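(* Let $\Omega\subset\mathbb{C}^d$ be a $\mathbb{C}$-proper convex open set. Suppose that for every sequence $u_n\in\Omega$ there exist a subsequence $n_k\to\infty$, complex affine maps $A_k\in\mathrm{Aff}(\mathbb{C}^d)$, a number $m>0$ and a $\mathbb{C}$-proper convex open set $\widehat{\Omega}$ such that (1) $A_k\Omega\to\widehat\Omega$ in the local Hausdorff topology, (2) $A_ku_{n_k}\to u_\infty$ for some $u_\infty\in\widehat\Omega$, (3) $(A_k\Omega)_{k\in\mathbb{N}}$ is a locally $m$-convex sequence, and (4) every geodesic of $(\widehat\Omega,d_{\widehat\Omega})$ is well behaved. Then $(\Omega,d_\Omega)$ is Gromov hyperbolic.
   Context: $\mathbb{C}$-proper: contains no complex affine line. $d_\Omega$ is the Kobayashi distance. Local Hausdorff topology: open convex $A_n\to A$ iff $d_H(\overline{A_n}\cap\overline{B_R(0)},\overline{A}\cap\overline{B_R(0)})\to0$ for all $R>0$. For an open set $\Omega$, $p\in\Omega$ and $v\neq0$, $\delta_\Omega(p)=\inf\{\|q-p\|:q\notin\Omega\}$ and $\delta_\Omega(p;v)=\inf\{\|q-p\|: q\in(p+\mathbb{C}v)\setminus\Omega\}$. A sequence $(\Omega_n)$ of $\mathbb{C}$-proper convex open sets is a locally $m$-convex sequence if for every $R>0$ there are $N,C>0$ with $\delta_{\Omega_n}(p;v)\le C\delta_{\Omega_n}(p)^{1/m}$ for all $n>N$, $p\in\Omega_n\cap B_R(0)$ and nonzero $v\in\mathbb{C}^d$. A geodesic $\sigma:\mathbb{R}\to\widehat\Omega$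 (i.e. $d_{\widehat\Omega}(\sigma(s),\sigma(t))=|s-t|$) is well behaved if $\lim_{t\to-\infty}\sigma(t)$ and $\lim_{t\to+\infty}\sigma(t)$ both exist in the one-point compactification $\mathbb{C}^d\cup\{\infty\}$ and are distinct. *)

theory Defs
  imports "HOL-Analysis.Analysis"
begin

definition C_proper :: "(complex ^ 'n) set \<Rightarrow> bool" where
  "C_proper \<Omega> \<longleftrightarrow> \<not> (\<exists>p v. v \<noteq> 0 \<and> (\<forall>c::complex. p + c *s v \<in> \<Omega>))"

definition holo_disc :: "(complex \<Rightarrow> complex ^ 'n) \<Rightarrow> bool" where
  "holo_disc f \<longleftrightarrow> (\<forall>i. (\<lambda>t. f t $ i) holomorphic_on ball 0 1)"

definition poinc0 :: "complex \<Rightarrow> real" where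
  "poinc0 z = artanh (cmod z)"

definition lempert :: "(complex ^ 'n) set \<Rightarrow> complex ^ 'n \<Rightarrow> complex ^ 'n \<Rightarrow> real" where
  "lempert \<Omega> z w = Inf {poinc0 \<zeta> | \<zeta>. cmod \<zeta> < 1 \<and>
      (\<exists>f. holo_disc f \<and> f ` ball 0 1 \<subseteq> \<Omega> \<and> f 0 = z \<and> f \<zeta> = w)}"

(* Kobayashi distance: largest pseudodistance below the Lempert function *)
definition kob_dist :: "(complex ^ 'n) set \<Rightarrow> complex ^ 'n \<Rightarrow> complex ^ 'n \<Rightarrow> real" where
  "kob_dist \<Omega> z w = Inf {(\<Sum>i<n. lempert \<Omega> (xs i) (xs (Suc i))) | xs n.
      xs 0 = z \<and> xs n = w \<and> (\<forall>i\<le>n. xs i \<in> \<Omega>)}"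

definition gromov_prod :: "('a \<Rightarrow> 'a \<Rightarrow> real) \<Rightarrow> 'a \<Rightarrow> 'a \<Rightarrow> 'a \<Rightarrow> real" where
  "gromov_prod d w x y = (d x w + d y w - d x y) / 2"

definition gromov_hyperbolic :: "'a set \<Rightarrow> ('a \<Rightarrow> 'a \<Rightarrow> real) \<Rightarrow> bool" where
  "gromov_hyperbolic X d \<longleftrightarrow> (\<exists>\<delta>\<ge>0. \<forall>w\<in>X. \<forall>x\<in>X. \<forall>y\<in>X. \<forall>z\<in>X.
      gromov_prod d w x z \<ge> min (gromov_prod d w x y) (gromov_prod d w y z) - \<delta>)"

definition aff_map :: "complex ^ 'n ^ 'n \<Rightarrow> complex ^ 'n \<Rightarrow> complex ^ 'n \<Rightarrow> complex ^ 'n" where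
  "aff_map M b z = M *v z + b"

(* local Hausdorff convergence: d_H(cl A_n \<inter> cball 0 R, cl A \<inter> cball 0 R) \<rightarrow> 0 for all R > 0,
   written out via the sup-inf definition (a nonempty vs empty set has infinite distance) *)
definition local_hausdorff_conv :: "(nat \<Rightarrow> 'a::euclidean_space set) \<Rightarrow> 'a set \<Rightarrow> bool" where
  "local_hausdorff_conv A B \<longleftrightarrow> (\<forall>R>0. \<forall>\<epsilon>>0. eventually (\<lambda>n.
      (\<forall>x\<in>closure (A n) \<inter> cball 0 R. \<exists>y\<in>closure B \<inter> cball 0 R. dist x y \<le> \<epsilon>) \<and>
      (\<forall>y\<in>closure B \<inter> cball 0 R. \<exists>x\<in>closure (A n) \<inter> cball 0 R. dist x y \<le> \<epsilon>)) sequentially)"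

definition bdist :: "(complex ^ 'n) set \<Rightarrow> complex ^ 'n \<Rightarrow> real" where
  "bdist \<Omega> p = infdist p (- \<Omega>)"

definition bdist_dir :: "(complex ^ 'n) set \<Rightarrow> complex ^ 'n \<Rightarrow> complex ^ 'n \<Rightarrow> real" where
  "bdist_dir \<Omega> p v = infdist p {q. (\<exists>c::complex. q = p + c *s v) \<and> q \<notin> \<Omega>}"

definition locally_m_convex_seq :: "real \<Rightarrow> (nat \<Rightarrow> (complex ^ 'n) set) \<Rightarrow> bool" where
  "locally_m_convex_seq m \<Omega>s \<longleftrightarrow> (\<forall>n. C_proper (\<Omega>s n) \<and> convex (\<Omega>s n) \<and> open (\<Omega>s n)) \<and>
     (\<forall>R>0. \<exists>N::nat. \<exists>C>0. \<forall>n>N. \<forall>p\<in>\<Omega>s n \<inter> ball 0 R. \<forall>v. v \<noteq> 0 \<longrightarrow>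
        bdist_dir (\<Omega>s n) p v \<le> C * bdist (\<Omega>s n) p powr (1 / m))"

definition is_geodesic :: "(complex ^ 'n) set \<Rightarrow> (real \<Rightarrow> complex ^ 'n) \<Rightarrow> bool" where
  "is_geodesic \<Omega> \<sigma> \<longleftrightarrow> (\<forall>t. \<sigma> t \<in> \<Omega>) \<and> (\<forall>s t. kob_dist \<Omega> (\<sigma> s) (\<sigma> t) = \<bar>s - t\<bar>)"

(* limit in the one-point compactification: None = \<infinity>, Some x = x *)
definition tends_opc :: "(real \<Rightarrow> 'a::real_normed_vector) \<Rightarrow> real filter \<Rightarrow> 'a option \<Rightarrow> bool" where
  "tends_opc \<sigma> F e = (case e of None \<Rightarrow> filterlim (\<lambda>t. norm (\<sigma> t)) at_top F
                              | Some x \<Rightarrow> (\<sigma> \<longlongrightarrow> x) F)"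

definition well_behaved :: "(real \<Rightarrow> 'a::real_normed_vector) \<Rightarrow> bool" where
  "well_behaved \<sigma> \<longleftrightarrow> (\<exists>e1 e2. tends_opc \<sigma> at_bot e1 \<and> tends_opc \<sigma> at_top e2 \<and> e1 \<noteq> e2)"

end

theory Submission
  imports Defs "HOL-Complex_Analysis.Riemann_Mapping"
begin

text \<open>
  If \<open>\<Omega>\<close> is not Gromov hyperbolic, there are ever fatter triangles of almost geodesics: a point
  \<open>u\<^sub>n\<close> on one side has distance more than \<open>n\<close> from the two other sides. Rescale along \<open>u\<^sub>n\<close>. The side
  through \<open>u\<^sub>n\<close> converges to a geodesic \<open>\<sigma>\<close> of the limit domain. Far from \<open>u\<^sub>n\<close> in the Kobayashi
  distance, the boundary distance decays exponentially, so local \<open>m\<close>-convexity makes the Euclidean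
  length of an almost geodesic that avoids a large Kobayashi ball about \<open>u\<^sub>n\<close> small inside any
  Euclidean ball. Walking from \<open>\<sigma> T\<close> to \<open>\<sigma> (- T)\<close> along the remaining parts of the triangle therefore
  moves at most \<open>\<epsilon>\<close>, unless both points are close to infinity. Hence both ends of \<open>\<sigma>\<close> have the same
  limit in the one-point compactification, so \<open>\<sigma>\<close> is not well behaved.

  Exact geodesics of \<open>\<Omega>\<close> and the infinitesimal Kobayashi metric are avoided: discrete almost
  geodesics with steps tending to zero suffice, and all estimates are made disc by disc along
  chains of holomorphic discs.
\<close>

section \<open>Chains of holomorphic discs\<close>

text \<open>Lower bounds for the Kobayashi distance come from supporting half-spaces and the Schwarz
  lemma, upper bounds from Euclidean balls inside the domain. The obstacle is the passage to the
  limit domain. Upper semicontinuity is easy, since slightly shrunk discs have compact image. In the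
  other direction a disc in \<open>A n\<close> may leave every bounded set, and outside bounded sets
  \<open>A n\<close> and its limit are unrelated. Short steps remove this: a disc joining two close
  points can be cut down to a concentric disc with bounded image at the cost of a factor near 1, and
  a factor, unlike an additive error, does not accumulate over the growing number of steps. The
  remaining image is only near the limit domain, hence an additional contraction towards
  \<open>u0\<close>. Local \<open>m\<close>-convexity enters twice: together with the exponential
  decay, and to keep Kobayashi balls of fixed radius about the base points in one compact subset of
  the limit domain.\<close>

definition cdom :: "(complex ^ 'n) set \<Rightarrow> bool" where
  "cdom \<Omega> \<longleftrightarrow> C_proper \<Omega> \<and> convex \<Omega> \<and> open \<Omega>"

text \<open>A length realised by a single disc. \<open>lempert\<close> is the infimum of such
  lengths and \<open>kob_dist\<close> that of the sums in \<open>kchain\<close>, so estimates are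
  proved for actual discs and chains, and infima are taken only at the end.\<close>

definition disc_step :: "(complex ^ 'n) set \<Rightarrow> complex ^ 'n \<Rightarrow> complex ^ 'n \<Rightarrow> real \<Rightarrow> bool" where
  "disc_step \<Omega> x y \<tau> \<longleftrightarrow> (\<exists>f \<zeta>. cmod \<zeta> < 1 \<and> holo_disc f \<and> f ` ball 0 1 \<subseteq> \<Omega> \<and>
     f 0 = x \<and> f \<zeta> = y \<and> \<tau> = poinc0 \<zeta>)"

inductive kchain :: "(complex ^ 'n) set \<Rightarrow> complex ^ 'n \<Rightarrow> complex ^ 'n \<Rightarrow> real \<Rightarrow> bool"
  for \<Omega> where
  Nil: "x \<in> \<Omega> \<Longrightarrow> kchain \<Omega> x x 0"
| Cons: "disc_step \<Omega> x y \<tau> \<Longrightarrow> kchain \<Omega> y z S \<Longrightarrow> kchain \<Omega> x z (\<tau> + S)"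

lemma holo_disc_compose:
  assumes "holo_disc f" "g holomorphic_on ball 0 1" "g ` ball 0 1 \<subseteq> ball 0 1"
  shows "holo_disc (\<lambda>z. f (g z))"
proof -
  have "((\<lambda>t. f t $ i) \<circ> g) holomorphic_on ball 0 1" for i
    using assms by (intro holomorphic_on_compose_gen[where t = "ball 0 1"])
      (auto simp: holo_disc_def image_subset_iff_funcset)
  then show ?thesis
    by (simp add: holo_disc_def o_def)
qed

lemma holo_disc_line:
  assumes "h holomorphic_on ball 0 1"
  shows "holo_disc (\<lambda>z. p + h z *s v)"
  unfolding holo_disc_def using assms by (auto intro!: holomorphic_intros)

lemma disc_step_compose:
  assumes "holo_disc f" "f ` ball 0 1 \<subseteq> \<Omega>" "g holomorphic_on ball 0 1" "g ` ball 0 1 \<subseteq> ball 0 1"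
    "f (g 0) = x" "f (g \<zeta>) = y" "cmod \<zeta> < 1" "\<tau> = artanh (cmod \<zeta>)"
  shows "disc_step \<Omega> x y \<tau>"
  unfolding disc_step_def poinc0_def
  by (rule exI[of _ "\<lambda>z. f (g z)"], rule exI[of _ \<zeta>]) (use assms holo_disc_compose in fastforce)

lemma Moebius_ball: "cmod w < 1 \<Longrightarrow> Moebius_function 0 w ` ball 0 1 \<subseteq> ball 0 1"
  by (auto intro: Moebius_function_norm_lt_1)

text \<open>Precomposition with the disc automorphism that sends 0 to \<open>\<zeta>\<close> and
  \<open>- \<zeta>\<close> to 0; the length depends only on the modulus.\<close>

lemma disc_step_sym:
  assumes "disc_step \<Omega> x y \<tau>"
  shows "disc_step \<Omega> y x \<tau>"
proof -
  obtain f \<zeta> where f: "cmod \<zeta> < 1" "holo_disc f" "f ` ball 0 1 \<subseteq> \<Omega>" "f 0 = x" "f \<zeta> = y"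
    "\<tau> = poinc0 \<zeta>"
    using assms by (auto simp: disc_step_def)
  show ?thesis
    by (rule disc_step_compose[where f = f and g = "Moebius_function 0 (-\<zeta>)" and \<zeta> = "-\<zeta>"])
      (use f in \<open>auto simp: Moebius_function_holomorphic Moebius_function_norm_lt_1
        Moebius_function_of_zero Moebius_function_eq_zero poinc0_def\<close>)
qed

lemma disc_step_normal:
  assumes "disc_step \<Omega> x y \<tau>"
  obtains f r where "0 \<le> r" "r < 1" "holo_disc f" "f ` ball 0 1 \<subseteq> \<Omega>" "f 0 = x"
    "f (complex_of_real r) = y" "\<tau> = artanh r"
proof -
  obtain f \<zeta> where f: "cmod \<zeta> < 1" "holo_disc f" "f ` ball 0 1 \<subseteq> \<Omega>" "f 0 = x" "f \<zeta> = y"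
    "\<tau> = poinc0 \<zeta>"
    using assms by (auto simp: disc_step_def)
  \<comment> \<open>\<open>sgn 0 = 0\<close> is not unimodular, hence the separate value 1.\<close>
  define e where "e = (if \<zeta> = 0 then 1 else sgn \<zeta>)"
  have e: "cmod e = 1" "e * complex_of_real (cmod \<zeta>) = \<zeta>"
    by (auto simp: e_def norm_sgn sgn_eq norm_divide)
  have b: "(\<lambda>z. e * z) ` ball 0 1 \<subseteq> ball 0 1"
    using e by (auto simp: norm_mult)
  show ?thesis
  proof (rule that)
    show "holo_disc (\<lambda>z. f (e * z))"
      by (rule holo_disc_compose[OF f(2) _ b]) (intro holomorphic_intros)
    show "(\<lambda>z. f (e * z)) ` ball 0 1 \<subseteq> \<Omega>"
      using b f(3) by fastforce
  qed (use f e in \<open>auto simp: poinc0_def\<close>)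
qed

lemma artanh_mono: "0 \<le> x \<Longrightarrow> x \<le> y \<Longrightarrow> y < 1 \<Longrightarrow> artanh x \<le> artanh (y::real)"
  unfolding artanh_def by (simp add: frac_le)

lemma artanh_nonneg: "0 \<le> x \<Longrightarrow> x < 1 \<Longrightarrow> 0 \<le> artanh (x::real)"
  using artanh_mono[of 0 x] by simp

lemma tanh_artanh: "-1 < x \<Longrightarrow> x < 1 \<Longrightarrow> tanh (artanh x) = (x::real)"
proof -
  assume x: "-1 < x" "x < 1"
  have e: "exp (- 2 * artanh x) = (1 - x) / (1 + x)"
    using x by (simp add: artanh_def exp_minus exp_ln)
  have "1 + (1 - x) / (1 + x) = 2 / (1 + x)" "1 - (1 - x) / (1 + x) = 2 * x / (1 + x)"
    using x by (auto simp: field_simps)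
  then show ?thesis
    using x unfolding tanh_real_altdef e by simp
qed

lemma disc_step_nonneg: "disc_step \<Omega> x y \<tau> \<Longrightarrow> 0 \<le> \<tau>"
  by (auto simp: disc_step_def poinc0_def artanh_nonneg)

lemma disc_step_mem:
  assumes "disc_step \<Omega> x y \<tau>" shows "x \<in> \<Omega>" "y \<in> \<Omega>"
  using assms by (force simp: disc_step_def)+

text \<open>The real diameter of the disc is a geodesic and can be cut at any intermediate length:
  the addition formula for \<open>tanh\<close> is the Moebius translation that moves 0 to
  \<open>a\<close> and \<open>b\<close> to \<open>r\<close>.\<close>

lemma disc_step_split:
  assumes "disc_step \<Omega> x y \<tau>" "0 \<le> s" "s \<le> \<tau>"
  obtains w where "disc_step \<Omega> x w s" "disc_step \<Omega> w y (\<tau> - s)"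
proof -
  obtain f r where f: "0 \<le> r" "r < 1" "holo_disc f" "f ` ball 0 1 \<subseteq> \<Omega>" "f 0 = x"
    "f (complex_of_real r) = y" "\<tau> = artanh r"
    using disc_step_normal[OF assms(1)] .
  define a where "a = tanh s"
  define b where "b = tanh (\<tau> - s)"
  have r: "r = tanh \<tau>" using f by (simp add: tanh_artanh)
  have a: "0 \<le> a" "a < 1" "s = artanh a"
    using assms by (auto simp: a_def artanh_tanh_real tanh_real_lt_1)
  have b: "0 \<le> b" "b < 1" "\<tau> - s = artanh b"
    using assms by (auto simp: b_def artanh_tanh_real tanh_real_lt_1)
  have ab: "a * b > -1" using a b by (smt (verit) mult_nonneg_nonneg)
  have "tanh (s + (\<tau> - s)) = (a + b) / (1 + a * b)"
    unfolding a_def b_def by (rule tanh_add) (auto simp: cosh_real_nonzero)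
  then have rr: "(a + b) / (1 + a * b) = r" using r by simp
  let ?g = "Moebius_function 0 (- complex_of_real a)"
  have ca: "cmod (- complex_of_real a) < 1" using a by simp
  have "?g (complex_of_real b) = complex_of_real ((a + b) / (1 + a * b))"
    by (simp add: Moebius_function_simple add.commute)
  then have g: "?g 0 = complex_of_real a" "?g (complex_of_real b) = complex_of_real r"
    using rr by (auto simp: Moebius_function_of_zero)
  show ?thesis
  proof
    show "disc_step \<Omega> x (f (complex_of_real a)) s"
      by (rule disc_step_compose[where f = f and g = "\<lambda>z. z" and \<zeta> = "complex_of_real a"])
         (use f a in \<open>auto intro!: holomorphic_intros\<close>)
    show "disc_step \<Omega> (f (complex_of_real a)) y (\<tau> - s)"
      by (rule disc_step_compose[where f = f and g = ?g and \<zeta> = "complex_of_real b"])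
         (use Moebius_ball[OF ca] Moebius_function_holomorphic[OF ca] in \<open>simp_all only: g f(3,4,6) b\<close>,
          use b in auto)
  qed
qed

lemma C_proper_slice:
  assumes "C_proper \<Omega>" "v \<noteq> 0"
  shows "\<exists>c. p + c *s v \<notin> \<Omega>"
  using assms by (auto simp: C_proper_def)

lemma open_slice:
  fixes \<Omega> :: "(complex ^ 'n) set"
  assumes "open \<Omega>" shows "open {c. p + c *s v \<in> \<Omega>}"
proof -
  have c: "continuous_on UNIV (\<lambda>c::complex. p + c *s v)"
    unfolding vector_scalar_mult_def by (intro continuous_intros)
  have "{c. p + c *s v \<in> \<Omega>} = (\<lambda>c. p + c *s v) -` \<Omega>" by auto
  then show ?thesis
    using continuous_on_open_vimage[of UNIV "\<lambda>c::complex. p + c *s v"] c assms by auto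
qed

lemma convex_slice:
  fixes \<Omega> :: "(complex ^ 'n) set"
  assumes "convex \<Omega>" shows "convex {c. p + c *s v \<in> \<Omega>}"
proof (rule convexI, unfold mem_Collect_eq)
  fix x y :: complex and a b :: real
  assume *: "p + x *s v \<in> \<Omega>" "p + y *s v \<in> \<Omega>" "0 \<le> a" "0 \<le> b" "a + b = 1"
  have "p + (a *\<^sub>R x + b *\<^sub>R y) *s v = a *\<^sub>R (p + x *s v) + b *\<^sub>R (p + y *s v)"
  proof -
    have "b = 1 - a" using *(5) by simp
    then show ?thesis
      by (simp add: vec_eq_iff) (simp add: scaleR_conv_of_real algebra_simps)
  qed
  with * show "p + (a *\<^sub>R x + b *\<^sub>R y) *s v \<in> \<Omega>"
    using convexD[OF assms] by metis
qed

lemma disc_step_refl: "x \<in> \<Omega> \<Longrightarrow> disc_step \<Omega> x x 0"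
  unfolding disc_step_def
  by (rule exI[of _ "\<lambda>_. x"], rule exI[of _ 0]) (auto simp: holo_disc_def poinc0_def)

text \<open>
  Without a disc through \<open>x\<close> and \<open>y\<close>, \<^const>\<open>lempert\<close> would be the junk value \<open>Inf {}\<close>. The Riemann map
  of the slice of \<open>\<Omega>\<close> by the complex line through \<open>x\<close> and \<open>y\<close> provides one.
\<close>

lemma disc_step_ex:
  assumes \<Omega>: "cdom \<Omega>" and xy: "x \<in> \<Omega>" "y \<in> \<Omega>"
  shows "\<exists>\<tau>. disc_step \<Omega> x y \<tau>"
proof (cases "x = y")
  case True then show ?thesis using disc_step_refl xy by blast
next
  case False
  define S where "S = {c::complex. x + c *s (y - x) \<in> \<Omega>}"
  have S: "open S" "convex S" "0 \<in> S" "1 \<in> S"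
    using \<Omega> xy unfolding S_def cdom_def by (blast intro: open_slice convex_slice, blast intro: open_slice convex_slice, auto)
  have "S \<noteq> UNIV"
    using C_proper_slice[of \<Omega> "y - x" x] False \<Omega> by (auto simp: S_def cdom_def)
  then obtain f g where fg: "f holomorphic_on S" "g holomorphic_on ball 0 1"
    "\<forall>z \<in> S. f z \<in> ball 0 1 \<and> g (f z) = z" "\<forall>z \<in> ball 0 1. g z \<in> S \<and> f (g z) = z"
    using simply_connected_eq_biholomorphic_to_disc[OF S(1)] convex_imp_simply_connected[OF S(2)] S(3)
    by blast
  have f: "cmod (f 0) < 1" "cmod (f 1) < 1" "g (f 0) = 0" "g (f 1) = 1" using fg S by auto
  have n: "cmod (- f 0) < 1" using f by simp
  \<comment> \<open>The Riemann map need not send 0 to 0; a Moebius map recentres the disc at the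
    parameter \<open>f 0\<close> of \<open>x\<close>.\<close>
  have e: "Moebius_function 0 (- f 0) (Moebius_function 0 (f 0) (f 1)) = f 1"
    by (rule Moebius_function_compose) (use f in auto)
  have m: "Moebius_function 0 (- f 0) 0 = f 0"
    by (simp add: Moebius_function_of_zero)
  show ?thesis
  proof (rule exI, rule disc_step_compose[where f = "\<lambda>z. x + g z *s (y - x)" and
       g = "Moebius_function 0 (- f 0)" and \<zeta> = "Moebius_function 0 (f 0) (f 1)"])
    show "holo_disc (\<lambda>z. x + g z *s (y - x))" by (rule holo_disc_line[OF fg(2)])
    show "(\<lambda>z. x + g z *s (y - x)) ` ball 0 1 \<subseteq> \<Omega>"
      using fg(4) by (auto simp: S_def)
    show "cmod (Moebius_function 0 (f 0) (f 1)) < 1"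
      using f Moebius_function_norm_lt_1 by blast
  qed (use n Moebius_ball Moebius_function_holomorphic in \<open>auto simp: m e f\<close>)
qed

lemma kchain_mem: "kchain \<Omega> x y S \<Longrightarrow> x \<in> \<Omega> \<and> y \<in> \<Omega>"
  by (induction rule: kchain.induct) (auto simp: disc_step_mem)

lemma kchain_nonneg: "kchain \<Omega> x y S \<Longrightarrow> 0 \<le> S"
  by (induction rule: kchain.induct) (auto dest: disc_step_nonneg)

lemma kchain_trans: "kchain \<Omega> x y S \<Longrightarrow> kchain \<Omega> y z T \<Longrightarrow> kchain \<Omega> x z (S + T)"
proof (induction rule: kchain.induct)
  case (Cons x y \<tau> z' S)
  then show ?case using kchain.Cons[of \<Omega> x y \<tau> z "S + T"] by (simp add: add.assoc)
qed simp

lemma kchain_single: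
  assumes "disc_step \<Omega> x y \<tau>" shows "kchain \<Omega> x y \<tau>"
  using kchain.Cons[OF assms kchain.Nil[OF disc_step_mem(2)[OF assms]]] by simp

lemma kchain_sym: "kchain \<Omega> x y S \<Longrightarrow> kchain \<Omega> y x S"
proof (induction rule: kchain.induct)
  case (Cons x y \<tau> z S)
  then show ?case
    using kchain_trans[OF Cons.IH kchain_single[OF disc_step_sym[OF Cons.hyps(1)]]] by (simp add: add.commute)
qed (auto intro: kchain.Nil)

text \<open>Follow the chain until the length \<open>a\<close> is used up. The cut may fall inside a
  disc, which then has to be split itself.\<close>

lemma kchain_split:
  assumes "kchain \<Omega> x y S" "S < a + b" "0 < a" "0 < b"
  shows "\<exists>w S1 S2. kchain \<Omega> x w S1 \<and> kchain \<Omega> w y S2 \<and> S1 < a \<and> S2 < b"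
  using assms
proof (induction arbitrary: a rule: kchain.induct)
  case (Nil x)
  then show ?case by (meson kchain.Nil)
next
  case (Cons x y \<tau> z S)
  show ?case
  proof (cases "\<tau> < a")
    case True
    then obtain w S1 S2 where "kchain \<Omega> y w S1" "kchain \<Omega> w z S2" "S1 < a - \<tau>" "S2 < b"
      using Cons.IH[of "a - \<tau>"] Cons.prems by auto
    then show ?thesis using kchain.Cons[OF Cons.hyps(1)]
      by (metis less_diff_eq add.commute)
  next
    case False
    \<comment> \<open>The requirements are \<open>s < a\<close> and
      \<open>s > \<tau> + S - b\<close>; the midpoint of this interval, cut off at 0.\<close>
    define s where "s = max 0 ((\<tau> + S - b + a) / 2)"
    have "0 \<le> S" using Cons.hyps(2) kchain_nonneg by auto
    then have s: "0 \<le> s" "s \<le> \<tau>" "s < a" "\<tau> - s + S < b"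
      using False Cons.prems by (auto simp: s_def max_def field_simps)
    obtain w where "disc_step \<Omega> x w s" "disc_step \<Omega> w y (\<tau> - s)"
      using disc_step_split[OF Cons.hyps(1) s(1,2)] .
    then show ?thesis using s kchain_single kchain.Cons Cons.hyps by meson
  qed
qed

section \<open>The Kobayashi distance as an infimum over chains\<close>

lemma lempert_alt: "lempert \<Omega> x y = Inf {\<tau>. disc_step \<Omega> x y \<tau>}"
  unfolding lempert_def disc_step_def by (rule arg_cong[where f = Inf]) auto

lemma lempert_le: "disc_step \<Omega> x y \<tau> \<Longrightarrow> lempert \<Omega> x y \<le> \<tau>"
  unfolding lempert_alt by (rule cInf_lower) (auto intro!: bdd_belowI[of _ 0] disc_step_nonneg)

lemma lempert_nonneg:
  assumes "cdom \<Omega>" "x \<in> \<Omega>" "y \<in> \<Omega>"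
  shows "0 \<le> lempert \<Omega> x y"
  unfolding lempert_alt by (rule cInf_greatest) (use disc_step_ex[OF assms] in \<open>auto intro: disc_step_nonneg\<close>)

lemma lempert_approx:
  assumes "cdom \<Omega>" "x \<in> \<Omega>" "y \<in> \<Omega>" "e > 0"
  shows "\<exists>\<tau>. disc_step \<Omega> x y \<tau> \<and> \<tau> < lempert \<Omega> x y + e"
  using cInf_lessD[of "{\<tau>. disc_step \<Omega> x y \<tau>}" "lempert \<Omega> x y + e"] disc_step_ex[OF assms(1-3)] assms(4)
  unfolding lempert_alt by auto

lemma bdd_below_kob:
  assumes "cdom \<Omega>"
  shows "bdd_below {(\<Sum>i<n. lempert \<Omega> (xs i) (xs (Suc i))) | xs n.
      xs 0 = z \<and> xs n = w \<and> (\<forall>i\<le>n. xs i \<in> \<Omega>)}"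
  by (rule bdd_belowI[of _ 0]) (auto intro!: sum_nonneg lempert_nonneg[OF assms])

lemma kchain_lempert_sum:
  "kchain \<Omega> x y S \<Longrightarrow> \<exists>xs n. xs 0 = x \<and> xs n = y \<and> (\<forall>i\<le>n. xs i \<in> \<Omega>) \<and>
     (\<Sum>i<n. lempert \<Omega> (xs i) (xs (Suc i))) \<le> S"
proof (induction rule: kchain.induct)
  case (Nil x)
  then show ?case by (intro exI[of _ "\<lambda>_. x"] exI[of _ 0]) auto
next
  case (Cons x y \<tau> z S)
  then obtain xs n where xs: "xs 0 = y" "xs n = z" "\<forall>i\<le>n. xs i \<in> \<Omega>"
    "(\<Sum>i<n. lempert \<Omega> (xs i) (xs (Suc i))) \<le> S" by blast
  show ?case
    by (rule exI[of _ "case_nat x xs"], rule exI[of _ "Suc n"])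
      (use xs Cons.hyps(1) lempert_le[OF Cons.hyps(1)] in
       \<open>auto simp: sum.lessThan_Suc_shift disc_step_mem split: nat.split simp del: sum.lessThan_Suc\<close>)
qed

lemma kob_dist_le:
  assumes "cdom \<Omega>" "kchain \<Omega> x y S"
  shows "kob_dist \<Omega> x y \<le> S"
proof -
  obtain xs n where xs: "xs 0 = x" "xs n = y" "\<forall>i\<le>n. xs i \<in> \<Omega>"
    "(\<Sum>i<n. lempert \<Omega> (xs i) (xs (Suc i))) \<le> S" using kchain_lempert_sum[OF assms(2)] by blast
  have "kob_dist \<Omega> x y \<le> (\<Sum>i<n. lempert \<Omega> (xs i) (xs (Suc i)))"
    unfolding kob_dist_def by (rule cInf_lower[OF _ bdd_below_kob[OF assms(1)]]) (use xs in blast)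
  with xs show ?thesis by simp
qed

lemma lempert_sum_kchain:
  assumes "cdom \<Omega>"
  shows "\<forall>i\<le>n. xs i \<in> \<Omega> \<Longrightarrow> e > 0 \<Longrightarrow>
    \<exists>S. kchain \<Omega> (xs 0) (xs n) S \<and> S < (\<Sum>i<n. lempert \<Omega> (xs i) (xs (Suc i))) + e"
proof (induction n arbitrary: e)
  case 0
  then show ?case by (auto intro: kchain.Nil)
next
  case (Suc n)
  obtain S where S: "kchain \<Omega> (xs 0) (xs n) S" "S < (\<Sum>i<n. lempert \<Omega> (xs i) (xs (Suc i))) + e/2"
    using Suc.IH[of "e/2"] Suc.prems by auto
  obtain \<tau> where \<tau>: "disc_step \<Omega> (xs n) (xs (Suc n)) \<tau>" "\<tau> < lempert \<Omega> (xs n) (xs (Suc n)) + e/2"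
    using lempert_approx[OF assms, of "xs n" "xs (Suc n)" "e/2"] Suc.prems by auto
  show ?case
    by (rule exI[of _ "S + \<tau>"]) (use kchain_trans[OF S(1) kchain_single[OF \<tau>(1)]] S \<tau> in auto)
qed

text \<open>Converse of \<open>kob_dist_le\<close>. The set of sums is nonempty because any two
  points are joined by a disc; otherwise the real \<open>Inf\<close> would carry no
  information.\<close>

lemma kob_dist_less:
  assumes "cdom \<Omega>" "x \<in> \<Omega>" "y \<in> \<Omega>" "kob_dist \<Omega> x y < T"
  shows "\<exists>S<T. kchain \<Omega> x y S"
proof -
  let ?A = "{(\<Sum>i<n. lempert \<Omega> (xs i) (xs (Suc i))) | xs n.
      xs 0 = x \<and> xs n = y \<and> (\<forall>i\<le>n. xs i \<in> \<Omega>)}"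
  obtain \<tau> where "disc_step \<Omega> x y \<tau>" using disc_step_ex assms by blast
  from kchain_lempert_sum[OF kchain_single[OF this]] have "?A \<noteq> {}" by blast
  then obtain xs n where xs: "xs 0 = x" "xs n = y" "\<forall>i\<le>n. xs i \<in> \<Omega>"
    "(\<Sum>i<n. lempert \<Omega> (xs i) (xs (Suc i))) < T"
    using cInf_lessD[of ?A T] assms(4) unfolding kob_dist_def by blast
  show ?thesis
    using lempert_sum_kchain[OF assms(1) xs(3), of "T - (\<Sum>i<n. lempert \<Omega> (xs i) (xs (Suc i)))"] xs by auto
qed

lemma kob_dist_nonneg:
  assumes "cdom \<Omega>" "x \<in> \<Omega>" "y \<in> \<Omega>"
  shows "0 \<le> kob_dist \<Omega> x y"
  using kob_dist_less[OF assms, of 0] kchain_nonneg by (meson not_le)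

lemma kob_dist_self:
  assumes "cdom \<Omega>" "x \<in> \<Omega>" shows "kob_dist \<Omega> x x = 0"
  using kob_dist_le[OF assms(1) kchain.Nil[OF assms(2)]] kob_dist_nonneg[OF assms assms(2)] by simp

lemma kob_dist_leI:
  assumes "cdom \<Omega>" "x \<in> \<Omega>" "y \<in> \<Omega>" "\<And>S. kchain \<Omega> x y S \<Longrightarrow> c \<le> S"
  shows "c \<le> kob_dist \<Omega> x y"
  using kob_dist_less[OF assms(1-3), of c] assms(4) by (meson not_le)

lemma kob_dist_sym:
  assumes "cdom \<Omega>" "x \<in> \<Omega>" "y \<in> \<Omega>"
  shows "kob_dist \<Omega> x y = kob_dist \<Omega> y x"
  by (rule antisym; rule kob_dist_leI) (auto intro!: kob_dist_le assms kchain_sym)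

lemma kob_dist_triangle:
  assumes "cdom \<Omega>" "x \<in> \<Omega>" "y \<in> \<Omega>" "z \<in> \<Omega>"
  shows "kob_dist \<Omega> x z \<le> kob_dist \<Omega> x y + kob_dist \<Omega> y z"
proof -
  have "kob_dist \<Omega> x z - S \<le> kob_dist \<Omega> y z" if "kchain \<Omega> x y S" for S
    by (rule kob_dist_leI) (use kob_dist_le[OF assms(1) kchain_trans[OF that]] assms in \<open>auto simp: algebra_simps\<close>)
  then have "kob_dist \<Omega> x z - kob_dist \<Omega> y z \<le> kob_dist \<Omega> x y"
    by (intro kob_dist_leI) (use assms in \<open>auto simp: algebra_simps\<close>)
  then show ?thesis by simp
qed

text \<open>Replaces points on an exact geodesic: intermediate points with arbitrarily small
  excess.\<close>

lemma kob_dist_split: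
  assumes "cdom \<Omega>" "x \<in> \<Omega>" "y \<in> \<Omega>" "kob_dist \<Omega> x y < a + b" "0 < a" "0 < b"
  obtains w where "w \<in> \<Omega>" "kob_dist \<Omega> x w < a" "kob_dist \<Omega> w y < b"
proof -
  obtain S where "S < a + b" "kchain \<Omega> x y S" using kob_dist_less[OF assms(1-4)] by blast
  then obtain w S1 S2 where "kchain \<Omega> x w S1" "kchain \<Omega> w y S2" "S1 < a" "S2 < b"
    using kchain_split assms(5,6) by blast
  then show ?thesis
    by (metis that kchain_mem kob_dist_le[OF assms(1)] order.strict_trans1)
qed

text \<open>Holomorphy of \<open>F\<close> enters only through its action on discs, which is
  immediate for affine maps.\<close>

lemma kob_dist_contract:
  assumes \<Omega>: "cdom \<Omega>" "cdom \<Omega>'" and F: "\<And>f. holo_disc f \<Longrightarrow> holo_disc (\<lambda>z. F (f z))" "F ` \<Omega> \<subseteq> \<Omega>'"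
    and xy: "x \<in> \<Omega>" "y \<in> \<Omega>"
  shows "kob_dist \<Omega>' (F x) (F y) \<le> kob_dist \<Omega> x y"
proof -
  have *: "disc_step \<Omega>' (F x) (F y) \<tau>" if "disc_step \<Omega> x y \<tau>" for x y \<tau>
    using that unfolding disc_step_def
    apply (elim exE)
    subgoal for f \<zeta>
      by (rule exI[of _ "\<lambda>z. F (f z)"], rule exI[of _ \<zeta>]) (use F in \<open>auto simp: image_subset_iff\<close>)
    done
  have "kchain \<Omega>' (F x) (F y) S" if "kchain \<Omega> x y S" for S
    using that by (induction rule: kchain.induct) (use F(2) in \<open>auto intro: kchain.Nil kchain.Cons[OF *]\<close>)
  then show ?thesis by (intro kob_dist_leI) (auto intro!: kob_dist_le \<Omega> xy)
qed

lemma norm_vector_smult: "norm (z *s v) = cmod z * norm v"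
  for v :: "complex ^ 'n"
  by (simp add: norm_vec_def L2_set_def norm_mult power_mult_distrib flip: sum_distrib_left)
     (simp add: real_sqrt_mult)

lemma disc_step_ball:
  assumes "ball p s \<subseteq> \<Omega>" "dist p q < s"
  shows "disc_step \<Omega> p q (artanh (dist p q / s))"
proof (cases "p = q")
  case True
  with assms have "p \<in> \<Omega>" by (auto simp: subset_iff)
  then show ?thesis using True disc_step_refl by auto
next
  case False
  define v where "v = (s / dist p q) *\<^sub>R (q - p)"
  have s: "s > 0" using assms(2) by (meson order.strict_trans1 zero_le_dist)
  have nv: "norm v = s" using False s by (simp add: v_def dist_norm norm_minus_commute)
  have im: "(\<lambda>z. p + z *s v) ` ball 0 1 \<subseteq> \<Omega>"
  proof -
    have "p + z *s v \<in> ball p s" if "cmod z < 1" for z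
      using that s by (simp add: dist_norm norm_vector_smult nv)
    with assms(1) show ?thesis by auto
  qed
  have e: "p + complex_of_real (dist p q / s) *s v = q"
    using False s by (simp add: v_def vec_eq_iff del: of_real_divide) (simp add: scaleR_conv_of_real)
  show ?thesis
    unfolding disc_step_def poinc0_def
    by (rule exI[of _ "\<lambda>z. p + z *s v"], rule exI[of _ "complex_of_real (dist p q / s)"])
      (use im e s assms(2) in \<open>auto intro!: holo_disc_line holomorphic_intros simp: norm_divide simp del: of_real_divide\<close>)
qed

lemma kob_dist_ball:
  assumes "cdom \<Omega>" "ball p s \<subseteq> \<Omega>" "dist p q < s"
  shows "kob_dist \<Omega> p q \<le> artanh (dist p q / s)"
  by (rule kob_dist_le[OF assms(1) kchain_single[OF disc_step_ball[OF assms(2,3)]]])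

section \<open>Supporting hyperplanes and the boundary distance\<close>

text \<open>The complex linear functional with real part \<open>a \<bullet> x\<close>. It maps a
  domain on one side of a real hyperplane into a half plane, where the Schwarz lemma
  applies.\<close>

definition hform :: "complex ^ 'n \<Rightarrow> complex ^ 'n \<Rightarrow> complex" where
  "hform a x = (\<Sum>i\<in>UNIV. cnj (a $ i) * x $ i)"

lemma Re_hform: "Re (hform a x) = a \<bullet> x"
  by (simp add: hform_def inner_vec_def inner_complex_def)

lemma hform_diff: "hform a (x - y) = hform a x - hform a y"
  by (simp add: hform_def algebra_simps sum_subtractf)

lemma hform_smult: "hform a (c *s x) = c * hform a x"
  by (simp add: hform_def sum_distrib_left mult.left_commute)

lemma hform_holomorphic: "holo_disc f \<Longrightarrow> (\<lambda>z. hform a (f z)) holomorphic_on ball 0 1"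
  unfolding hform_def holo_disc_def by (auto intro!: holomorphic_intros)

text \<open>The Schwarz lemma after the Cayley map \<open>w / (2 * g - w)\<close> of
  \<open>w = h z - h 0\<close>, which takes the half plane \<open>Re w < g\<close> to the unit disc
  and fixes 0.\<close>

lemma half_plane_Schwarz:
  assumes h: "h holomorphic_on ball 0 1" and lt: "\<And>z. cmod z < 1 \<Longrightarrow> Re (h z) < t"
    and \<zeta>: "cmod \<zeta> < 1"
  shows "cmod (h \<zeta> - h 0) * (1 - cmod \<zeta>) \<le> 2 * cmod \<zeta> * (t - Re (h 0))"
proof -
  define g where "g = t - Re (h 0)"
  have g: "g > 0" using lt[of 0] by (simp add: g_def)
  define \<phi> where "\<phi> z = (h z - h 0) / (2 * of_real g - (h z - h 0))" for z
  have lt': "cmod (h z - h 0) < cmod (2 * of_real g - (h z - h 0))" if "cmod z < 1" for z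
  proof -
    have "Re (h z - h 0) < g" using lt[OF that] by (simp add: g_def)
    then have "0 < 4 * g * (g - Re (h z - h 0))" using g by simp
    then have "(cmod (h z - h 0))\<^sup>2 < (cmod (2 * of_real g - (h z - h 0)))\<^sup>2"
      unfolding cmod_power2 by (simp add: power2_eq_square algebra_simps)
    then show ?thesis by (rule power2_less_imp_less) simp
  qed
  have nz: "2 * of_real g - (h z - h 0) \<noteq> 0" if "cmod z < 1" for z
    using lt'[OF that] by (metis norm_not_less_zero norm_zero)
  have hol: "\<phi> holomorphic_on ball 0 1"
    unfolding \<phi>_def using h nz by (auto intro!: holomorphic_intros)
  have "cmod (\<phi> z) < 1" if "cmod z < 1" for z
    using lt'[OF that] nz[OF that] by (simp add: \<phi>_def norm_divide divide_less_eq)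
  then have "cmod (\<phi> \<zeta>) \<le> cmod \<zeta>"
    using Schwarz_Lemma(1)[OF hol _ _ \<zeta>] by (simp add: \<phi>_def)
  then have "cmod (h \<zeta> - h 0) \<le> cmod \<zeta> * cmod (2 * of_real g - (h \<zeta> - h 0))"
    using nz[OF \<zeta>] by (simp add: \<phi>_def norm_divide divide_le_eq)
  also have "\<dots> \<le> cmod \<zeta> * (2 * g + cmod (h \<zeta> - h 0))"
    using norm_triangle_ineq4[of "2 * complex_of_real g" "h \<zeta> - h 0"] g
    by (intro mult_left_mono) (auto simp: norm_mult)
  finally show ?thesis by (simp add: g_def algebra_simps)
qed

lemma exp_two_artanh:
  assumes "0 \<le> r" "r < 1" shows "exp (2 * artanh r) = (1 + r) / (1 - r :: real)"
  using assms by (simp add: artanh_def)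

lemma disc_step_hform:
  assumes "\<And>x. x \<in> \<Omega> \<Longrightarrow> a \<bullet> x < t" "disc_step \<Omega> x y \<tau>"
  shows "cmod (hform a y - hform a x) \<le> (exp (2 * \<tau>) - 1) * (t - a \<bullet> x)"
proof -
  obtain f \<zeta> where f: "cmod \<zeta> < 1" "holo_disc f" "f ` ball 0 1 \<subseteq> \<Omega>" "f 0 = x" "f \<zeta> = y"
    "\<tau> = poinc0 \<zeta>"
    using assms by (auto simp: disc_step_def)
  have "f z \<in> \<Omega>" if "cmod z < 1" for z using that f(3) by auto
  then have *: "cmod (hform a y - hform a x) * (1 - cmod \<zeta>) \<le> 2 * cmod \<zeta> * (t - a \<bullet> x)"
    using half_plane_Schwarz[OF hform_holomorphic[OF f(2)], of a t \<zeta>] f assms(1) by (auto simp: Re_hform)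
  have e: "exp (2 * \<tau>) - 1 = 2 * cmod \<zeta> / (1 - cmod \<zeta>)"
    using f exp_two_artanh[of "cmod \<zeta>"] by (simp add: poinc0_def field_simps)
  show ?thesis unfolding e using * f(1) by (simp add: field_simps)
qed

text \<open>
  Along a chain the distance \<open>t - a \<bullet> x\<close> to the hyperplane grows at most by the factors \<open>exp (2 * \<tau>)\<close>,
  so the bounds for the single discs telescope.
\<close>

lemma kchain_hform:
  assumes a: "\<And>x. x \<in> \<Omega> \<Longrightarrow> a \<bullet> x < t" and "kchain \<Omega> x y S"
  shows "cmod (hform a y - hform a x) \<le> (exp (2 * S) - 1) * (t - a \<bullet> x)"
  using assms(2)
proof (induction rule: kchain.induct)
  case (Cons x y \<tau> z S)
  have 1: "cmod (hform a y - hform a x) \<le> (exp (2 * \<tau>) - 1) * (t - a \<bullet> x)"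
    by (rule disc_step_hform[OF a Cons.hyps(1)])
  have "a \<bullet> x - a \<bullet> y \<le> cmod (hform a y - hform a x)"
    by (metis Re_hform abs_Re_le_cmod abs_le_D2 minus_complex.simps(1) minus_diff_eq)
  with 1 have 2: "t - a \<bullet> y \<le> exp (2 * \<tau>) * (t - a \<bullet> x)" by (simp add: algebra_simps)
  have "cmod (hform a z - hform a x) \<le> cmod (hform a y - hform a x) + cmod (hform a z - hform a y)"
    by (metis add.commute diff_add_cancel norm_triangle_ineq add_diff_eq)
  also have "\<dots> \<le> (exp (2 * \<tau>) - 1) * (t - a \<bullet> x) + (exp (2 * S) - 1) * (t - a \<bullet> y)"
    using 1 Cons.IH by simp
  also have "\<dots> \<le> (exp (2 * \<tau>) - 1) * (t - a \<bullet> x) + (exp (2 * S) - 1) * (exp (2 * \<tau>) * (t - a \<bullet> x))"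
    using 2 kchain_nonneg[OF Cons.hyps(2)] by (intro add_left_mono mult_left_mono) auto
  also have "\<dots> = (exp (2 * (\<tau> + S)) - 1) * (t - a \<bullet> x)"
    by (simp add: distrib_left exp_add algebra_simps)
  finally show ?case .
qed simp

lemma kob_dist_hform:
  assumes a: "\<And>x. x \<in> \<Omega> \<Longrightarrow> a \<bullet> x < t" and \<Omega>: "cdom \<Omega>" "x \<in> \<Omega>" "y \<in> \<Omega>"
  shows "cmod (hform a y - hform a x) \<le> (exp (2 * kob_dist \<Omega> x y) - 1) * (t - a \<bullet> x)"
proof (rule ccontr)
  let ?X = "cmod (hform a y - hform a x)" and ?g = "t - a \<bullet> x"
  assume "\<not> ?thesis"
  then have *: "(exp (2 * kob_dist \<Omega> x y) - 1) * ?g < ?X" by simp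
  have g: "?g > 0" using a[OF \<Omega>(2)] by simp
  \<comment> \<open>Chosen so that \<open>(exp (2 * T) - 1) * ?g = ?X\<close>: a chain shorter than
    \<open>T\<close> then violates the bound for chains.\<close>
  define T where "T = ln (1 + ?X / ?g) / 2"
  have e: "exp (2 * T) = 1 + ?X / ?g"
    using g by (simp add: T_def add_pos_nonneg)
  have "exp (2 * kob_dist \<Omega> x y) < exp (2 * T)"
    unfolding e using * g by (simp add: field_simps)
  then have "kob_dist \<Omega> x y < T" by simp
  then obtain S where S: "S < T" "kchain \<Omega> x y S" using kob_dist_less[OF \<Omega>] by blast
  have "?X \<le> (exp (2 * S) - 1) * ?g" by (rule kchain_hform[OF a S(2)])
  also have "\<dots> < (exp (2 * T) - 1) * ?g" using S(1) g by (intro mult_strict_right_mono) auto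
  also have "\<dots> = ?X" unfolding e using g by simp
  finally show False by simp
qed

text \<open>A Harnack inequality: \<open>t - a \<bullet> x\<close> is a positive pluriharmonic
  function on \<open>\<Omega>\<close>, being the real part of a complex affine function.\<close>

lemma kob_dist_Harnack:
  assumes a: "\<And>x. x \<in> \<Omega> \<Longrightarrow> a \<bullet> x < t" and \<Omega>: "cdom \<Omega>" "x \<in> \<Omega>" "y \<in> \<Omega>"
  shows "t - a \<bullet> y \<le> exp (2 * kob_dist \<Omega> x y) * (t - a \<bullet> x)"
proof -
  have "a \<bullet> x - a \<bullet> y \<le> cmod (hform a y - hform a x)"
    by (metis Re_hform abs_Re_le_cmod abs_le_D2 minus_complex.simps(1) minus_diff_eq)
  with kob_dist_hform[OF assms] show ?thesis by (simp add: algebra_simps)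
qed

text \<open>Openness makes the separation strict: a point of \<open>\<Omega>\<close> on the
  hyperplane could be moved across it in direction \<open>a\<close>. Normalising \<open>a\<close>
  turns differences of inner products into distances to the hyperplane.\<close>

lemma open_convex_support:
  fixes \<Omega> :: "'a::euclidean_space set"
  assumes "open \<Omega>" "convex \<Omega>" "\<Omega> \<noteq> {}" "q \<notin> \<Omega>"
  obtains a where "norm a = 1" "\<And>x. x \<in> \<Omega> \<Longrightarrow> a \<bullet> x < a \<bullet> q"
proof -
  obtain a b where a: "a \<noteq> 0" "\<And>x. x \<in> \<Omega> \<Longrightarrow> a \<bullet> x \<le> b" "b \<le> a \<bullet> q"
    using separating_hyperplane_sets[OF assms(2) _ assms(3), of "{q}"] assms(4) by auto
  have lt: "sgn a \<bullet> x < sgn a \<bullet> q" if x: "x \<in> \<Omega>" for x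
  proof -
    obtain e where e: "e > 0" "ball x e \<subseteq> \<Omega>" using assms(1) x openE by blast
    have "x + (e/2) *\<^sub>R sgn a \<in> ball x e" using e a(1) by (simp add: dist_norm norm_sgn)
    then have "a \<bullet> (x + (e/2) *\<^sub>R sgn a) \<le> a \<bullet> q" using e(2) a(2,3) by fastforce
    moreover have "a \<bullet> sgn a > 0" using a(1) by (simp add: sgn_div_norm)
    ultimately have "a \<bullet> x < a \<bullet> q" using e(1)
      by (simp add: inner_right_distrib) (smt (verit) half_gt_zero mult_pos_pos divide_pos_pos)
    then show ?thesis using a(1) by (simp add: sgn_div_norm divide_strict_right_mono)
  qed
  show ?thesis by (rule that[OF _ lt]) (use a(1) in \<open>auto simp: norm_sgn\<close>)
qed

lemma ball_bdist_subset: "ball q (bdist \<Omega> q) \<subseteq> \<Omega>"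
  unfolding bdist_def using infdist_le[of _ "- \<Omega>" q] by (fastforce simp: not_le)

text \<open>\<open>infdist\<close> to the empty set is 0, so the whole space has to be
  excluded.\<close>

lemma bdist_ge_iff:
  assumes "\<Omega> \<noteq> UNIV" shows "c \<le> bdist \<Omega> q \<longleftrightarrow> ball q c \<subseteq> \<Omega>"
proof
  assume "ball q c \<subseteq> \<Omega>"
  then have "c \<le> dist q y" if "y \<in> - \<Omega>" for y using that by force
  moreover have "- \<Omega> \<noteq> {}" using assms by auto
  ultimately show "c \<le> bdist \<Omega> q"
    unfolding bdist_def by (simp add: infdist_notempty cINF_greatest del: Compl_iff)
qed (use ball_bdist_subset[of q \<Omega>] in auto)

lemma cdom_not_UNIV: "cdom \<Omega> \<Longrightarrow> \<Omega> \<noteq> UNIV"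
  using C_proper_slice[of \<Omega> 1 0] by (auto simp: cdom_def)

lemma bdist_pos:
  assumes "cdom \<Omega>" "q \<in> \<Omega>" shows "bdist \<Omega> q > 0"
proof -
  obtain e where "e > 0" "ball q e \<subseteq> \<Omega>" using assms openE by (metis cdom_def)
  then show ?thesis using bdist_ge_iff[OF cdom_not_UNIV[OF assms(1)]] by (meson order.strict_trans2)
qed

text \<open>Take a supporting hyperplane at the point outside \<open>\<Omega>\<close> nearest to
  \<open>q\<close>. Its distance from \<open>q\<close> is at most \<open>bdist \<Omega> q\<close>,
  its distance from \<open>p\<close> is at least \<open>bdist \<Omega> p\<close>, and
  \<open>kob_dist_Harnack\<close> compares the two.\<close>

lemma bdist_Harnack:
  assumes \<Omega>: "cdom \<Omega>" "p \<in> \<Omega>" "q \<in> \<Omega>"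
  shows "bdist \<Omega> p \<le> exp (2 * kob_dist \<Omega> p q) * bdist \<Omega> q"
proof -
  have o: "open \<Omega>" "convex \<Omega>" "\<Omega> \<noteq> {}" using \<Omega> by (auto simp: cdom_def)
  obtain y where y: "y \<notin> \<Omega>" "bdist \<Omega> q = dist q y"
    using infdist_attains_inf[of "- \<Omega>" q] cdom_not_UNIV[OF \<Omega>(1)] o(1) unfolding bdist_def by auto
  obtain a where a: "norm a = 1" "\<And>x. x \<in> \<Omega> \<Longrightarrow> a \<bullet> x < a \<bullet> y"
    using open_convex_support[OF o y(1)] by blast
  have "a \<bullet> y - a \<bullet> q \<le> dist q y"
    using norm_cauchy_schwarz[of a "y - q"] a(1) by (simp add: inner_diff_right dist_norm norm_minus_commute)
  moreover have "bdist \<Omega> p \<le> a \<bullet> y - a \<bullet> p"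
  proof -
    let ?g = "a \<bullet> y - a \<bullet> p"
    have "a \<bullet> (p + ?g *\<^sub>R a) = a \<bullet> y" using a(1)
      by (simp add: inner_right_distrib dot_square_norm)
    then have "p + ?g *\<^sub>R a \<notin> \<Omega>" using a(2) by force
    then have "bdist \<Omega> p \<le> dist p (p + ?g *\<^sub>R a)" unfolding bdist_def by (intro infdist_le) auto
    also have "\<dots> = ?g" using a(1) a(2)[OF \<Omega>(2)] by (simp add: dist_norm)
    finally show ?thesis .
  qed
  moreover have "a \<bullet> y - a \<bullet> p \<le> exp (2 * kob_dist \<Omega> p q) * (a \<bullet> y - a \<bullet> q)"
    using kob_dist_Harnack[OF a(2) \<Omega>(1,3,2)] kob_dist_sym[OF \<Omega>] by simp
  ultimately show ?thesis unfolding y(2)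
    by (meson exp_ge_zero mult_left_mono order_trans)
qed

text \<open>Integrated form of the classical lower bound
  \<open>norm v / (2 * bdist_dir \<Omega> p v)\<close> for the infinitesimal Kobayashi metric of a
  convex domain. The supporting functional is taken at the point of the complex line through
  \<open>p\<close> and \<open>q\<close> that lies outside \<open>\<Omega>\<close> and is nearest to
  \<open>p\<close>.\<close>

lemma dist_le_bdist_dir:
  assumes \<Omega>: "cdom \<Omega>" "p \<in> \<Omega>" "q \<in> \<Omega>" and "p \<noteq> q"
  shows "dist p q \<le> (exp (2 * kob_dist \<Omega> p q) - 1) * bdist_dir \<Omega> p (q - p)"
proof -
  define v where "v = q - p"
  have v: "v \<noteq> 0" using assms(4) by (simp add: v_def)
  have o: "open \<Omega>" "convex \<Omega>" "\<Omega> \<noteq> {}" using \<Omega> by (auto simp: cdom_def)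
  define X where "X = {y. (\<exists>c::complex. y = p + c *s v) \<and> y \<notin> \<Omega>}"
  have X: "X \<noteq> {}" using C_proper_slice[of \<Omega> v p] v \<Omega> by (auto simp: X_def cdom_def)
  \<comment> \<open>On the line, distances to \<open>p\<close> are \<open>norm v\<close> times
    moduli of parameters, so the closed parameter set \<open>Z\<close> yields a nearest
    point.\<close>
  have "\<exists>y\<in>X. infdist p X = dist p y"
  proof -
    define Z where "Z = - {c. p + c *s v \<in> \<Omega>}"
    have Z: "closed Z" "Z \<noteq> {}" using open_slice[OF o(1)] X unfolding Z_def X_def by (auto simp: closed_def)
    obtain c where c: "c \<in> Z" "infdist 0 Z = dist 0 c" using infdist_attains_inf[OF Z] .
    have "dist p (p + c *s v) \<le> dist p y" if y: "y \<in> X" for y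
    proof -
      obtain c' where c': "y = p + c' *s v" "c' \<in> Z" using y by (auto simp: X_def Z_def)
      have "cmod c \<le> cmod c'" using infdist_le[OF c'(2), of 0] c(2) by simp
      then show ?thesis by (simp add: c' dist_norm norm_vector_smult mult_right_mono)
    qed
    moreover have cX: "p + c *s v \<in> X" using c(1) by (auto simp: X_def Z_def)
    ultimately have "infdist p X = dist p (p + c *s v)"
      by (intro antisym infdist_le) (use X in \<open>auto simp: infdist_notempty intro!: cINF_greatest\<close>)
    with cX show ?thesis by blast
  qed
  then obtain c where c: "p + c *s v \<notin> \<Omega>" "bdist_dir \<Omega> p v = cmod c * norm v"
    unfolding bdist_dir_def X_def[symmetric] by (auto simp: X_def dist_norm norm_vector_smult)
  obtain a where a: "norm a = 1" "\<And>x. x \<in> \<Omega> \<Longrightarrow> a \<bullet> x < a \<bullet> (p + c *s v)"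
    using open_convex_support[OF o c(1)] by blast
  let ?E = "exp (2 * kob_dist \<Omega> p q) - 1"
  have g: "a \<bullet> (p + c *s v) - a \<bullet> p = Re (c * hform a v)"
    unfolding hform_smult[symmetric] Re_hform by (simp add: inner_right_distrib)
  have gpos: "0 < Re (c * hform a v)" using a(2)[OF \<Omega>(2)] g by simp
  have E: "?E \<ge> 0" using kob_dist_nonneg[OF \<Omega>] by simp
  have "cmod (hform a v) \<le> ?E * Re (c * hform a v)"
    using kob_dist_hform[OF a(2) \<Omega>] unfolding g by (simp add: v_def hform_diff)
  also have "\<dots> \<le> ?E * (cmod c * cmod (hform a v))"
    using E complex_Re_le_cmod[of "c * hform a v"] by (intro mult_left_mono) (auto simp: norm_mult)
  \<comment> \<open>The slope \<open>hform a v\<close> is unknown, but it occurs on both sides and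
    cancels.\<close>
  finally have "cmod (hform a v) * 1 \<le> cmod (hform a v) * (?E * cmod c)" by (simp add: mult_ac)
  moreover have "cmod (hform a v) > 0" using gpos by auto
  ultimately have "1 \<le> ?E * cmod c" by (simp only: mult_le_cancel_left_pos)
  then have "norm v * 1 \<le> norm v * (?E * cmod c)" by (intro mult_left_mono) auto
  then show ?thesis using c(2) by (simp add: v_def dist_norm norm_minus_commute mult_ac)
qed

lemma kob_dist_half_ball:
  assumes "cdom \<Omega>" "ball p s \<subseteq> \<Omega>" "dist p q \<le> s / 2" "s > 0"
  shows "kob_dist \<Omega> p q \<le> 1"
proof -
  have "kob_dist \<Omega> p q \<le> artanh (dist p q / s)" using kob_dist_ball[OF assms(1,2)] assms by simp
  also have "\<dots> \<le> artanh (1/2)" using assms by (intro artanh_mono) (auto simp: field_simps)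
  also have "\<dots> \<le> 1" using ln_le_minus_one[of "3::real"] by (simp add: artanh_def)
  finally show ?thesis .
qed

text \<open>
  The points \<open>q + \<mu> ^ j *\<^sub>R (u - q)\<close> carry balls of radius \<open>\<mu> ^ j * s\<close> by convexity, and \<open>\<mu>\<close> is chosen so
  that consecutive points are at most half a radius apart.
\<close>

lemma kob_dist_segment:
  assumes \<Omega>: "cdom \<Omega>" and u: "ball u s \<subseteq> \<Omega>" "0 < s" "s \<le> R" and q: "q \<in> \<Omega>" "dist u q \<le> R"
    and \<mu>: "\<mu> = 1 - s / (2 * R)" and b: "2 * R * \<mu> ^ J \<le> bdist \<Omega> q"
  shows "kob_dist \<Omega> u q \<le> real J + 1"
proof -
  have R: "R > 0" using u by simp
  have \<mu>1: "0 < \<mu>" "\<mu> < 1" "(1 - \<mu>) * R = s / 2" using u R by (auto simp: \<mu> field_simps)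
  define p where "p j = q + \<mu> ^ j *\<^sub>R (u - q)" for j
  have ballp: "ball (p j) (\<mu> ^ j * s) \<subseteq> \<Omega>" for j
  proof
    fix y assume y: "y \<in> ball (p j) (\<mu> ^ j * s)"
    \<comment> \<open>The preimage of \<open>y\<close> under the homothety with centre
      \<open>q\<close> and ratio \<open>\<mu> ^ j\<close>, which carries the ball about
      \<open>u\<close> to the ball about \<open>p j\<close>.\<close>
    define w where "w = u + (1 / \<mu> ^ j) *\<^sub>R (y - p j)"
    have "dist u w = norm (y - p j) / \<mu> ^ j"
      using \<mu>1 by (simp add: w_def dist_norm norm_minus_commute)
    also have "\<dots> < s" using y \<mu>1 by (simp add: dist_norm norm_minus_commute field_simps)
    finally have "w \<in> \<Omega>" using u(1) by auto
    moreover have "y = (1 - \<mu> ^ j) *\<^sub>R q + \<mu> ^ j *\<^sub>R w"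
      using \<mu>1 by (simp add: w_def p_def algebra_simps)
    moreover have "\<mu> ^ j \<le> 1" "\<mu> ^ j \<ge> 0" using \<mu>1 by (auto simp: power_le_one)
    ultimately show "y \<in> \<Omega>" using convexD[of \<Omega> q w "1 - \<mu> ^ j" "\<mu> ^ j"] q(1) \<Omega> by (auto simp: cdom_def)
  qed
  have p\<Omega>: "p j \<in> \<Omega>" for j using ballp[of j] \<mu>1 u(2) by (auto simp: subset_iff)
  have step: "kob_dist \<Omega> (p j) (p (Suc j)) \<le> 1" for j
  proof (rule kob_dist_half_ball[OF \<Omega> ballp])
    have "p j - p (Suc j) = (\<mu> ^ j * (1 - \<mu>)) *\<^sub>R (u - q)" by (simp add: p_def algebra_simps)
    then have "dist (p j) (p (Suc j)) = \<mu> ^ j * ((1 - \<mu>) * dist u q)"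
      using \<mu>1 by (simp add: dist_norm)
    also have "\<dots> \<le> \<mu> ^ j * ((1 - \<mu>) * R)" using \<mu>1 q by (intro mult_left_mono) auto
    finally show "dist (p j) (p (Suc j)) \<le> \<mu> ^ j * s / 2" by (simp add: \<mu>1)
  qed (use \<mu>1 u in auto)
  have "kob_dist \<Omega> u (p j) \<le> real j" for j
  proof (induction j)
    case 0 then show ?case using kob_dist_self[OF \<Omega>, of u] p\<Omega>[of 0] by (simp add: p_def)
  next
    case (Suc j)
    have "u \<in> \<Omega>" using p\<Omega>[of 0] by (simp add: p_def)
    then show ?case using kob_dist_triangle[OF \<Omega> _ p\<Omega>[of j] p\<Omega>[of "Suc j"], of u] step[of j] Suc.IH by simp
  qed
  moreover have "kob_dist \<Omega> q (p J) \<le> 1"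
  proof (rule kob_dist_half_ball[OF \<Omega> ball_bdist_subset])
    have "dist q (p J) = \<mu> ^ J * dist u q" using \<mu>1 by (simp add: p_def dist_norm)
    also have "\<dots> \<le> \<mu> ^ J * R" using \<mu>1 q by (intro mult_left_mono) auto
    finally show "dist q (p J) \<le> bdist \<Omega> q / 2" using b by (simp add: mult_ac)
  qed (rule bdist_pos[OF \<Omega> q(1)])
  moreover have "u \<in> \<Omega>" using p\<Omega>[of 0] by (simp add: p_def)
  ultimately show ?thesis
    using kob_dist_triangle[OF \<Omega> _ p\<Omega> q(1), of u J] kob_dist_sym[OF \<Omega> q(1) p\<Omega>, of J]
    by (smt (verit))
qed

text \<open>The domain is quantified inside the existential, so that one rate, depending only on
  \<open>s\<close> and \<open>R\<close>, serves a whole sequence of domains. Any positive rate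
  suffices later.\<close>

lemma bdist_exp_decay:
  assumes "0 < s" "s \<le> R"
  shows "\<exists>b C. 0 < b \<and> 0 < C \<and> (\<forall>(\<Omega> :: (complex ^ 'n) set) u q. cdom \<Omega> \<longrightarrow> ball u s \<subseteq> \<Omega> \<longrightarrow> q \<in> \<Omega> \<longrightarrow> dist u q \<le> R \<longrightarrow>
    1 < kob_dist \<Omega> u q \<longrightarrow> bdist \<Omega> q \<le> C * exp (- b * kob_dist \<Omega> u q))"
proof -
  define \<mu> where "\<mu> = 1 - s / (2 * R)"
  have \<mu>: "0 < \<mu>" "\<mu> < 1" using assms by (auto simp: \<mu>_def field_simps)
  define b where "b = - ln \<mu>"
  have b: "b > 0" "\<mu> = exp (- b)" using \<mu> by (auto simp: b_def)
  show ?thesis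
  proof (rule exI[of _ b], rule exI[of _ "2 * R * exp (2 * b)"], intro conjI allI impI)
    fix \<Omega> :: "(complex ^ 'n) set" and u q
    assume *: "cdom \<Omega>" "ball u s \<subseteq> \<Omega>" "q \<in> \<Omega>" "dist u q \<le> R" "1 < kob_dist \<Omega> u q"
    let ?d = "kob_dist \<Omega> u q"
    \<comment> \<open>The largest integer with \<open>J + 1 < ?d\<close>: the conclusion of
      \<open>kob_dist_segment\<close> fails for it, hence so does its hypothesis on
      \<open>bdist \<Omega> q\<close>. That \<open>J\<close> is not negative uses
      \<open>1 < ?d\<close>.\<close>
    define J where "J = nat (\<lceil>?d\<rceil> - 2)"
    have J: "real J = of_int \<lceil>?d\<rceil> - 2" using *(5) by (simp add: J_def)
    have "bdist \<Omega> q \<le> 2 * R * \<mu> ^ J"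
      using kob_dist_segment[OF *(1,2) assms *(3,4) \<mu>_def, of J] J ceiling_correct[of ?d] by linarith
    also have "\<mu> ^ J = exp (- b * real J)" unfolding b(2) by (simp flip: exp_of_nat_mult add: mult.commute)
    also have "\<dots> \<le> exp (- b * (?d - 2))" using J b(1) by (simp add: mult_left_mono)
    also have "\<dots> = exp (2 * b) * exp (- b * ?d)" by (simp flip: exp_add add: algebra_simps)
    finally show "bdist \<Omega> q \<le> 2 * R * exp (2 * b) * exp (- b * ?d)" using assms by (simp add: mult_ac)
  qed (use b assms in auto)
qed

section \<open>Almost geodesics and thin triangles\<close>

text \<open>A discrete substitute for a unit speed geodesic: the index \<open>i\<close> stands for
  the time \<open>i * \<eta>\<close>. The slack absorbs the rounding of the length to a multiple of
  \<open>\<eta>\<close> and, as a bound on the total excess, is inherited by subpaths.\<close>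

definition almost_geod :: "'a set \<Rightarrow> ('a \<Rightarrow> 'a \<Rightarrow> real) \<Rightarrow> real \<Rightarrow> (nat \<Rightarrow> 'a) \<Rightarrow> nat \<Rightarrow> bool" where
  "almost_geod X d \<eta> c N \<longleftrightarrow> (\<forall>i\<le>N. c i \<in> X) \<and> (\<forall>i<N. d (c i) (c (Suc i)) \<le> \<eta>) \<and>
     real N * \<eta> \<le> d (c 0) (c N) + 2 * \<eta>"

locale pseudometric =
  fixes X :: "'a set" and d :: "'a \<Rightarrow> 'a \<Rightarrow> real"
  assumes d_self: "x \<in> X \<Longrightarrow> d x x = 0"
    and d_sym: "x \<in> X \<Longrightarrow> y \<in> X \<Longrightarrow> d x y = d y x"
    and d_triangle: "x \<in> X \<Longrightarrow> y \<in> X \<Longrightarrow> z \<in> X \<Longrightarrow> d x z \<le> d x y + d y z"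
begin

lemma path_upper:
  assumes "\<And>k. i \<le> k \<Longrightarrow> k \<le> j \<Longrightarrow> c k \<in> X" "\<And>k. i \<le> k \<Longrightarrow> k < j \<Longrightarrow> d (c k) (c (Suc k)) \<le> e" "i \<le> j"
  shows "d (c i) (c j) \<le> real (j - i) * e"
  using assms(3,1,2)
proof (induction j rule: dec_induct)
  case base then show ?case using d_self by auto
next
  case (step n)
  have "d (c i) (c (Suc n)) \<le> d (c i) (c n) + d (c n) (c (Suc n))"
    using step by (intro d_triangle) auto
  also have "\<dots> \<le> real (n - i) * e + e" using step by (auto intro!: add_mono)
  finally show ?case using step by (simp add: Suc_diff_le algebra_simps)
qed

lemma almost_geod_upper:
  assumes "almost_geod X d \<eta> c N" "i \<le> j" "j \<le> N"
  shows "d (c i) (c j) \<le> real (j - i) * \<eta>"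
  using assms by (intro path_upper) (auto simp: almost_geod_def)

lemma almost_geod_lower:
  assumes "almost_geod X d \<eta> c N" "i \<le> j" "j \<le> N"
  shows "real (j - i) * \<eta> \<le> d (c i) (c j) + 2 * \<eta>"
proof -
  have "d (c 0) (c N) \<le> d (c 0) (c i) + d (c i) (c j) + d (c j) (c N)"
    using assms d_triangle[of "c 0" "c i" "c N"] d_triangle[of "c i" "c j" "c N"]
    by (fastforce simp: almost_geod_def)
  also have "\<dots> \<le> real i * \<eta> + d (c i) (c j) + real (N - j) * \<eta>"
    using almost_geod_upper[OF assms(1), of 0 i] almost_geod_upper[OF assms(1), of j N] assms by simp
  moreover have "real N * \<eta> \<le> d (c 0) (c N) + 2 * \<eta>" using assms(1) by (simp add: almost_geod_def)
  moreover have "real N * \<eta> = real i * \<eta> + real (j - i) * \<eta> + real (N - j) * \<eta>"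
    using assms by (simp add: of_nat_diff algebra_simps)
  ultimately show ?thesis by linarith
qed

lemma almost_geod_sub:
  assumes "almost_geod X d \<eta> c N" "a \<le> b" "b \<le> N"
  shows "almost_geod X d \<eta> (\<lambda>i. c (a + i)) (b - a)"
  using assms almost_geod_lower[OF assms] by (auto simp: almost_geod_def)

lemma almost_geod_rev:
  assumes "almost_geod X d \<eta> c N"
  shows "almost_geod X d \<eta> (\<lambda>i. c (N - i)) N"
proof -
  have "d (c (N - i)) (c (N - Suc i)) \<le> \<eta>" if "i < N" for i
  proof -
    have "d (c (N - Suc i)) (c (Suc (N - Suc i))) \<le> \<eta>" using assms that by (auto simp: almost_geod_def)
    moreover have "Suc (N - Suc i) = N - i" using that by simp
    ultimately show ?thesis using d_sym[of "c (N - i)" "c (N - Suc i)"] assms by (auto simp: almost_geod_def)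
  qed
  then show ?thesis using assms d_sym[of "c 0" "c N"] by (auto simp: almost_geod_def)
qed

lemma almost_geod_sum:
  assumes "almost_geod X d \<eta> c N" "i \<le> N"
  shows "d (c 0) (c i) + d (c i) (c N) \<le> d (c 0) (c N) + 2 * \<eta>"
proof -
  have "d (c 0) (c i) + d (c i) (c N) \<le> real i * \<eta> + real (N - i) * \<eta>"
    using almost_geod_upper[OF assms(1), of 0 i] almost_geod_upper[OF assms(1), of i N] assms by simp
  also have "\<dots> = real N * \<eta>" using assms by (simp add: of_nat_diff algebra_simps)
  finally show ?thesis using assms(1) by (simp add: almost_geod_def)
qed

lemma gromov_prod_le_dist:
  assumes "almost_geod X d \<eta> c N" "i \<le> N" "w \<in> X" "u \<in> X"
  shows "gromov_prod d w (c 0) (c N) \<le> d w u + d u (c i) + \<eta>"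
proof -
  have X: "c 0 \<in> X" "c N \<in> X" "c i \<in> X" using assms by (auto simp: almost_geod_def)
  show ?thesis
    using almost_geod_sum[OF assms(1,2)] d_triangle[OF X(1,3) assms(3)] d_triangle[OF X(2,3) assms(3)]
      d_triangle[OF X(3) assms(4,3)] d_sym[OF X(2,3)] d_sym[OF X(3) assms(4)] d_sym[OF assms(3,4)]
      d_triangle[OF X(1,3,2)]
    by (simp add: gromov_prod_def field_simps)
qed

text \<open>Two triangles share the side from \<open>x\<close> to \<open>z\<close>. In the one with
  vertex \<open>w\<close>, some point \<open>u\<close> of this side is close to both other sides, so
  the product of \<open>x\<close> and \<open>z\<close> is at least \<open>d u w\<close> up to a
  constant. In the one with vertex \<open>y\<close>, \<open>u\<close> is close to one of the other
  sides, so one of the products with \<open>y\<close> is at most \<open>d w u\<close> up to a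
  constant. A single step size and a single \<open>\<delta>\<close> are enough.\<close>

lemma thin_imp_gromov_hyperbolic:
  assumes \<eta>: "0 < \<eta>" "\<eta> \<le> 1" and \<delta>: "0 \<le> \<delta>"
    and ex: "\<And>x y. x \<in> X \<Longrightarrow> y \<in> X \<Longrightarrow> \<exists>c N. almost_geod X d \<eta> c N \<and> c 0 = x \<and> c N = y"
    and thin: "\<And>\<gamma> N \<alpha> A \<beta> B i. almost_geod X d \<eta> \<gamma> N \<Longrightarrow> almost_geod X d \<eta> \<alpha> A \<Longrightarrow> almost_geod X d \<eta> \<beta> B \<Longrightarrow>
      \<gamma> 0 = \<alpha> 0 \<Longrightarrow> \<alpha> A = \<beta> 0 \<Longrightarrow> \<beta> B = \<gamma> N \<Longrightarrow> i \<le> N \<Longrightarrow>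
      (\<exists>j\<le>A. d (\<gamma> i) (\<alpha> j) \<le> \<delta>) \<or> (\<exists>j\<le>B. d (\<gamma> i) (\<beta> j) \<le> \<delta>)"
  shows "gromov_hyperbolic X d"
proof -
  have main: "min (gromov_prod d w x y) (gromov_prod d w y z) - (3 * \<delta> + 5) \<le> gromov_prod d w x z"
    if X: "w \<in> X" "x \<in> X" "y \<in> X" "z \<in> X" for w x y z
  proof -
    obtain \<gamma> N where \<gamma>: "almost_geod X d \<eta> \<gamma> N" "\<gamma> 0 = x" "\<gamma> N = z" using ex X by blast
    obtain \<alpha> A where \<alpha>: "almost_geod X d \<eta> \<alpha> A" "\<alpha> 0 = x" "\<alpha> A = w" using ex X by blast
    obtain \<beta> B where \<beta>: "almost_geod X d \<eta> \<beta> B" "\<beta> 0 = w" "\<beta> B = z" using ex X by blast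
    have mem: "\<And>i. i \<le> N \<Longrightarrow> \<gamma> i \<in> X" "\<And>i. i \<le> A \<Longrightarrow> \<alpha> i \<in> X" "\<And>i. i \<le> B \<Longrightarrow> \<beta> i \<in> X"
      using \<gamma> \<alpha> \<beta> by (auto simp: almost_geod_def)
    \<comment> \<open>Discrete connectedness: take the last point close to \<open>\<alpha>\<close>.
      Its successor, one step of length at most 1 away, must be close to
      \<open>\<beta>\<close>.\<close>
    have "\<exists>i\<le>N. (\<exists>j\<le>A. d (\<gamma> i) (\<alpha> j) \<le> \<delta>) \<and> (\<exists>k\<le>B. d (\<gamma> i) (\<beta> k) \<le> \<delta> + 1)"
    proof -
      define P where "P i \<longleftrightarrow> i \<le> N \<and> (\<exists>j\<le>A. d (\<gamma> i) (\<alpha> j) \<le> \<delta>)" for i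
      define i where "i = (GREATEST i. P i)"
      have P0: "P 0" unfolding P_def
        using \<gamma> \<alpha> \<delta> d_self[OF X(2)] by auto
      have Pi: "P i" unfolding i_def by (rule GreatestI_nat[of P 0 N, OF P0]) (simp add: P_def)
      have mx: "P k \<Longrightarrow> k \<le> i" for k unfolding i_def
        by (rule Greatest_le_nat[of P k N]) (auto simp: P_def)
      have "\<exists>k\<le>B. d (\<gamma> i) (\<beta> k) \<le> \<delta> + 1"
      proof (cases "i = N")
        case True then show ?thesis using \<beta> \<gamma> \<delta> d_self[OF X(4)] by (intro exI[of _ B]) auto
      next
        case False
        then have iN: "Suc i \<le> N" using Pi by (auto simp: P_def)
        then have "\<not> (\<exists>j\<le>A. d (\<gamma> (Suc i)) (\<alpha> j) \<le> \<delta>)" using mx[of "Suc i"] by (auto simp: P_def)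
        then obtain k where k: "k \<le> B" "d (\<gamma> (Suc i)) (\<beta> k) \<le> \<delta>"
          using thin[OF \<gamma>(1) \<alpha>(1) \<beta>(1) _ _ _ iN] \<gamma> \<alpha> \<beta> by auto
        have "d (\<gamma> i) (\<gamma> (Suc i)) \<le> \<eta>" using \<gamma>(1) iN by (auto simp: almost_geod_def)
        then show ?thesis using d_triangle[of "\<gamma> i" "\<gamma> (Suc i)" "\<beta> k"] k mem iN \<eta>
          by (intro exI[of _ k]) auto
      qed
      then show ?thesis using Pi unfolding P_def by blast
    qed
    then obtain i j k where ijk: "i \<le> N" "j \<le> A" "k \<le> B" "d (\<gamma> i) (\<alpha> j) \<le> \<delta>" "d (\<gamma> i) (\<beta> k) \<le> \<delta> + 1"
      by blast
    define u p q where "u = \<gamma> i" and "p = \<alpha> j" and "q = \<beta> k"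
    have U: "u \<in> X" "p \<in> X" "q \<in> X" using mem ijk by (auto simp: u_def p_def q_def)
    have up: "d u p \<le> \<delta>" "d u q \<le> \<delta> + 1" using ijk by (auto simp: u_def p_def q_def)
    have s1: "d x p + d p w \<le> d x w + 2"
      using almost_geod_sum[OF \<alpha>(1) ijk(2)] \<alpha> \<eta> by (simp add: p_def)
    have s2: "d w q + d q z \<le> d w z + 2"
      using almost_geod_sum[OF \<beta>(1) ijk(3)] \<beta> \<eta> by (simp add: q_def)
    have xu: "d x u \<le> d x p + \<delta>" "d u w \<le> d p w + \<delta>" "d u w \<le> \<delta> + 1 + d w q" "d u z \<le> \<delta> + 1 + d q z"
      "d x z \<le> d x u + d u z"
      using d_triangle[OF X(2) U(2,1)] d_triangle[OF U(1,2) X(1)] d_triangle[OF U(1,3) X(1)]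
        d_triangle[OF U(1,3) X(4)] d_triangle[OF X(2) U(1) X(4)] up d_sym[OF U(1,2)] d_sym[OF U(3) X(1)]
      by linarith+
    have lower: "d u w - (2 * \<delta> + 3) \<le> gromov_prod d w x z"
      unfolding gromov_prod_def using s1 s2 xu d_sym[OF X(1,4)] by simp
    obtain \<alpha>' A' where \<alpha>': "almost_geod X d \<eta> \<alpha>' A'" "\<alpha>' 0 = x" "\<alpha>' A' = y" using ex X by blast
    obtain \<beta>' B' where \<beta>': "almost_geod X d \<eta> \<beta>' B'" "\<beta>' 0 = y" "\<beta>' B' = z" using ex X by blast
    have "(\<exists>j\<le>A'. d u (\<alpha>' j) \<le> \<delta>) \<or> (\<exists>j\<le>B'. d u (\<beta>' j) \<le> \<delta>)"
      unfolding u_def by (rule thin[OF \<gamma>(1) \<alpha>'(1) \<beta>'(1)]) (use \<gamma> \<alpha>' \<beta>' ijk in auto)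
    then have "min (gromov_prod d w x y) (gromov_prod d w y z) \<le> d w u + \<delta> + 1"
    proof
      assume "\<exists>j\<le>A'. d u (\<alpha>' j) \<le> \<delta>"
      then obtain j where "j \<le> A'" "d u (\<alpha>' j) \<le> \<delta>" by blast
      then show ?thesis using gromov_prod_le_dist[OF \<alpha>'(1) _ X(1) U(1), of j] \<alpha>' \<eta> by simp
    next
      assume "\<exists>j\<le>B'. d u (\<beta>' j) \<le> \<delta>"
      then obtain j where "j \<le> B'" "d u (\<beta>' j) \<le> \<delta>" by blast
      then show ?thesis using gromov_prod_le_dist[OF \<beta>'(1) _ X(1) U(1), of j] \<beta>' \<eta> by simp
    qed
    with lower d_sym[OF U(1) X(1)] show ?thesis by simp
  qed
  show ?thesis unfolding gromov_hyperbolic_def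
    by (rule exI[of _ "3 * \<delta> + 5"]) (use main \<delta> in auto)
qed

end

lemma pseudometric_kob: "cdom \<Omega> \<Longrightarrow> pseudometric \<Omega> (kob_dist \<Omega>)"
  by unfold_locales (auto intro: kob_dist_self kob_dist_sym kob_dist_triangle)

lemma kob_chain_ex:
  assumes \<Omega>: "cdom \<Omega>" and \<eta>: "0 < \<eta>" and y: "y \<in> \<Omega>"
  shows "x \<in> \<Omega> \<Longrightarrow> kob_dist \<Omega> x y < real (Suc N) * \<eta> \<Longrightarrow>
    \<exists>c. c 0 = x \<and> c (Suc N) = y \<and> (\<forall>i\<le>Suc N. c i \<in> \<Omega>) \<and> (\<forall>i<Suc N. kob_dist \<Omega> (c i) (c (Suc i)) \<le> \<eta>)"
proof (induction N arbitrary: x)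
  case 0
  then show ?case using y by (intro exI[of _ "\<lambda>i. if i = 0 then x else y"]) auto
next
  case (Suc N)
  obtain w where w: "w \<in> \<Omega>" "kob_dist \<Omega> x w < \<eta>" "kob_dist \<Omega> w y < real (Suc N) * \<eta>"
    by (rule kob_dist_split[OF \<Omega> Suc.prems(1) y, of \<eta> "real (Suc N) * \<eta>"])
       (use \<eta> Suc.prems in \<open>auto simp: algebra_simps intro: add_pos_nonneg\<close>)
  obtain c where c: "c 0 = w" "c (Suc N) = y" "\<forall>i\<le>Suc N. c i \<in> \<Omega>" "\<forall>i<Suc N. kob_dist \<Omega> (c i) (c (Suc i)) \<le> \<eta>"
    using Suc.IH[OF w(1,3)] by blast
  show ?case
    by (rule exI[of _ "case_nat x c"]) (use c w Suc.prems in \<open>auto split: nat.split\<close>)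
qed

lemma almost_geod_kob_ex:
  assumes \<Omega>: "cdom \<Omega>" and \<eta>: "0 < \<eta>" and xy: "x \<in> \<Omega>" "y \<in> \<Omega>"
  shows "\<exists>c N. almost_geod \<Omega> (kob_dist \<Omega>) \<eta> c N \<and> c 0 = x \<and> c N = y"
proof -
  let ?d = "kob_dist \<Omega> x y"
  \<comment> \<open>Rounding down gives \<open>N\<close>, but \<open>kob_chain_ex\<close> needs a
    strict bound, so \<open>Suc N\<close> steps are used; the excess is at most one step.\<close>
  define N where "N = nat \<lfloor>?d / \<eta>\<rfloor>"
  have "0 \<le> ?d / \<eta>" using kob_dist_nonneg[OF \<Omega> xy] \<eta> by simp
  then have N: "real N \<le> ?d / \<eta>" "?d / \<eta> < real N + 1" unfolding N_def by linarith+
  then have N': "real N * \<eta> \<le> ?d" "?d < real (Suc N) * \<eta>" using \<eta> by (auto simp: field_simps)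
  obtain c where c: "c 0 = x" "c (Suc N) = y" "\<forall>i\<le>Suc N. c i \<in> \<Omega>" "\<forall>i<Suc N. kob_dist \<Omega> (c i) (c (Suc i)) \<le> \<eta>"
    using kob_chain_ex[OF \<Omega> \<eta> xy(2,1) N'(2)] by blast
  show ?thesis
    by (intro exI[of _ c] exI[of _ "Suc N"]) (use c N' \<eta> in \<open>auto simp: almost_geod_def algebra_simps\<close>)
qed

lemma sum_power_dist_le:
  fixes x :: real
  assumes "0 \<le> x" "x < 1"
  shows "(\<Sum>i<j. x ^ nat \<bar>int i - int k\<bar>) \<le> 2 / (1 - x)"
proof -
  have geo: "(\<Sum>i<n. x ^ i) \<le> 1 / (1 - x)" for n
    using assms by (simp add: sum_gp_strict divide_right_mono)
  have "(\<Sum>i<j. x ^ nat \<bar>int i - int k\<bar>) \<le> (\<Sum>i\<in>{..k} \<union> {k..<k+j}. x ^ nat \<bar>int i - int k\<bar>)"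
    by (rule sum_mono2) (use assms in auto)
  also have "\<dots> \<le> (\<Sum>i\<in>{..k}. x ^ nat \<bar>int i - int k\<bar>) + (\<Sum>i\<in>{k..<k+j}. x ^ nat \<bar>int i - int k\<bar>)"
    using assms by (simp add: sum_Un sum_nonneg)
  also have "(\<Sum>i\<in>{..k}. x ^ nat \<bar>int i - int k\<bar>) = (\<Sum>i<Suc k. x ^ i)"
    by (rule sum.reindex_bij_witness[where i = "\<lambda>i. k - i" and j = "\<lambda>i. k - i"])
       (auto simp: nat_eq_iff of_nat_diff intro!: arg_cong[where f = "\<lambda>n. x ^ n"])
  also have "(\<Sum>i\<in>{k..<k+j}. x ^ nat \<bar>int i - int k\<bar>) = (\<Sum>i<j. x ^ i)"
    by (rule sum.reindex_bij_witness[where i = "\<lambda>i. k + i" and j = "\<lambda>i. i - k"]) (auto simp: nat_diff_distrib')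
  finally show ?thesis using geo[of "Suc k"] geo[of j] by simp
qed

lemma dist_le_sum_steps:
  fixes c :: "nat \<Rightarrow> 'a::metric_space"
  shows "dist (c 0) (c j) \<le> (\<Sum>i<j. dist (c i) (c (Suc i)))"
proof (induction j)
  case (Suc j)
  then show ?case using dist_triangle[of "c 0" "c (Suc j)" "c j"] by simp
qed simp

text \<open>
  Let \<open>c k\<close> be nearest to \<open>u\<close>. Then the distance of \<open>c i\<close> to \<open>u\<close> is at least both \<open>D\<close> and about
  \<open>\<bar>i - k\<bar> * \<eta> / 2\<close>, so the Euclidean steps are bounded by a small constant times a geometric series
  centred at \<open>k\<close>.
\<close>

lemma almost_geod_stays:
  fixes C m R s \<epsilon> :: real
  assumes "0 < s" "0 < R" "0 < C" "0 < m" "0 < \<epsilon>"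
  shows "\<exists>D. \<forall>(\<Omega> :: (complex ^ 'n) set) u \<eta> c N. cdom \<Omega> \<longrightarrow> ball u s \<subseteq> \<Omega> \<longrightarrow> norm u \<le> R \<longrightarrow>
    (\<forall>p\<in>\<Omega> \<inter> ball 0 (R + \<epsilon>). \<forall>v. v \<noteq> 0 \<longrightarrow> bdist_dir \<Omega> p v \<le> C * bdist \<Omega> p powr (1 / m)) \<longrightarrow>
    0 < \<eta> \<longrightarrow> \<eta> \<le> 1 \<longrightarrow> almost_geod \<Omega> (kob_dist \<Omega>) \<eta> c N \<longrightarrow>
    (\<forall>i\<le>N. D < kob_dist \<Omega> u (c i)) \<longrightarrow> norm (c 0) < R \<longrightarrow> (\<forall>j\<le>N. dist (c 0) (c j) < \<epsilon>)"
proof -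
  have "\<exists>b C. 0 < b \<and> 0 < C \<and> (\<forall>(\<Omega> :: (complex ^ 'n) set) u q. cdom \<Omega> \<longrightarrow> ball u s \<subseteq> \<Omega> \<longrightarrow> q \<in> \<Omega> \<longrightarrow>
      dist u q \<le> 2 * R + \<epsilon> + s \<longrightarrow> 1 < kob_dist \<Omega> u q \<longrightarrow> bdist \<Omega> q \<le> C * exp (- b * kob_dist \<Omega> u q))"
    by (rule bdist_exp_decay) (use assms in auto)
  then obtain b C0 where b: "0 < b" "0 < C0" and
    decay: "\<And>(\<Omega> :: (complex ^ 'n) set) u q. cdom \<Omega> \<Longrightarrow> ball u s \<subseteq> \<Omega> \<Longrightarrow> q \<in> \<Omega> \<Longrightarrow>
      dist u q \<le> 2 * R + \<epsilon> + s \<Longrightarrow> 1 < kob_dist \<Omega> u q \<Longrightarrow> bdist \<Omega> q \<le> C0 * exp (- b * kob_dist \<Omega> u q)"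
    by blast
  define \<beta> where "\<beta> = b / m"
  define A where "A = C * C0 powr (1 / m)"
  define Q where "Q = 2 * exp 2 * A * exp (\<beta> / 2) * (2 * (4 / \<beta> + 1))"
  have pos: "0 < \<beta>" "0 < A" using assms b by (auto simp: \<beta>_def A_def)
  then have Q: "0 < Q" by (simp add: Q_def add_pos_pos)
  \<comment> \<open>Makes \<open>Q * exp (- (\<beta> * D / 2))\<close> smaller than
    \<open>\<epsilon>\<close>, where \<open>Q\<close> collects the constants of the final sum. The
    summand 1 gives strictness, and \<open>max 1\<close> provides the hypothesis
    \<open>1 < kob_dist \<Omega> u q\<close> of the decay estimate.\<close>
  define D where "D = max 1 (2 / \<beta> * (ln (Q / \<epsilon>) + 1))"
  have D1: "1 \<le> D" by (simp add: D_def)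
  have "- (\<beta> * D / 2) \<le> - (ln (Q / \<epsilon>) + 1)"
    using pos mult_left_mono[of "2 / \<beta> * (ln (Q / \<epsilon>) + 1)" D "\<beta> / 2"] by (simp add: D_def)
  also have "\<dots> < - ln (Q / \<epsilon>)" by simp
  finally have "exp (- (\<beta> * D / 2)) < exp (- ln (Q / \<epsilon>))" by simp
  also have "\<dots> = \<epsilon> / Q" using Q assms by (simp add: exp_minus)
  finally have DQ: "Q * exp (- (\<beta> * D / 2)) < \<epsilon>" using Q by (simp add: field_simps)
  show ?thesis
  proof (rule exI[of _ D], intro allI impI)
    fix \<Omega> :: "(complex ^ 'n) set" and u \<eta> c N j
    assume \<Omega>: "cdom \<Omega>" and u: "ball u s \<subseteq> \<Omega>" "norm u \<le> R"
      and conv: "\<forall>p\<in>\<Omega> \<inter> ball 0 (R + \<epsilon>). \<forall>v. v \<noteq> 0 \<longrightarrow> bdist_dir \<Omega> p v \<le> C * bdist \<Omega> p powr (1 / m)"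
      and \<eta>: "0 < \<eta>" "\<eta> \<le> 1" and c: "almost_geod \<Omega> (kob_dist \<Omega>) \<eta> c N"
      and far: "\<forall>i\<le>N. D < kob_dist \<Omega> u (c i)" and c0: "norm (c 0) < R" and jN: "j \<le> N"
    interpret pseudometric \<Omega> "kob_dist \<Omega>" by (rule pseudometric_kob[OF \<Omega>])
    let ?d = "\<lambda>i. kob_dist \<Omega> u (c i)"
    have u\<Omega>: "u \<in> \<Omega>" using u assms by auto
    have c\<Omega>: "c i \<in> \<Omega>" if "i \<le> N" for i using c that by (auto simp: almost_geod_def)
    obtain k where k: "k \<le> N" "\<And>i. i \<le> N \<Longrightarrow> ?d k \<le> ?d i"
      using arg_min_if_finite(1,2)[of "{..N}" ?d] by (metis atMost_iff finite_atMost empty_iff not_le le0)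
    define x where "x = exp (- (\<beta> * \<eta> / 4))"
    have x: "0 < x" "x < 1" using pos \<eta> by (auto simp: x_def)
    have decay_term: "exp (- (\<beta> * ?d i)) \<le> exp (\<beta> / 2) * exp (- (\<beta> * D / 2)) * x ^ nat \<bar>int i - int k\<bar>" if i: "i \<le> N" for i
    proof -
      have "real (nat \<bar>int i - int k\<bar>) * \<eta> \<le> kob_dist \<Omega> (c i) (c k) + 2 * \<eta>"
      proof (cases "i \<le> k")
        case True
        then show ?thesis using almost_geod_lower[OF c True k(1)] by (simp add: nat_diff_distrib')
      next
        case False
        then have "k \<le> i" by simp
        with almost_geod_lower[OF c this i] d_sym[OF c\<Omega>[OF i] c\<Omega>[OF k(1)]] show ?thesis
          by (simp add: nat_diff_distrib')
      qed
      also have "\<dots> \<le> ?d i + ?d k + 2"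
        using d_triangle[OF c\<Omega>[OF i] u\<Omega> c\<Omega>[OF k(1)]] d_sym[OF c\<Omega>[OF i] u\<Omega>] \<eta> by simp
      \<comment> \<open>From \<open>\<bar>i - k\<bar> * \<eta> - 2 \<le> ?d i + ?d k \<le> 2 * ?d
        i\<close> and \<open>D < ?d i\<close>: half of the distance pays for summability, the other
        half for smallness.\<close>
      finally have "real (nat \<bar>int i - int k\<bar>) * \<eta> + 2 * D - 2 \<le> 4 * ?d i"
        using k(2)[OF i] far i by (smt (verit))
      then have "\<beta> * (real (nat \<bar>int i - int k\<bar>) * \<eta> + 2 * D - 2) \<le> \<beta> * (4 * ?d i)"
        using pos by (intro mult_left_mono) auto
      then have "- (\<beta> * ?d i) \<le> \<beta> / 2 + - (\<beta> * D / 2) + real (nat \<bar>int i - int k\<bar>) * (- (\<beta> * \<eta> / 4))"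
        by (simp add: algebra_simps)
      then have "exp (- (\<beta> * ?d i)) \<le> exp (\<beta> / 2 + - (\<beta> * D / 2) + real (nat \<bar>int i - int k\<bar>) * (- (\<beta> * \<eta> / 4)))"
        by simp
      then show ?thesis unfolding x_def exp_add exp_of_nat_mult .
    qed
    have ex: "exp (2 * \<eta>) - 1 \<le> 2 * exp 2 * \<eta>"
    proof -
      have "exp (2 * \<eta>) * (1 - 2 * \<eta>) \<le> exp (2 * \<eta>) * exp (- (2 * \<eta>))"
        using exp_ge_add_one_self[of "- (2 * \<eta>)"] by (intro mult_left_mono) auto
      then have "exp (2 * \<eta>) - 1 \<le> 2 * \<eta> * exp (2 * \<eta>)" by (simp add: exp_minus algebra_simps)
      also have "\<dots> \<le> 2 * \<eta> * exp 2" using \<eta> by (intro mult_left_mono) auto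
      finally show ?thesis by (simp add: mult_ac)
    qed
    have step: "dist (c i) (c (Suc i)) \<le> 2 * exp 2 * \<eta> * A * exp (- (\<beta> * ?d i))"
      if i: "i < N" "norm (c i) < R + \<epsilon>" for i
    proof (cases "c i = c (Suc i)")
      case True then show ?thesis using pos \<eta> by simp
    next
      case False
      have iN: "i \<le> N" "Suc i \<le> N" using i by auto
      have "dist u (c i) \<le> 2 * R + \<epsilon> + s" using u(2) i(2) norm_triangle_ineq4[of u "c i"] assms by (simp add: dist_norm)
      then have "bdist \<Omega> (c i) \<le> C0 * exp (- b * ?d i)"
        using decay[OF \<Omega> u(1) c\<Omega>[OF iN(1)]] far iN(1) D1 by (meson order.strict_trans1)
      then have "bdist \<Omega> (c i) powr (1 / m) \<le> (C0 * exp (- b * ?d i)) powr (1 / m)"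
        using assms bdist_pos[OF \<Omega> c\<Omega>[OF iN(1)]] by (intro powr_mono2) auto
      also have "\<dots> = C0 powr (1 / m) * exp (- (\<beta> * ?d i))"
        using b exp_powr_real[of "- b * ?d i" "1 / m"] by (simp add: powr_mult \<beta>_def)
      finally have bd: "C * bdist \<Omega> (c i) powr (1 / m) \<le> A * exp (- (\<beta> * ?d i))"
        using assms by (simp add: A_def mult_ac)
      have "dist (c i) (c (Suc i)) \<le> (exp (2 * kob_dist \<Omega> (c i) (c (Suc i))) - 1) * bdist_dir \<Omega> (c i) (c (Suc i) - c i)"
        by (rule dist_le_bdist_dir[OF \<Omega> c\<Omega>[OF iN(1)] c\<Omega>[OF iN(2)] False])
      also have "\<dots> \<le> (2 * exp 2 * \<eta>) * (A * exp (- (\<beta> * ?d i)))"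
      proof (rule mult_mono)
        have "kob_dist \<Omega> (c i) (c (Suc i)) \<le> \<eta>" using c i by (auto simp: almost_geod_def)
        then have "exp (2 * kob_dist \<Omega> (c i) (c (Suc i))) \<le> exp (2 * \<eta>)" by simp
        with ex show "exp (2 * kob_dist \<Omega> (c i) (c (Suc i))) - 1 \<le> 2 * exp 2 * \<eta>" by linarith
        have "bdist_dir \<Omega> (c i) (c (Suc i) - c i) \<le> C * bdist \<Omega> (c i) powr (1 / m)"
          using conv c\<Omega>[OF iN(1)] i(2) False by auto
        with bd show "bdist_dir \<Omega> (c i) (c (Suc i) - c i) \<le> A * exp (- (\<beta> * ?d i))" by linarith
      qed (use \<eta> in \<open>auto simp: bdist_dir_def infdist_nonneg\<close>)
      finally show ?thesis by (simp add: mult_ac)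
    qed
    \<comment> \<open>The number of steps is not bounded as \<open>\<eta>\<close> tends to 0, but
      \<open>1 - x\<close> is of order \<open>\<eta>\<close>, so the step size times the geometric
      series stays bounded.\<close>
    have eta: "\<eta> * (2 / (1 - x)) \<le> 2 * (4 / \<beta> + 1)"
    proof -
      define y where "y = \<beta> * \<eta> / 4"
      have y: "y > 0" "y \<le> \<beta> / 4" using pos \<eta> by (auto simp: y_def)
      have "x = inverse (exp y)" by (simp add: x_def y_def exp_minus)
      also have "\<dots> \<le> inverse (1 + y)" using y exp_ge_add_one_self[of y] by (intro le_imp_inverse_le) auto
      finally have "y / (1 + y) \<le> 1 - x" using y by (simp add: field_simps)
      then have "\<eta> / (1 - x) \<le> \<eta> / (y / (1 + y))" using y \<eta> x by (intro divide_left_mono) (auto simp: field_simps)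
      also have "\<dots> = (4 / \<beta>) * (1 + y)" using y \<eta> pos by (simp add: y_def field_simps)
      also have "\<dots> \<le> (4 / \<beta>) * (1 + \<beta> / 4)" using y pos by (intro mult_left_mono) auto
      also have "\<dots> = 4 / \<beta> + 1" using pos by (simp add: field_simps)
      finally have "2 * (\<eta> / (1 - x)) \<le> 2 * (4 / \<beta> + 1)" by (intro mult_left_mono) auto
      moreover have "\<eta> * (2 / (1 - x)) = 2 * (\<eta> / (1 - x))" by simp
      ultimately show ?thesis by (simp only:)
    qed
    \<comment> \<open>Strong induction, since the convexity estimate holds only in
      \<open>ball 0 (R + \<epsilon>)\<close>: the claim for earlier indices keeps their points in
      this ball.\<close>
    show "dist (c 0) (c j) < \<epsilon>" using jN
    proof (induction j rule: less_induct)
      case (less j)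
      have near: "norm (c i) < R + \<epsilon>" if "i < j" for i
        using less.IH[OF that] less.prems that c0 norm_triangle_sub[of "c i" "c 0"]
        by (simp add: dist_norm norm_minus_commute)
      have "dist (c 0) (c j) \<le> (\<Sum>i<j. dist (c i) (c (Suc i)))" by (rule dist_le_sum_steps)
      also have "\<dots> \<le> (\<Sum>i<j. 2 * exp 2 * \<eta> * A * (exp (\<beta> / 2) * exp (- (\<beta> * D / 2)) * x ^ nat \<bar>int i - int k\<bar>))"
      proof (rule sum_mono)
        fix i assume i: "i \<in> {..<j}"
        have "dist (c i) (c (Suc i)) \<le> 2 * exp 2 * \<eta> * A * exp (- (\<beta> * ?d i))"
          using i near less.prems by (intro step) auto
        also have "\<dots> \<le> 2 * exp 2 * \<eta> * A * (exp (\<beta> / 2) * exp (- (\<beta> * D / 2)) * x ^ nat \<bar>int i - int k\<bar>)"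
          using decay_term[of i] i less.prems pos \<eta> by (intro mult_left_mono) auto
        finally show "dist (c i) (c (Suc i)) \<le> \<dots>" .
      qed
      also have "\<dots> = 2 * exp 2 * A * exp (\<beta> / 2) * exp (- (\<beta> * D / 2)) * (\<eta> * (\<Sum>i<j. x ^ nat \<bar>int i - int k\<bar>))"
        by (simp add: sum_distrib_left mult_ac)
      also have "\<dots> \<le> 2 * exp 2 * A * exp (\<beta> / 2) * exp (- (\<beta> * D / 2)) * (\<eta> * (2 / (1 - x)))"
        using sum_power_dist_le[of x k j] x \<eta> pos by (intro mult_left_mono) auto
      also have "\<dots> \<le> 2 * exp 2 * A * exp (\<beta> / 2) * exp (- (\<beta> * D / 2)) * (2 * (4 / \<beta> + 1))"
        using eta pos by (intro mult_left_mono) auto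
      also have "\<dots> = Q * exp (- (\<beta> * D / 2))" by (simp add: Q_def mult_ac)
      finally show ?case using DQ by linarith
    qed
  qed
qed

section \<open>Kobayashi distances under local Hausdorff convergence\<close>

lemma artanh_le:
  assumes "0 \<le> y" "y < 1" shows "artanh y \<le> y / (1 - y :: real)"
proof -
  have "(1 + y) / (1 - y) = 1 + 2 * y / (1 - y)" using assms by (simp add: field_simps)
  moreover have "ln (1 + 2 * y / (1 - y)) \<le> 2 * y / (1 - y)" by (rule ln_add_one_self_le_self2) (use assms in \<open>auto intro: less_le_trans[of _ 0]\<close>)
  ultimately have "ln ((1 + y) / (1 - y)) \<le> 2 * (y / (1 - y))" by simp
  then show ?thesis unfolding artanh_def by linarith
qed

lemma le_artanh:
  assumes "0 \<le> y" "y < 1" shows "y \<le> artanh (y :: real)"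
proof -
  have "artanh 0 - 0 \<le> artanh y - y"
  proof (rule DERIV_nonneg_imp_nondecreasing[OF assms(1)])
    fix x assume x: "0 \<le> x" "x \<le> y"
    have "((\<lambda>x. artanh x - x) has_field_derivative (1 / (1 - x\<^sup>2) - 1)) (at x)"
      using x assms by (auto intro!: derivative_eq_intros)
    moreover have "0 \<le> 1 / (1 - x\<^sup>2) - 1"
    proof -
      have "x\<^sup>2 < 1" using x assms by (simp add: abs_square_less_1)
      then show ?thesis by (simp add: field_simps)
    qed
    ultimately show "\<exists>D. ((\<lambda>x. artanh x - x) has_real_derivative D) (at x) \<and> 0 \<le> D" by blast
  qed
  then show ?thesis by simp
qed

lemma kob_dist_ball_le:
  assumes "cdom \<Omega>" "ball p s \<subseteq> \<Omega>" "dist p q \<le> s / 2" "s > 0"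
  shows "kob_dist \<Omega> p q \<le> 2 * dist p q / s"
proof -
  define y where "y = dist p q / s"
  have y: "0 \<le> y" "y \<le> 1/2" using assms by (auto simp: y_def field_simps)
  have "kob_dist \<Omega> p q \<le> artanh y" unfolding y_def using kob_dist_ball[OF assms(1,2)] assms by simp
  also have "\<dots> \<le> y / (1 - y)" using y by (intro artanh_le) auto
  also have "\<dots> \<le> y / (1/2)" using y by (intro divide_left_mono) auto
  finally show ?thesis by (simp add: y_def mult.commute)
qed

text \<open>If \<open>z\<close> in the smaller ball is missing from \<open>S\<close>, some
  hyperplane through \<open>z\<close> has \<open>S\<close> on one side. Moving from \<open>z\<close>
  by \<open>c / 2\<close> along its normal stays in the larger ball, hence in \<open>X\<close>, but
  leads to distance at least \<open>c / 2\<close> from \<open>closure S\<close>, against the error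
  \<open>c / 4\<close>. The window of radius \<open>R + c\<close> contains the larger ball.\<close>

lemma convex_erode:
  fixes S X :: "'a::euclidean_space set"
  assumes S: "convex S" "open S" and q: "ball q c \<subseteq> X" "c > 0" "norm q \<le> R"
    and near: "\<forall>x\<in>closure X \<inter> cball 0 (R + c). \<exists>y\<in>closure S \<inter> cball 0 (R + c). dist x y \<le> c / 4"
  shows "ball q (c / 2) \<subseteq> S"
proof (rule ccontr)
  assume "\<not> ?thesis"
  then obtain z where z: "dist q z < c / 2" "z \<notin> S" unfolding subset_iff mem_ball by blast
  have mem: "x \<in> closure X \<inter> cball 0 (R + c)" if "dist q x < c" for x
    using that q(1,3) closure_subset[of X] norm_triangle_sub[of x q] by (auto simp: dist_norm norm_minus_commute)
  have "S \<noteq> {}" using near mem[of q] q(2) by fastforce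
  then obtain a where a: "norm a = 1" "\<And>x. x \<in> S \<Longrightarrow> a \<bullet> x < a \<bullet> z"
    using open_convex_support[OF S(2,1) _ z(2)] by blast
  define x where "x = z + (c / 2) *\<^sub>R a"
  have "dist q x \<le> dist q z + dist z x" by (rule dist_triangle)
  also have "dist z x = c / 2" using a(1) q(2) by (simp add: x_def dist_norm)
  finally have "dist q x < c" using z(1) by simp
  then obtain y where y: "y \<in> closure S" "dist x y \<le> c / 4" using near mem[of x] by blast
  have "closure S \<subseteq> {y. a \<bullet> y \<le> a \<bullet> z}"
    by (rule closure_minimal) (use a(2) in \<open>auto simp: closed_halfspace_le intro: less_imp_le\<close>)
  then have "a \<bullet> y \<le> a \<bullet> z" using y(1) by auto
  moreover have "a \<bullet> x = a \<bullet> z + c / 2" using a(1) by (simp add: x_def inner_right_distrib dot_square_norm)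
  moreover have "a \<bullet> x - a \<bullet> y \<le> dist x y"
    using norm_cauchy_schwarz[of a "x - y"] a(1) by (simp add: inner_diff_right dist_norm)
  ultimately show False using y(2) q(2) by simp
qed

lemma hausdorff_ball_limit:
  assumes "local_hausdorff_conv A B" "convex B" "open B" "c > 0" "R > 0"
  shows "eventually (\<lambda>n. \<forall>q. norm q \<le> R \<longrightarrow> ball q c \<subseteq> A n \<longrightarrow> ball q (c / 2) \<subseteq> B) sequentially"
proof -
  have "eventually (\<lambda>n. \<forall>x\<in>closure (A n) \<inter> cball 0 (R + c). \<exists>y\<in>closure B \<inter> cball 0 (R + c). dist x y \<le> c / 4) sequentially"
    using assms unfolding local_hausdorff_conv_def
    by (elim allE[of _ "R + c"] allE[of _ "c / 4"] impE) (auto elim: eventually_mono)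
  then show ?thesis by eventually_elim (use convex_erode assms in blast)
qed

lemma hausdorff_ball_seq:
  assumes "local_hausdorff_conv A B" "\<And>n. convex (A n)" "\<And>n. open (A n)" "c > 0" "R > 0"
  shows "eventually (\<lambda>n. \<forall>q. norm q \<le> R \<longrightarrow> ball q c \<subseteq> B \<longrightarrow> ball q (c / 2) \<subseteq> A n) sequentially"
proof -
  have "eventually (\<lambda>n. \<forall>x\<in>closure B \<inter> cball 0 (R + c). \<exists>y\<in>closure (A n) \<inter> cball 0 (R + c). dist x y \<le> c / 4) sequentially"
    using assms unfolding local_hausdorff_conv_def
    by (elim allE[of _ "R + c"] allE[of _ "c / 4"] impE) (auto elim!: eventually_mono simp: dist_commute)
  then show ?thesis by eventually_elim (use convex_erode assms in blast)
qed

lemma hausdorff_compact: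
  fixes A :: "nat \<Rightarrow> 'a::euclidean_space set"
  assumes "local_hausdorff_conv A B" "\<And>n. convex (A n)" "\<And>n. open (A n)" "open B" "compact K" "K \<subseteq> B"
  shows "eventually (\<lambda>n. K \<subseteq> A n) sequentially"
proof -
  obtain e where e: "e > 0" "(\<Union>x\<in>K. cball x e) \<subseteq> B"
    using compact_subset_open_imp_cball_epsilon_subset[OF assms(5,4,6)] .
  obtain R where R: "R > 0" "\<And>x. x \<in> K \<Longrightarrow> norm x \<le> R"
    using compact_imp_bounded[OF assms(5)] by (auto simp: bounded_pos)
  show ?thesis
    using hausdorff_ball_seq[OF assms(1-3) e(1) R(1)]
  proof eventually_elim
    case (elim n)
    show ?case
    proof
      fix x assume x: "x \<in> K"
      then have "ball x e \<subseteq> B" using e(2) by (force simp: subset_iff)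
      then have "ball x (e / 2) \<subseteq> A n" using elim R(2)[OF x] by blast
      then show "x \<in> A n" using e(1) by auto
    qed
  qed
qed

text \<open>Contraction towards an interior point absorbs the Hausdorff error: a bounded part of
  \<open>A n\<close> need not lie in \<open>B\<close>, but its contraction does.\<close>

lemma hausdorff_scaled:
  fixes A :: "nat \<Rightarrow> 'a::euclidean_space set"
  assumes "local_hausdorff_conv A B" "convex B" "open B" "u \<in> B" "\<epsilon> > 0" "\<rho> > 0"
  shows "eventually (\<lambda>n. \<forall>x\<in>A n \<inter> ball 0 \<rho>. u + (1 / (1 + \<epsilon>)) *\<^sub>R (x - u) \<in> B) sequentially"
proof -
  obtain s where s: "s > 0" "ball u s \<subseteq> B" using assms openE by blast
  have "eventually (\<lambda>n. \<forall>x\<in>closure (A n) \<inter> cball 0 \<rho>. \<exists>y\<in>closure B \<inter> cball 0 \<rho>. dist x y \<le> \<epsilon> * s / 2) sequentially"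
    using assms s unfolding local_hausdorff_conv_def
    by (elim allE[of _ \<rho>] allE[of _ "\<epsilon> * s / 2"] impE) (auto elim: eventually_mono)
  then show ?thesis
  proof eventually_elim
    case (elim n)
    show ?case
    proof
      fix x assume "x \<in> A n \<inter> ball 0 \<rho>"
      then have "x \<in> closure (A n) \<inter> cball 0 \<rho>" using closure_subset by auto
      then obtain y where y: "y \<in> closure B" "dist x y \<le> \<epsilon> * s / 2" using elim by blast
      \<comment> \<open>Chosen so that the contracted \<open>x\<close> is the convex combination of
        \<open>y\<close> and \<open>w\<close> with weights \<open>1 / (1 + \<epsilon>)\<close> and
        \<open>\<epsilon> / (1 + \<epsilon>)\<close>; the error \<open>\<epsilon> * s / 2\<close>
        keeps \<open>w\<close> within \<open>s / 2\<close> of \<open>u\<close>.\<close>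
      define w where "w = u + (1 / \<epsilon>) *\<^sub>R (x - y)"
      have "dist u w = dist x y / \<epsilon>" using assms(5) by (simp add: w_def dist_norm del: scaleR_right_diff_distrib)
      also have "\<dots> \<le> s / 2" using y(2) assms(5) by (simp add: field_simps)
      finally have "dist u w \<le> s / 2" .
      then have "w \<in> interior B" using s assms(3) by (auto simp: interior_open)
      then have "y - (\<epsilon> / (1 + \<epsilon>)) *\<^sub>R (y - w) \<in> interior B"
        using assms(5) by (intro mem_interior_closure_convex_shrink[OF assms(2) _ y(1)]) auto
      also have "y - (\<epsilon> / (1 + \<epsilon>)) *\<^sub>R (y - w) = u + (1 / (1 + \<epsilon>)) *\<^sub>R (x - u)"
      proof -
        have "(1 + \<epsilon>) *\<^sub>R (y - (\<epsilon> / (1 + \<epsilon>)) *\<^sub>R (y - w)) = (1 + \<epsilon>) *\<^sub>R (u + (1 / (1 + \<epsilon>)) *\<^sub>R (x - u))"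
          using assms(5) by (simp add: w_def scaleR_right_diff_distrib scaleR_add_right scaleR_add_left)
        then show ?thesis using assms(5) by simp
      qed
      finally show "u + (1 / (1 + \<epsilon>)) *\<^sub>R (x - u) \<in> B" using interior_subset by blast
    qed
  qed
qed

lemma holo_disc_continuous: "holo_disc f \<Longrightarrow> continuous_on (ball 0 1) f"
  using continuous_on_vec_lambda[of "ball 0 1" "\<lambda>i z. f z $ i"]
  by (auto simp: holo_disc_def intro: holomorphic_on_imp_continuous_on)

text \<open>Restricting the disc to a radius \<open>r\<close> close to 1 gives a compact image,
  which survives small changes of the domain, while the length grows only from
  \<open>artanh (cmod \<zeta>)\<close> to \<open>artanh (cmod \<zeta> / r)\<close>.\<close>

lemma disc_step_shrink:
  assumes "disc_step \<Omega> x y \<tau>" "e > 0"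
  obtains K \<tau>' where "compact K" "K \<subseteq> \<Omega>" "\<tau>' < \<tau> + e" "\<And>\<Omega>'. K \<subseteq> \<Omega>' \<Longrightarrow> disc_step \<Omega>' x y \<tau>'"
proof -
  obtain f \<zeta> where f: "cmod \<zeta> < 1" "holo_disc f" "f ` ball 0 1 \<subseteq> \<Omega>" "f 0 = x" "f \<zeta> = y"
    "\<tau> = poinc0 \<zeta>"
    using assms(1) by (auto simp: disc_step_def)
  have "((\<lambda>r. artanh (cmod \<zeta> / r)) \<longlongrightarrow> artanh (cmod \<zeta> / 1)) (at_left 1)"
    using f(1) by (intro tendsto_intros) (auto intro: less_le_trans[of _ 0])
  then have "\<forall>\<^sub>F r in at_left 1. artanh (cmod \<zeta> / r) < \<tau> + e"
    by (rule order_tendstoD) (use f assms in \<open>auto simp: poinc0_def\<close>)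
  moreover have "\<forall>\<^sub>F r in at_left 1. r \<in> {cmod \<zeta><..<1}"
    using f(1) by (intro eventually_at_left_real)
  ultimately have "\<forall>\<^sub>F r in at_left 1. artanh (cmod \<zeta> / r) < \<tau> + e \<and> r \<in> {cmod \<zeta><..<1}"
    by eventually_elim auto
  then obtain r where r: "artanh (cmod \<zeta> / r) < \<tau> + e" "cmod \<zeta> < r" "r < 1"
    using eventually_happens[of _ "at_left (1::real)"] by (auto simp: trivial_limit_at_left_real)
  have r0: "r > 0" using r(2) by (meson norm_ge_zero order.strict_trans1)
  let ?K = "f ` cball 0 r"
  show ?thesis
  proof (rule that[of ?K "artanh (cmod \<zeta> / r)"])
    show "compact ?K"
      by (rule compact_continuous_image[OF continuous_on_subset[OF holo_disc_continuous[OF f(2)]]])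
         (use r in auto)
    show "?K \<subseteq> \<Omega>" using f(3) r by fastforce
    fix \<Omega>' assume K: "?K \<subseteq> \<Omega>'"
    have m: "(\<lambda>z. of_real r * z) ` ball 0 1 \<subseteq> ball (0::complex) 1"
    proof -
      have "r * cmod z < 1" if "cmod z < 1" for z
        using mult_strict_mono[OF r(3) that] r0 by simp
      then show ?thesis using r0 by (auto simp: norm_mult)
    qed
    have b: "holo_disc (\<lambda>z. f (of_real r * z))"
      by (rule holo_disc_compose[OF f(2) _ m]) (intro holomorphic_intros)
    have c: "f (of_real r * z) \<in> \<Omega>'" if "cmod z < 1" for z
    proof -
      have "of_real r * z \<in> cball 0 r" using that r0 by (simp add: norm_mult mult_left_le)
      then show ?thesis using K by blast
    qed
    show "disc_step \<Omega>' x y (artanh (cmod \<zeta> / r))"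
      unfolding disc_step_def
      by (rule exI[of _ "\<lambda>z. f (of_real r * z)"], rule exI[of _ "\<zeta> / of_real r"])
        (use b c f r r0 in \<open>auto simp: norm_divide poinc0_def\<close>)
  qed (rule r(1))
qed

lemma kchain_eventually:
  assumes haus: "local_hausdorff_conv A B" and A: "\<And>n. cdom (A n)" and B: "cdom B"
    and "kchain B x y S" "S < T"
  shows "eventually (\<lambda>n. \<exists>S'<T. kchain (A n) x y S') sequentially"
  using assms(4,5)
proof (induction arbitrary: T rule: kchain.induct)
  case (Nil x)
  have "eventually (\<lambda>n. {x} \<subseteq> A n) sequentially"
    by (rule hausdorff_compact[OF haus]) (use A B Nil in \<open>auto simp: cdom_def\<close>)
  then show ?case by eventually_elim (use Nil in \<open>auto intro: kchain.Nil\<close>)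
next
  case (Cons x y \<tau> z S)
  define e where "e = (T - (\<tau> + S)) / 2"
  have e: "e > 0" using Cons.prems by (simp add: e_def)
  obtain K \<tau>' where K: "compact K" "K \<subseteq> B" "\<tau>' < \<tau> + e" "\<And>\<Omega>'. K \<subseteq> \<Omega>' \<Longrightarrow> disc_step \<Omega>' x y \<tau>'"
    using disc_step_shrink[OF Cons.hyps(1) e] by blast
  have "eventually (\<lambda>n. K \<subseteq> A n) sequentially"
    by (rule hausdorff_compact[OF haus]) (use A B K in \<open>auto simp: cdom_def\<close>)
  moreover have "eventually (\<lambda>n. \<exists>S'<S + e. kchain (A n) y z S') sequentially"
    using Cons.IH[of "S + e"] e by simp
  ultimately show ?case
  proof eventually_elim
    case (elim n)
    then obtain S' where S': "S' < S + e" "kchain (A n) y z S'" by blast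
    have "\<tau>' + S' < T" using S' K(3) by (simp add: e_def field_simps)
    then show ?case using kchain.Cons[OF K(4)[OF elim(1)] S'(2)] by blast
  qed
qed

lemma kob_dist_near:
  assumes haus: "local_hausdorff_conv A B" and A: "\<And>n. cdom (A n)" and B: "cdom B"
    and G: "G \<le> sequentially" and p: "(p \<longlongrightarrow> p0) G" "p0 \<in> B" "e > 0"
  shows "eventually (\<lambda>n. p n \<in> A n \<and> p0 \<in> A n \<and> kob_dist (A n) p0 (p n) < e) G"
proof -
  obtain s where s: "s > 0" "ball p0 s \<subseteq> B" using B p openE by (metis cdom_def)
  have "eventually (\<lambda>n. \<forall>q. norm q \<le> norm p0 + 1 \<longrightarrow> ball q s \<subseteq> B \<longrightarrow> ball q (s / 2) \<subseteq> A n) G"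
    by (rule filter_leD[OF G], rule hausdorff_ball_seq[OF haus])
      (use A s in \<open>auto simp: cdom_def add_nonneg_pos\<close>)
  moreover define \<delta> where "\<delta> = min (s / 4) (e * s / 8)"
  have "\<delta> > 0" using s p by (simp add: \<delta>_def)
  then have "eventually (\<lambda>n. dist (p n) p0 < \<delta>) G" using p(1) tendstoD by blast
  ultimately show ?thesis
  proof eventually_elim
    case (elim n)
    have b: "ball p0 (s / 2) \<subseteq> A n" using elim(1) s(2) by auto
    have d: "dist p0 (p n) < s / 4" "dist p0 (p n) < e * s / 8" using elim(2) by (auto simp: \<delta>_def dist_commute)
    have "kob_dist (A n) p0 (p n) \<le> 2 * dist p0 (p n) / (s / 2)"
      by (rule kob_dist_ball_le[OF A b]) (use s d in auto)
    also have "\<dots> < e" using d(2) s p(3) zero_le_dist[of p0 "p n"] by (simp add: field_simps del: zero_le_dist)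
    finally show ?case using b d s by (auto simp: subset_iff)
  qed
qed

text \<open>The easy half of continuity: the shrunk discs of a finite chain in \<open>B\<close>
  eventually lie in \<open>A n\<close>. The filter \<open>G\<close> is general because limits are
  later taken along a filter finer than \<open>sequentially\<close>.\<close>

lemma kob_dist_usc:
  assumes haus: "local_hausdorff_conv A B" and A: "\<And>n. cdom (A n)" and B: "cdom B"
    and G: "G \<le> sequentially" and p: "(p \<longlongrightarrow> p0) G" "p0 \<in> B" and q: "(q \<longlongrightarrow> q0) G" "q0 \<in> B"
    and T: "kob_dist B p0 q0 < T"
  shows "eventually (\<lambda>n. kob_dist (A n) (p n) (q n) < T) G"
proof -
  define e where "e = (T - kob_dist B p0 q0) / 3"
  have e: "e > 0" using T by (simp add: e_def)
  have "kob_dist B p0 q0 < T - 2 * e" using T by (simp add: e_def field_simps)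
  then obtain S where S: "S < T - 2 * e" "kchain B p0 q0 S" using kob_dist_less[OF B p(2) q(2)] by blast
  have "eventually (\<lambda>n. \<exists>S'<T - 2 * e. kchain (A n) p0 q0 S') G"
    by (rule filter_leD[OF G], rule kchain_eventually[OF haus A B S(2,1)])
  then show ?thesis using kob_dist_near[OF haus A B G p e] kob_dist_near[OF haus A B G q e]
  proof eventually_elim
    case (elim n)
    then have m: "p n \<in> A n" "q n \<in> A n" "p0 \<in> A n" "q0 \<in> A n" by auto
    have "kob_dist (A n) p0 q0 < T - 2 * e" using elim(1) kob_dist_le[OF A] by (meson order.strict_trans1)
    moreover have "kob_dist (A n) (p n) p0 < e" "kob_dist (A n) q0 (q n) < e"
      using elim kob_dist_sym[OF A m(1,3)] by auto
    ultimately show ?case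
      using kob_dist_triangle[OF A m(1,3,2)] kob_dist_triangle[OF A m(3,4,2)] by linarith
  qed
qed

text \<open>Stated for an arbitrary filter because it serves two limits: along the cluster filter,
  and along \<open>at_right 0\<close> for the contraction parameter.\<close>

lemma kob_dist_le_limit:
  assumes B: "cdom B" and F: "F \<noteq> bot" and p: "(p \<longlongrightarrow> p0) F" "p0 \<in> B" and q: "(q \<longlongrightarrow> q0) F" "q0 \<in> B"
    and e: "eventually (\<lambda>n. kob_dist B (p n) (q n) \<le> e n) F" "(e \<longlongrightarrow> e0) F"
  shows "kob_dist B p0 q0 \<le> e0"
proof -
  have near: "eventually (\<lambda>n. p n \<in> B \<and> kob_dist B p0 (p n) \<le> 2 * dist p0 (p n) / s) F"
    if p: "(p \<longlongrightarrow> p0) F" and s: "s > 0" "ball p0 s \<subseteq> B" for p p0 and s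
    using tendstoD[OF p, of "s / 2"] s
    by (auto elim!: eventually_mono intro!: kob_dist_ball_le[OF B s(2)] simp: dist_commute subset_iff)
  obtain s where s: "s > 0" "ball p0 s \<subseteq> B" using B p openE by (metis cdom_def)
  obtain t where t: "t > 0" "ball q0 t \<subseteq> B" using B q openE by (metis cdom_def)
  have "((\<lambda>n. 2 * dist p0 (p n) / s + e n + 2 * dist q0 (q n) / t) \<longlongrightarrow> 2 * dist p0 p0 / s + e0 + 2 * dist q0 q0 / t) F"
    using s t by (intro tendsto_intros p q e) auto
  moreover have "eventually (\<lambda>n. kob_dist B p0 q0 \<le> 2 * dist p0 (p n) / s + e n + 2 * dist q0 (q n) / t) F"
    using near[OF p(1) s] near[OF q(1) t] e(1)
  proof eventually_elim
    case (elim n)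
    then have m: "p n \<in> B" "q n \<in> B" by auto
    show ?case using elim kob_dist_triangle[OF B p(2) m(1) q(2)] kob_dist_triangle[OF B m q(2)]
      kob_dist_sym[OF B m(2) q(2)] by linarith
  qed
  ultimately have "kob_dist B p0 q0 \<le> 2 * dist p0 p0 / s + e0 + 2 * dist q0 q0 / t"
    using F by (rule tendsto_lowerbound)
  then show ?thesis by simp
qed

text \<open>
  The disc of radius \<open>r < 1\<close> of a disc centred at a good point stays in a fixed Euclidean ball, where
  the rescaled domains are comparable with their limit. Passing to this smaller disc costs only a
  factor close to 1 on short steps.
\<close>

lemma disc_step_localize:
  assumes \<Omega>: "cdom \<Omega>" and r: "r < 1" and x: "norm x \<le> R" "\<And>v. v \<noteq> 0 \<Longrightarrow> bdist_dir \<Omega> x v \<le> M"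
    and \<psi>: "\<And>f. holo_disc f \<Longrightarrow> holo_disc (\<lambda>z. \<psi> (f z))" "\<And>y. y \<in> \<Omega> \<Longrightarrow> norm y < \<rho> \<Longrightarrow> \<psi> y \<in> B"
    and \<rho>: "R + 2 * r / (1 - r) * M < \<rho>" and step: "disc_step \<Omega> x y \<tau>" and \<tau>: "\<tau> < r"
  shows "\<exists>\<tau>'. disc_step B (\<psi> x) (\<psi> y) \<tau>' \<and> \<tau>' \<le> \<tau> / (r - \<tau>)"
proof -
  obtain f \<zeta> where f: "cmod \<zeta> < 1" "holo_disc f" "f ` ball 0 1 \<subseteq> \<Omega>" "f 0 = x" "f \<zeta> = y"
    "\<tau> = poinc0 \<zeta>"
    using step by (auto simp: disc_step_def)
  have \<tau>0: "0 \<le> \<tau>" using step disc_step_nonneg by blast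
  have \<zeta>: "cmod \<zeta> \<le> \<tau>" using f le_artanh[of "cmod \<zeta>"] by (simp add: poinc0_def)
  have r0: "r > 0" using \<tau> \<tau>0 by simp
  have M: "M \<ge> 0" using x(2)[of 1] by (smt (verit) bdist_dir_def infdist_nonneg one_neq_zero zero_neq_one)
  have x\<Omega>: "x \<in> \<Omega>" using f by force
  have m: "cmod (of_real r * z) \<le> r" if "cmod z < 1" for z
    using that r0 by (simp add: norm_mult mult_left_le)
  have in\<Omega>: "f (of_real r * z) \<in> \<Omega>" if "cmod z < 1" for z
    using m[OF that] r f(3) by (auto simp: image_subset_iff)
  have bound: "norm (f (of_real r * z)) < \<rho>" if z: "cmod z < 1" for z
  proof (cases "x = f (of_real r * z)")
    case True
    have "0 \<le> 2 * r / (1 - r) * M" using r r0 M by simp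
    then show ?thesis using True x(1) \<rho> by simp
  next
    case False
    let ?w = "f (of_real r * z)"
    have "disc_step \<Omega> x ?w (poinc0 (of_real r * z))"
      unfolding disc_step_def using f m[OF z] r
      by (intro exI[of _ f] exI[of _ "of_real r * z"]) auto
    then have "kob_dist \<Omega> x ?w \<le> poinc0 (of_real r * z)" by (rule kob_dist_le[OF \<Omega> kchain_single])
    also have "\<dots> \<le> artanh r" unfolding poinc0_def by (rule artanh_mono) (use m[OF z] r in auto)
    finally have "exp (2 * kob_dist \<Omega> x ?w) \<le> exp (2 * artanh r)" by simp
    also have "\<dots> = (1 + r) / (1 - r)" using exp_two_artanh r r0 by simp
    finally have e: "exp (2 * kob_dist \<Omega> x ?w) - 1 \<le> 2 * r / (1 - r)" using r by (simp add: field_simps)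
    have "dist x ?w \<le> (exp (2 * kob_dist \<Omega> x ?w) - 1) * bdist_dir \<Omega> x (?w - x)"
      by (rule dist_le_bdist_dir[OF \<Omega> x\<Omega> in\<Omega>[OF z] False])
    also have "\<dots> \<le> 2 * r / (1 - r) * M"
      by (rule mult_mono[OF e x(2)]) (use False r r0 in \<open>auto simp: bdist_dir_def infdist_nonneg\<close>)
    finally have "norm ?w \<le> norm x + 2 * r / (1 - r) * M"
      using norm_triangle_sub[of ?w x] by (simp add: dist_norm norm_minus_commute)
    with x(1) \<rho> show ?thesis by simp
  qed
  have im: "(\<lambda>z. of_real r * z) ` ball 0 1 \<subseteq> ball (0::complex) 1"
    using m r by (force)
  have h: "holo_disc (\<lambda>z. \<psi> (f (of_real r * z)))"
    by (rule \<psi>(1)[OF holo_disc_compose[OF f(2) _ im]]) (intro holomorphic_intros)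
  have "disc_step B (\<psi> x) (\<psi> y) (artanh (cmod \<zeta> / r))"
    unfolding disc_step_def
    by (rule exI[of _ "\<lambda>z. \<psi> (f (of_real r * z))"], rule exI[of _ "\<zeta> / of_real r"])
      (use h f \<zeta> \<tau> r0 \<psi>(2)[OF in\<Omega> bound] in \<open>auto simp: norm_divide poinc0_def\<close>)
  moreover have "artanh (cmod \<zeta> / r) \<le> \<tau> / (r - \<tau>)"
  proof -
    have "artanh (cmod \<zeta> / r) \<le> (cmod \<zeta> / r) / (1 - cmod \<zeta> / r)"
      using \<zeta> \<tau> r0 by (intro artanh_le) auto
    also have "\<dots> = cmod \<zeta> / (r - cmod \<zeta>)" using r0 \<zeta> \<tau> by (simp add: field_simps)
    also have "\<dots> \<le> \<tau> / (r - \<tau>)" using \<zeta> \<tau> \<tau>0 by (intro frac_le) auto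
    finally show ?thesis .
  qed
  ultimately show ?thesis by blast
qed

text \<open>The budget \<open>kob_dist \<Omega> u x + S \<le> L\<close> is preserved along the
  chain, so every disc starts at a point where \<open>good\<close> applies. As no disc is longer
  than \<open>\<tau>0\<close>, each loses at most the same factor
  \<open>1 / (r - \<tau>0)\<close>.\<close>

lemma kchain_localize:
  assumes \<Omega>: "cdom \<Omega>" and u: "u \<in> \<Omega>" and r: "r < 1" "\<tau>0 < r"
    and good: "\<And>x. x \<in> \<Omega> \<Longrightarrow> kob_dist \<Omega> u x \<le> L \<Longrightarrow> norm x \<le> R \<and> (\<forall>v. v \<noteq> 0 \<longrightarrow> bdist_dir \<Omega> x v \<le> M)"
    and \<psi>: "\<And>f. holo_disc f \<Longrightarrow> holo_disc (\<lambda>z. \<psi> (f z))" "\<And>y. y \<in> \<Omega> \<Longrightarrow> norm y < \<rho> \<Longrightarrow> \<psi> y \<in> B"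
    and \<rho>: "R + 2 * r / (1 - r) * M < \<rho>" and r0: "r > 0" and M: "M \<ge> 0"
  shows "kchain \<Omega> x y S \<Longrightarrow> S \<le> \<tau>0 \<Longrightarrow> kob_dist \<Omega> u x + S \<le> L \<Longrightarrow>
    \<exists>S'. kchain B (\<psi> x) (\<psi> y) S' \<and> S' \<le> S / (r - \<tau>0)"
proof (induction rule: kchain.induct)
  case (Nil x)
  have "norm x \<le> R" using good[of x] Nil by auto
  moreover have "0 \<le> 2 * r / (1 - r) * M" using r r0 M by simp
  ultimately have "\<psi> x \<in> B" using \<psi>(2) Nil \<rho> by auto
  then show ?case using kchain.Nil by fastforce
next
  case (Cons x y \<tau> z S)
  have S: "0 \<le> S" "0 \<le> \<tau>" using kchain_nonneg[OF Cons.hyps(2)] disc_step_nonneg[OF Cons.hyps(1)] by auto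
  have xy: "x \<in> \<Omega>" "y \<in> \<Omega>" using disc_step_mem[OF Cons.hyps(1)] by auto
  have "kob_dist \<Omega> u y \<le> kob_dist \<Omega> u x + \<tau>"
    using kob_dist_triangle[OF \<Omega> u xy] kob_dist_le[OF \<Omega> kchain_single[OF Cons.hyps(1)]] by simp
  then obtain S' where S': "kchain B (\<psi> y) (\<psi> z) S'" "S' \<le> S / (r - \<tau>0)" using Cons S by auto
  have g: "norm x \<le> R" "\<And>v. v \<noteq> 0 \<Longrightarrow> bdist_dir \<Omega> x v \<le> M" using good[OF xy(1)] Cons.prems S by auto
  have "\<exists>\<tau>'. disc_step B (\<psi> x) (\<psi> y) \<tau>' \<and> \<tau>' \<le> \<tau> / (r - \<tau>)"
    by (rule disc_step_localize[where R = R and M = M and \<rho> = \<rho>])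
      (use \<Omega> r g \<psi> \<rho> Cons.hyps(1) Cons.prems S in auto)
  then obtain \<tau>' where \<tau>': "disc_step B (\<psi> x) (\<psi> y) \<tau>'" "\<tau>' \<le> \<tau> / (r - \<tau>)" by blast
  have "\<tau> / (r - \<tau>) \<le> \<tau> / (r - \<tau>0)" using Cons.prems S r by (intro divide_left_mono) (auto intro!: mult_pos_pos)
  then have "\<tau>' + S' \<le> (\<tau> + S) / (r - \<tau>0)" using \<tau>'(2) S'(2) by (simp add: add_divide_distrib)
  then show ?case using kchain.Cons[OF \<tau>'(1) S'(1)] by blast
qed

lemma kob_dist_localize:
  assumes \<Omega>: "cdom \<Omega>" and B: "cdom B" and u: "u \<in> \<Omega>" and r: "r < 1" "\<tau>0 < r" "0 < \<tau>0"
    and good: "\<And>x. x \<in> \<Omega> \<Longrightarrow> kob_dist \<Omega> u x \<le> L \<Longrightarrow> norm x \<le> R \<and> (\<forall>v. v \<noteq> 0 \<longrightarrow> bdist_dir \<Omega> x v \<le> M)"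
    and \<psi>: "\<And>f. holo_disc f \<Longrightarrow> holo_disc (\<lambda>z. \<psi> (f z))" "\<And>y. y \<in> \<Omega> \<Longrightarrow> norm y < \<rho> \<Longrightarrow> \<psi> y \<in> B"
    and \<rho>: "R + 2 * r / (1 - r) * M < \<rho>" and M: "M \<ge> 0"
    and xy: "x \<in> \<Omega>" "y \<in> \<Omega>" "kob_dist \<Omega> x y < \<tau>0" "kob_dist \<Omega> u x + \<tau>0 \<le> L"
  shows "kob_dist B (\<psi> x) (\<psi> y) \<le> kob_dist \<Omega> x y / (r - \<tau>0)"
proof (rule ccontr)
  assume "\<not> ?thesis"
  then have "kob_dist \<Omega> x y < min \<tau>0 (kob_dist B (\<psi> x) (\<psi> y) * (r - \<tau>0))"
    using r xy(3) by (simp add: field_simps)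
  then obtain S where S: "S < min \<tau>0 (kob_dist B (\<psi> x) (\<psi> y) * (r - \<tau>0))" "kchain \<Omega> x y S"
    using kob_dist_less[OF \<Omega> xy(1,2)] by blast
  have "\<exists>S'. kchain B (\<psi> x) (\<psi> y) S' \<and> S' \<le> S / (r - \<tau>0)"
    by (rule kchain_localize[OF \<Omega> u r(1,2) good \<psi> \<rho> _ M S(2)]) (use S xy r in auto)
  then have "kob_dist B (\<psi> x) (\<psi> y) \<le> S / (r - \<tau>0)" using kob_dist_le[OF B] by force
  then show False using S(1) r by (simp add: field_simps)
qed

section \<open>Limits of almost geodesics\<close>

text \<open>
  Tychonoff's theorem replaces a diagonal argument: limits are taken along a filter finer than
  \<^const>\<open>sequentially\<close> instead of along a subsequence.
\<close>

lemma pointwise_cluster: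
  fixes f :: "nat \<Rightarrow> 'i \<Rightarrow> 'a::topological_space"
  assumes K: "\<And>t. compact (K t)" and ev: "\<And>t. eventually (\<lambda>n. f n t \<in> K t) sequentially"
  obtains g G where "G \<noteq> bot" "G \<le> sequentially" "\<And>t. g t \<in> K t" "\<And>t. ((\<lambda>n. f n t) \<longlongrightarrow> g t) G"
proof -
  have "\<exists>x. x \<in> K t" for t using eventually_happens[OF ev[of t]] by auto
  then obtain k where k: "\<And>t. k t \<in> K t" by metis
  \<comment> \<open>Values outside \<open>K t\<close> are replaced so that every \<open>h n\<close>
    lies in the compact product; for each fixed \<open>t\<close> only finitely many \<open>n\<close>
    are affected.\<close>
  define h where "h n t = (if f n t \<in> K t then f n t else k t)" for n t
  have h: "h n \<in> PiE UNIV K" for n using k by (auto simp: h_def)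
  have "compactin (product_topology (\<lambda>_. euclidean) UNIV) (PiE UNIV K)"
    unfolding compactin_PiE using K by simp
  then have "compact (PiE UNIV K)" by (simp add: euclidean_product_topology)
  then obtain g where g: "g \<in> PiE UNIV K" "inf (nhds g) (filtermap h sequentially) \<noteq> bot"
    unfolding compact_filter using h
    by (metis (no_types, lifting) eventually_filtermap always_eventually filtermap_bot_iff sequentially_bot)
  \<comment> \<open>The coarsest refinement of \<open>sequentially\<close> along which
    \<open>h\<close> tends to \<open>g\<close>; it is proper because \<open>g\<close> is a cluster
    point.\<close>
  define G where "G = inf sequentially (filtercomap h (nhds g))"
  have "G \<noteq> bot"
  proof
    assume "G = bot"
    then obtain P Q where PQ: "eventually P sequentially" "eventually Q (filtercomap h (nhds g))" "\<And>n. P n \<Longrightarrow> Q n \<Longrightarrow> False"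
      unfolding G_def trivial_limit_def eventually_inf by auto
    obtain R where R: "eventually R (nhds g)" "\<And>n. R (h n) \<Longrightarrow> Q n" using PQ(2) by (auto simp: eventually_filtercomap)
    have "eventually (\<lambda>x. \<not> R x) (filtermap h sequentially)"
      unfolding eventually_filtermap using PQ(1) by eventually_elim (use PQ(3) R(2) in auto)
    with R(1) have "eventually (\<lambda>_. False) (inf (nhds g) (filtermap h sequentially))"
      unfolding eventually_inf by blast
    then show False using g(2) by (simp add: trivial_limit_def)
  qed
  moreover have le: "G \<le> sequentially" by (simp add: G_def)
  moreover have "((\<lambda>n. f n t) \<longlongrightarrow> g t) G" for t
  proof -
    have "(h \<longlongrightarrow> g) G" unfolding filterlim_iff_le_filtercomap G_def by simp
    then have "((\<lambda>n. h n t) \<longlongrightarrow> g t) G"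
      by (rule continuous_on_tendsto_compose[OF continuous_on_product_coordinates[of t]]) auto
    moreover have "eventually (\<lambda>n. h n t = f n t) G"
      using filter_leD[OF le ev[of t]] by eventually_elim (simp add: h_def)
    ultimately show ?thesis by (simp add: tendsto_cong)
  qed
  ultimately show ?thesis using that g(1) by blast
qed

section \<open>Uniform estimates for the rescaled domains\<close>

locale rescaled_seq =
  fixes A :: "nat \<Rightarrow> (complex ^ 'n) set" and B :: "(complex ^ 'n) set" and m :: real
    and u :: "nat \<Rightarrow> complex ^ 'n" and u0 :: "complex ^ 'n"
  assumes cdA: "\<And>n. cdom (A n)" and cdB: "cdom B" and m: "m > 0"
    and haus: "local_hausdorff_conv A B" and lmc: "locally_m_convex_seq m A"
    and u_in: "\<And>n. u n \<in> A n" and u_lim: "u \<longlonglongrightarrow> u0" and u0: "u0 \<in> B"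
begin

lemma ball_u: "\<exists>s>0. eventually (\<lambda>n. ball (u n) s \<subseteq> A n \<and> norm (u n) < norm u0 + 1) sequentially"
proof -
  obtain s where s: "s > 0" "ball u0 s \<subseteq> B" using cdB u0 openE by (metis cdom_def)
  have ev: "eventually (\<lambda>n. \<forall>q. norm q \<le> norm u0 + 1 \<longrightarrow> ball q s \<subseteq> B \<longrightarrow> ball q (s / 2) \<subseteq> A n) sequentially"
    by (rule hausdorff_ball_seq[OF haus]) (use cdA s in \<open>auto simp: cdom_def add_nonneg_pos\<close>)
  have "min 1 (s / 4) > 0" using s by simp
  from tendstoD[OF u_lim this] have "eventually (\<lambda>n. dist (u n) u0 < 1 \<and> dist (u n) u0 < s / 4) sequentially"
    by eventually_elim auto
  with ev have "eventually (\<lambda>n. ball (u n) (s / 4) \<subseteq> A n \<and> norm (u n) < norm u0 + 1) sequentially"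
  proof eventually_elim
    case (elim n)
    have "ball (u n) (s / 4) \<subseteq> ball u0 (s / 2)"
    proof
      fix x assume "x \<in> ball (u n) (s / 4)"
      then show "x \<in> ball u0 (s / 2)"
        using elim(2) dist_triangle[of u0 x "u n"] by (simp add: dist_commute)
    qed
    also have "\<dots> \<subseteq> A n" using elim(1) s by simp
    finally show ?case using elim(2) norm_triangle_sub[of "u n" u0] by (simp add: dist_norm)
  qed
  then show ?thesis using s(1) by (intro exI[of _ "s / 4"]) auto
qed

text \<open>A point omitted by almost all \<open>A n\<close> bounds \<open>bdist\<close> on bounded
  sets. It exists because an open convex set is the interior of its closure, so
  \<open>closure B\<close> is not the whole space.\<close>

lemma ex_outside: "\<exists>y. eventually (\<lambda>n. y \<notin> A n) sequentially"
proof -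
  have "closure B \<noteq> UNIV"
    using convex_interior_closure[of B] cdB cdom_not_UNIV[OF cdB] by (auto simp: cdom_def interior_open)
  then obtain y where "y \<in> - closure B" by blast
  then obtain e where e: "e > 0" "ball y e \<subseteq> - closure B" by (metis closed_closure open_Compl openE)
  have "norm y + 1 > 0" by (simp add: add_nonneg_pos)
  then have "eventually (\<lambda>n. \<forall>x\<in>closure (A n) \<inter> cball 0 (norm y + 1). \<exists>z\<in>closure B \<inter> cball 0 (norm y + 1). dist x z \<le> e / 2) sequentially"
    using haus e(1) unfolding local_hausdorff_conv_def
    by (elim allE[of _ "norm y + 1"] allE[of _ "e / 2"] impE) (auto elim: eventually_mono)
  then have "eventually (\<lambda>n. y \<notin> A n) sequentially"
  proof eventually_elim
    case (elim n)
    show ?case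
    proof
      assume "y \<in> A n"
      then have "y \<in> closure (A n) \<inter> cball 0 (norm y + 1)" using closure_subset by auto
      then obtain z where "z \<in> closure B" "dist y z \<le> e / 2" using elim by blast
      then show False using e by (auto simp: subset_iff)
    qed
  qed
  then show ?thesis by blast
qed

lemma m_convex_bound:
  assumes "R > 0"
  shows "\<exists>C>0. eventually (\<lambda>n. \<forall>p\<in>A n \<inter> ball 0 R. \<forall>v. v \<noteq> 0 \<longrightarrow>
    bdist_dir (A n) p v \<le> C * bdist (A n) p powr (1 / m)) sequentially"
proof -
  obtain N C where "C > 0" "\<forall>n>N. \<forall>p\<in>A n \<inter> ball 0 R. \<forall>v. v \<noteq> 0 \<longrightarrow>
    bdist_dir (A n) p v \<le> C * bdist (A n) p powr (1 / m)"
    using lmc assms unfolding locally_m_convex_seq_def by blast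
  then show ?thesis by (intro exI[of _ C] conjI) (auto simp: eventually_at_top_dense)
qed

text \<open>A second use of local \<open>m\<close>-convexity: with \<open>bdist\<close> bounded on
  bounded sets, the slices by complex lines are uniformly limited. This keeps Kobayashi balls
  bounded uniformly in \<open>n\<close>.\<close>

lemma bdist_dir_bound:
  assumes "R > 0"
  shows "\<exists>M>0. eventually (\<lambda>n. \<forall>p\<in>A n \<inter> ball 0 R. \<forall>v. v \<noteq> 0 \<longrightarrow> bdist_dir (A n) p v \<le> M) sequentially"
proof -
  obtain C where C: "C > 0" "eventually (\<lambda>n. \<forall>p\<in>A n \<inter> ball 0 R. \<forall>v. v \<noteq> 0 \<longrightarrow>
    bdist_dir (A n) p v \<le> C * bdist (A n) p powr (1 / m)) sequentially" using m_convex_bound[OF assms] by blast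
  obtain y where y: "eventually (\<lambda>n. y \<notin> A n) sequentially" using ex_outside by blast
  show ?thesis
  proof (rule exI[of _ "C * (R + norm y) powr (1 / m)"], rule conjI)
    have "0 < R + norm y" using assms by (simp add: add_pos_nonneg)
    then show "0 < C * (R + norm y) powr (1 / m)" using C(1) by simp
    show "eventually (\<lambda>n. \<forall>p\<in>A n \<inter> ball 0 R. \<forall>v. v \<noteq> 0 \<longrightarrow> bdist_dir (A n) p v \<le> C * (R + norm y) powr (1 / m)) sequentially"
      using C(2) y
    proof eventually_elim
      case (elim n)
      show ?case
      proof (intro ballI allI impI)
        fix p v assume p: "p \<in> A n \<inter> ball 0 R" and v: "v \<noteq> (0 :: complex ^ 'n)"
        have "bdist (A n) p \<le> dist p y" unfolding bdist_def by (rule infdist_le) (use elim in auto)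
        also have "\<dots> \<le> R + norm y" using p norm_triangle_ineq4[of p y] by (simp add: dist_norm)
        finally have "bdist (A n) p powr (1 / m) \<le> (R + norm y) powr (1 / m)"
          using m by (intro powr_mono2) (auto simp: bdist_def infdist_nonneg)
        then show "bdist_dir (A n) p v \<le> C * (R + norm y) powr (1 / m)"
          using elim(1) p v C(1) by (meson mult_left_mono order_trans less_imp_le)
      qed
    qed
  qed
qed

text \<open>Both bounds start from the base point, where a ball of fixed radius and the bound
  \<open>M\<close> are available: \<open>dist_le_bdist_dir\<close> limits the displacement and
  \<open>bdist_Harnack\<close> the loss of radius.\<close>

lemma kob_ball_bound:
  "\<exists>R>0. \<exists>c>0. eventually (\<lambda>n. \<forall>q\<in>A n. kob_dist (A n) (u n) q \<le> L \<longrightarrow> norm q < R \<and> ball q c \<subseteq> A n) sequentially"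
proof -
  obtain s where s: "s > 0" "eventually (\<lambda>n. ball (u n) s \<subseteq> A n \<and> norm (u n) < norm u0 + 1) sequentially"
    using ball_u by blast
  have R0: "norm u0 + 1 > 0" by (simp add: add_nonneg_pos)
  obtain M where M: "M > 0" "eventually (\<lambda>n. \<forall>p\<in>A n \<inter> ball 0 (norm u0 + 1). \<forall>v. v \<noteq> 0 \<longrightarrow> bdist_dir (A n) p v \<le> M) sequentially"
    using bdist_dir_bound[OF R0] by blast
  show ?thesis
  proof (rule exI[of _ "norm u0 + 1 + exp (2 * L) * M"], rule conjI, (use M R0 in \<open>simp add: add_pos_nonneg\<close>),
      rule exI[of _ "exp (- (2 * L)) * s"], rule conjI, (use s in simp))
    show "eventually (\<lambda>n. \<forall>q\<in>A n. kob_dist (A n) (u n) q \<le> L \<longrightarrow>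
        norm q < norm u0 + 1 + exp (2 * L) * M \<and> ball q (exp (- (2 * L)) * s) \<subseteq> A n) sequentially"
      using s(2) M(2)
    proof eventually_elim
      case (elim n)
      show ?case
      proof (intro ballI impI conjI)
        fix q assume q: "q \<in> A n" "kob_dist (A n) (u n) q \<le> L"
        have e: "exp (2 * kob_dist (A n) (u n) q) \<le> exp (2 * L)" using q(2) by simp
        show "norm q < norm u0 + 1 + exp (2 * L) * M"
        proof (cases "u n = q")
          case True
          have "0 < exp (2 * L) * M" using M(1) by simp
          then show ?thesis using elim(1) True by auto
        next
          case False
          have "dist (u n) q \<le> (exp (2 * kob_dist (A n) (u n) q) - 1) * bdist_dir (A n) (u n) (q - u n)"
            by (rule dist_le_bdist_dir[OF cdA u_in q(1) False])
          also have "\<dots> \<le> exp (2 * L) * M"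
          proof (rule mult_mono)
            show "exp (2 * kob_dist (A n) (u n) q) - 1 \<le> exp (2 * L)" using e by linarith
            show "bdist_dir (A n) (u n) (q - u n) \<le> M" using elim(1,2) u_in[of n] False by auto
          qed (auto simp: bdist_dir_def infdist_nonneg)
          finally show ?thesis using elim(1) norm_triangle_sub[of q "u n"] by (simp add: dist_norm norm_minus_commute)
        qed
        have "s \<le> bdist (A n) (u n)" using bdist_ge_iff[OF cdom_not_UNIV[OF cdA]] elim(1) by blast
        also have "\<dots> \<le> exp (2 * kob_dist (A n) (u n) q) * bdist (A n) q" by (rule bdist_Harnack[OF cdA u_in q(1)])
        also have "\<dots> \<le> exp (2 * L) * bdist (A n) q" using e by (intro mult_right_mono) (auto simp: bdist_def infdist_nonneg)
        finally have "exp (- (2 * L)) * s \<le> bdist (A n) q" by (simp add: exp_minus field_simps)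
        then show "ball q (exp (- (2 * L)) * s) \<subseteq> A n" using bdist_ge_iff[OF cdom_not_UNIV[OF cdA]] by blast
      qed
    qed
  qed
qed

text \<open>Uniform properness, supplying the compact sets for the cluster argument. The passage
  from \<open>A n\<close> to \<open>B\<close> halves the radius, and the condition on
  \<open>infdist\<close> makes \<open>K\<close> closed.\<close>

lemma kob_ball_compact:
  "\<exists>K. compact K \<and> K \<subseteq> B \<and> eventually (\<lambda>n. \<forall>q\<in>A n. kob_dist (A n) (u n) q \<le> L \<longrightarrow> q \<in> K) sequentially"
proof -
  obtain R c where Rc: "R > 0" "c > 0"
    "eventually (\<lambda>n. \<forall>q\<in>A n. kob_dist (A n) (u n) q \<le> L \<longrightarrow> norm q < R \<and> ball q c \<subseteq> A n) sequentially"
    using kob_ball_bound by blast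
  define K where "K = cball 0 R \<inter> {q. c / 2 \<le> infdist q (- B)}"
  have "closed {q. c / 2 \<le> infdist q (- B)}"
    by (intro closed_Collect_le continuous_intros)
  then have "compact K" unfolding K_def by (intro compact_Int_closed) auto
  moreover have iff: "c / 2 \<le> infdist q (- B) \<longleftrightarrow> ball q (c / 2) \<subseteq> B" for q
    using bdist_ge_iff[OF cdom_not_UNIV[OF cdB]] by (simp add: bdist_def)
  moreover have "K \<subseteq> B"
  proof
    fix q assume "q \<in> K"
    then have "ball q (c / 2) \<subseteq> B" unfolding K_def using iff by blast
    then show "q \<in> B" using Rc(2) by (auto simp: subset_iff)
  qed
  moreover have "eventually (\<lambda>n. \<forall>q. norm q \<le> R \<longrightarrow> ball q c \<subseteq> A n \<longrightarrow> ball q (c / 2) \<subseteq> B) sequentially"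
    by (rule hausdorff_ball_limit[OF haus]) (use cdB Rc in \<open>auto simp: cdom_def\<close>)
  with Rc(3) have "eventually (\<lambda>n. \<forall>q\<in>A n. kob_dist (A n) (u n) q \<le> L \<longrightarrow> q \<in> K) sequentially"
  proof eventually_elim
    case (elim n)
    show ?case unfolding K_def using elim iff by (auto simp: less_imp_le)
  qed
  ultimately show ?thesis by blast
qed

text \<open>One bounded end point is enough, since the path can be reversed. The radius
  \<open>R'\<close> exceeds \<open>R\<close> in order to bound the base points as well.\<close>

lemma almost_geod_far_close:
  assumes \<eta>: "\<And>n. \<eta> n > 0" "\<eta> \<longlonglongrightarrow> 0" and "R > 0" "\<epsilon> > 0"
  shows "\<exists>D. eventually (\<lambda>n. \<forall>c N. almost_geod (A n) (kob_dist (A n)) (\<eta> n) c N \<longrightarrow>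
    (\<forall>i\<le>N. D < kob_dist (A n) (u n) (c i)) \<longrightarrow> norm (c 0) < R \<or> norm (c N) < R \<longrightarrow> dist (c 0) (c N) < \<epsilon>) sequentially"
proof -
  obtain s where s: "s > 0" "eventually (\<lambda>n. ball (u n) s \<subseteq> A n \<and> norm (u n) < norm u0 + 1) sequentially"
    using ball_u by blast
  define R' where "R' = R + norm u0 + 1"
  have R': "R' > 0" "R' \<ge> R" "norm u0 + 1 \<le> R'" using assms by (auto simp: R'_def add_pos_nonneg)
  then have Re: "R' + \<epsilon> > 0" using assms by simp
  obtain C where C: "C > 0" "eventually (\<lambda>n. \<forall>p\<in>A n \<inter> ball 0 (R' + \<epsilon>). \<forall>v. v \<noteq> 0 \<longrightarrow>
    bdist_dir (A n) p v \<le> C * bdist (A n) p powr (1 / m)) sequentially" using m_convex_bound[OF Re] by blast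
  obtain D where D: "\<forall>(\<Omega> :: (complex ^ 'n) set) u \<eta> c N. cdom \<Omega> \<longrightarrow> ball u s \<subseteq> \<Omega> \<longrightarrow> norm u \<le> R' \<longrightarrow>
    (\<forall>p\<in>\<Omega> \<inter> ball 0 (R' + \<epsilon>). \<forall>v. v \<noteq> 0 \<longrightarrow> bdist_dir \<Omega> p v \<le> C * bdist \<Omega> p powr (1 / m)) \<longrightarrow>
    0 < \<eta> \<longrightarrow> \<eta> \<le> 1 \<longrightarrow> almost_geod \<Omega> (kob_dist \<Omega>) \<eta> c N \<longrightarrow>
    (\<forall>i\<le>N. D < kob_dist \<Omega> u (c i)) \<longrightarrow> norm (c 0) < R' \<longrightarrow> (\<forall>j\<le>N. dist (c 0) (c j) < \<epsilon>)"
    using almost_geod_stays[OF s(1) R'(1) C(1) m assms(4)] by blast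
  have "eventually (\<lambda>n. \<eta> n < 1) sequentially" using order_tendstoD(2)[OF \<eta>(2), of 1] by simp
  with s(2) C(2) have "eventually (\<lambda>n. \<forall>c N. almost_geod (A n) (kob_dist (A n)) (\<eta> n) c N \<longrightarrow>
    (\<forall>i\<le>N. D < kob_dist (A n) (u n) (c i)) \<longrightarrow> norm (c 0) < R \<or> norm (c N) < R \<longrightarrow> dist (c 0) (c N) < \<epsilon>) sequentially"
  proof eventually_elim
    case (elim n)
    have un: "ball (u n) s \<subseteq> A n" "norm (u n) \<le> R'" using elim(1) R'(3) by auto
    have fwd: "dist (c 0) (c N) < \<epsilon>" if "almost_geod (A n) (kob_dist (A n)) (\<eta> n) c N"
      "\<forall>i\<le>N. D < kob_dist (A n) (u n) (c i)" "norm (c 0) < R" for c N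
      using D[rule_format, OF cdA un _ \<eta>(1) _ that(1), of N] elim(2,3) that(2,3) R'(2) by auto
    show ?case
    proof (intro allI impI, elim disjE)
      fix c N assume c: "almost_geod (A n) (kob_dist (A n)) (\<eta> n) c N"
        "\<forall>i\<le>N. D < kob_dist (A n) (u n) (c i)" "norm (c N) < R"
      show "dist (c 0) (c N) < \<epsilon>"
        using fwd[OF pseudometric.almost_geod_rev[OF pseudometric_kob[OF cdA] c(1)]] c(2,3)
        by (simp add: dist_commute)
    qed (rule fwd)
  qed
  then show ?thesis by blast
qed

end

section \<open>Convergence of the sides through the base points\<close>

locale rescaled_geods = rescaled_seq A B m u u0
  for A :: "nat \<Rightarrow> (complex ^ 'n) set" and B m u u0 +
  fixes \<eta> :: "nat \<Rightarrow> real" and \<gamma> :: "nat \<Rightarrow> nat \<Rightarrow> complex ^ 'n" and N k0 :: "nat \<Rightarrow> nat"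
  assumes eta_pos: "\<And>n. \<eta> n > 0" and eta_lim: "\<eta> \<longlonglongrightarrow> 0"
    and geod: "\<And>n. almost_geod (A n) (kob_dist (A n)) (\<eta> n) (\<gamma> n) (N n)"
    and k0: "\<And>n. k0 n \<le> N n" "\<And>n. \<gamma> n (k0 n) = u n"
    and left_lim: "filterlim (\<lambda>n. real (k0 n) * \<eta> n) at_top sequentially"
    and right_lim: "filterlim (\<lambda>n. real (N n - k0 n) * \<eta> n) at_top sequentially"
begin

text \<open>Time is measured from the base point, which has index \<open>k0 n\<close>. The
  truncation by \<open>nat\<close> is harmless: both halves of the path become arbitrarily long, so
  for a fixed time the index is eventually a genuine one.\<close>

definition idx :: "nat \<Rightarrow> real \<Rightarrow> nat" where
  "idx n t = nat (int (k0 n) + \<lfloor>t / \<eta> n\<rfloor>)"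

definition rpath :: "nat \<Rightarrow> real \<Rightarrow> complex ^ 'n" where
  "rpath n t = \<gamma> n (idx n t)"

lemma idx_0: "idx n 0 = k0 n" by (simp add: idx_def)

lemma idx_eventually:
  assumes "s \<le> t"
  shows "eventually (\<lambda>n. idx n s \<le> idx n t \<and> idx n t \<le> N n \<and>
    real (idx n t - idx n s) * \<eta> n \<le> t - s + \<eta> n \<and> t - s - \<eta> n \<le> real (idx n t - idx n s) * \<eta> n) sequentially"
proof -
  have "eventually (\<lambda>n. \<bar>s\<bar> \<le> real (k0 n) * \<eta> n) sequentially"
    using left_lim by (simp add: filterlim_at_top)
  moreover have "eventually (\<lambda>n. \<bar>t\<bar> \<le> real (N n - k0 n) * \<eta> n) sequentially"
    using right_lim by (simp add: filterlim_at_top)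
  ultimately show ?thesis
  proof eventually_elim
    case (elim n)
    note e = eta_pos[of n]
    have "- real (k0 n) \<le> s / \<eta> n" using elim(1) e by (simp add: field_simps)
    then have a: "0 \<le> int (k0 n) + \<lfloor>s / \<eta> n\<rfloor>" by linarith
    have st: "\<lfloor>s / \<eta> n\<rfloor> \<le> \<lfloor>t / \<eta> n\<rfloor>" using assms e by (intro floor_mono divide_right_mono) auto
    have "t / \<eta> n \<le> real (N n - k0 n)" using elim(2) e by (simp add: field_simps)
    then have b: "\<lfloor>t / \<eta> n\<rfloor> \<le> int (N n - k0 n)" by linarith
    have i: "int (idx n s) = int (k0 n) + \<lfloor>s / \<eta> n\<rfloor>" "int (idx n t) = int (k0 n) + \<lfloor>t / \<eta> n\<rfloor>"
      using a st by (auto simp: idx_def)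
    have le: "idx n s \<le> idx n t" "idx n t \<le> N n" using i st b k0(1)[of n] by linarith+
    have "real (idx n t - idx n s) = of_int \<lfloor>t / \<eta> n\<rfloor> - of_int \<lfloor>s / \<eta> n\<rfloor>" using i le by linarith
    then have "real (idx n t - idx n s) \<le> t / \<eta> n - s / \<eta> n + 1" "t / \<eta> n - s / \<eta> n - 1 \<le> real (idx n t - idx n s)"
      by linarith+
    then have "real (idx n t - idx n s) * \<eta> n \<le> (t / \<eta> n - s / \<eta> n + 1) * \<eta> n"
      "(t / \<eta> n - s / \<eta> n - 1) * \<eta> n \<le> real (idx n t - idx n s) * \<eta> n"
      using e by (auto intro: mult_right_mono)
    then show ?case using le e by (simp add: algebra_simps)
  qed
qed

text \<open>In the lower bound, two of the three \<open>\<eta> n\<close> are the slack of an almost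
  geodesic and one is the rounding of indices.\<close>

lemma path_dist:
  assumes "s \<le> t"
  shows "eventually (\<lambda>n. rpath n s \<in> A n \<and> rpath n t \<in> A n \<and> kob_dist (A n) (rpath n s) (rpath n t) \<le> t - s + \<eta> n \<and>
    t - s - 3 * \<eta> n \<le> kob_dist (A n) (rpath n s) (rpath n t)) sequentially"
  using idx_eventually[OF assms]
proof eventually_elim
  case (elim n)
  interpret pseudometric "A n" "kob_dist (A n)" by (rule pseudometric_kob[OF cdA])
  show ?case
    using elim almost_geod_upper[OF geod, of "idx n s" "idx n t"] almost_geod_lower[OF geod, of "idx n s" "idx n t"] geod[of n]
    by (auto simp: rpath_def almost_geod_def)
qed

lemma path_dist_u: "eventually (\<lambda>n. rpath n t \<in> A n \<and> kob_dist (A n) (u n) (rpath n t) \<le> \<bar>t\<bar> + \<eta> n) sequentially"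
proof (cases "0 \<le> t")
  case True
  from path_dist[OF this] show ?thesis
    by eventually_elim (use True in \<open>auto simp: rpath_def idx_0 k0\<close>)
next
  case False
  then have "t \<le> 0" by simp
  from path_dist[OF this] show ?thesis
    by eventually_elim (use False kob_dist_sym[OF cdA] in \<open>auto simp: rpath_def idx_0 k0\<close>)
qed

lemma eta_small: "e > 0 \<Longrightarrow> eventually (\<lambda>n. \<eta> n < e) sequentially"
  using order_tendstoD(2)[OF eta_lim, of e] .

definition shrink :: "real \<Rightarrow> complex ^ 'n \<Rightarrow> complex ^ 'n" where
  "shrink \<epsilon> x = u0 + (1 / (1 + \<epsilon>)) *\<^sub>R (x - u0)"

lemma shrink_mem:
  assumes "x \<in> B" "\<epsilon> > 0" shows "shrink \<epsilon> x \<in> B"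
proof -
  have "shrink \<epsilon> x = (\<epsilon> / (1 + \<epsilon>)) *\<^sub>R u0 + (1 / (1 + \<epsilon>)) *\<^sub>R x"
  proof -
    have "\<epsilon> / (1 + \<epsilon>) = 1 - 1 / (1 + \<epsilon>)" using assms by (simp add: field_simps)
    then have "(\<epsilon> / (1 + \<epsilon>)) *\<^sub>R u0 = u0 - (1 / (1 + \<epsilon>)) *\<^sub>R u0"
      by (simp only: scaleR_diff_left scaleR_one)
    then show ?thesis by (simp add: shrink_def scaleR_diff_right)
  qed
  moreover have "\<epsilon> / (1 + \<epsilon>) + 1 / (1 + \<epsilon>) = 1" using assms by (simp add: field_simps)
  ultimately show ?thesis using cdB u0 assms by (auto simp: cdom_def intro!: convexD)
qed

text \<open>The hard half of continuity. Each step of the path is localised separately; the loss is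
  a factor \<open>1 + \<epsilon>\<close>, which summation over the steps leaves unchanged.
  \<open>shrink\<close> moves the localised discs, which are only near \<open>B\<close>, into
  \<open>B\<close>.\<close>

lemma shrink_path_dist:
  assumes "s \<le> t" "\<epsilon> > 0"
  shows "eventually (\<lambda>n. kob_dist B (shrink \<epsilon> (rpath n s)) (shrink \<epsilon> (rpath n t)) \<le> (1 + \<epsilon>) * (t - s + \<eta> n)) sequentially"
proof -
  \<comment> \<open>\<open>r\<close> and \<open>\<tau>0\<close> are chosen for
    \<open>r - \<tau>0 = \<kappa>\<close>, so that the loss \<open>1 / (r - \<tau>0)\<close> in
    \<open>kob_dist_localize\<close> is \<open>1 + \<epsilon>\<close>.\<close>
  define \<kappa> where "\<kappa> = 1 / (1 + \<epsilon>)"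
  define r where "r = (1 + \<kappa>) / 2"
  define \<tau>0 where "\<tau>0 = (1 - \<kappa>) / 2"
  have \<kappa>: "0 < \<kappa>" "\<kappa> < 1" using assms by (auto simp: \<kappa>_def)
  then have r: "r < 1" "\<tau>0 < r" "0 < \<tau>0" "r - \<tau>0 = \<kappa>" "0 < r" by (auto simp: r_def \<tau>0_def field_simps)
  \<comment> \<open>Between the times \<open>s\<close> and \<open>t\<close> the path stays within
    \<open>2 * \<bar>s\<bar> + \<bar>t\<bar> + 2\<close> of the base point once
    \<open>\<eta> n < 1\<close>; the summand \<open>\<tau>0\<close> is the budget of one
    step.\<close>
  define L where "L = 2 * \<bar>s\<bar> + \<bar>t\<bar> + 2 + \<tau>0"
  obtain R c where R: "R > 0" "c > 0"
    "eventually (\<lambda>n. \<forall>q\<in>A n. kob_dist (A n) (u n) q \<le> L \<longrightarrow> norm q < R \<and> ball q c \<subseteq> A n) sequentially"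
    using kob_ball_bound by blast
  obtain M where M: "M > 0" "eventually (\<lambda>n. \<forall>p\<in>A n \<inter> ball 0 R. \<forall>v. v \<noteq> 0 \<longrightarrow> bdist_dir (A n) p v \<le> M) sequentially"
    using bdist_dir_bound[OF R(1)] by blast
  define \<rho> where "\<rho> = R + 2 * r / (1 - r) * M + 1"
  have \<rho>: "R + 2 * r / (1 - r) * M < \<rho>" "\<rho> > R" using r M by (auto simp: \<rho>_def add_pos_nonneg)
  have sc: "eventually (\<lambda>n. \<forall>x\<in>A n \<inter> ball 0 \<rho>. shrink \<epsilon> x \<in> B) sequentially"
    unfolding shrink_def by (rule hausdorff_scaled[OF haus]) (use cdB u0 assms \<rho> R in \<open>auto simp: cdom_def\<close>)
  have hol: "holo_disc (\<lambda>z. shrink \<epsilon> (f z))" if "holo_disc f" for f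
    using that unfolding holo_disc_def shrink_def by (auto simp: scaleR_conv_of_real intro!: holomorphic_intros)
  show ?thesis
    using idx_eventually[OF assms(1)] path_dist_u[of s] R(3) M(2) sc eta_small[OF r(3)] eta_small[of 1, simplified]
  proof eventually_elim
    case (elim n)
    interpret An: pseudometric "A n" "kob_dist (A n)" by (rule pseudometric_kob[OF cdA])
    interpret Bm: pseudometric B "kob_dist B" by (rule pseudometric_kob[OF cdB])
    let ?a = "idx n s" and ?b = "idx n t"
    have mem: "\<gamma> n i \<in> A n" if "i \<le> ?b" for i using geod[of n] that elim(1) by (auto simp: almost_geod_def)
    have near: "kob_dist (A n) (u n) (\<gamma> n i) + \<tau>0 \<le> L" if i: "?a \<le> i" "i \<le> ?b" for i
    proof -
      have "kob_dist (A n) (\<gamma> n ?a) (\<gamma> n i) \<le> real (i - ?a) * \<eta> n"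
        by (rule An.almost_geod_upper[OF geod]) (use i elim(1) in auto)
      also have "\<dots> \<le> real (?b - ?a) * \<eta> n" using i eta_pos[of n] by (intro mult_right_mono) auto
      finally have "kob_dist (A n) (\<gamma> n ?a) (\<gamma> n i) \<le> t - s + \<eta> n" using elim(1) by linarith
      moreover have "kob_dist (A n) (u n) (\<gamma> n i) \<le> kob_dist (A n) (u n) (\<gamma> n ?a) + kob_dist (A n) (\<gamma> n ?a) (\<gamma> n i)"
        using u_in mem i by (intro An.d_triangle) auto
      moreover have "kob_dist (A n) (u n) (\<gamma> n ?a) \<le> \<bar>s\<bar> + \<eta> n" using elim(2) by (simp add: rpath_def)
      ultimately show ?thesis using elim(7) by (simp add: L_def)
    qed
    have "kob_dist B (shrink \<epsilon> (\<gamma> n ?a)) (shrink \<epsilon> (\<gamma> n ?b)) \<le> real (?b - ?a) * ((1 + \<epsilon>) * \<eta> n)"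
    proof (rule Bm.path_upper[where c = "\<lambda>i. shrink \<epsilon> (\<gamma> n i)"])
      show "?a \<le> ?b" using elim(1) by simp
      fix i assume i: "?a \<le> i" "i \<le> ?b"
      have "norm (\<gamma> n i) < R" using elim(3) mem[OF i(2)] near[OF i] r(3) by auto
      then show "shrink \<epsilon> (\<gamma> n i) \<in> B" using elim(5) mem[OF i(2)] \<rho>(2) by auto
    next
      fix i assume i: "?a \<le> i" "i < ?b"
      have st: "kob_dist (A n) (\<gamma> n i) (\<gamma> n (Suc i)) \<le> \<eta> n" using geod[of n] i elim(1) by (auto simp: almost_geod_def)
      have "kob_dist B (shrink \<epsilon> (\<gamma> n i)) (shrink \<epsilon> (\<gamma> n (Suc i))) \<le> kob_dist (A n) (\<gamma> n i) (\<gamma> n (Suc i)) / (r - \<tau>0)"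
      proof (rule kob_dist_localize[where R = R and M = M and \<rho> = \<rho> and L = L and u = "u n"])
        fix x assume x: "x \<in> A n" "kob_dist (A n) (u n) x \<le> L"
        then have "norm x < R" using elim(3) by blast
        then show "norm x \<le> R \<and> (\<forall>v. v \<noteq> 0 \<longrightarrow> bdist_dir (A n) x v \<le> M)" using elim(4) x(1) by auto
      qed (use cdA cdB u_in r hol elim \<rho> M mem near i st in auto)
      also have "\<dots> = (1 + \<epsilon>) * kob_dist (A n) (\<gamma> n i) (\<gamma> n (Suc i))" using assms by (simp add: r(4) \<kappa>_def mult.commute)
      also have "\<dots> \<le> (1 + \<epsilon>) * \<eta> n" using st assms by (intro mult_left_mono) auto
      finally show "kob_dist B (shrink \<epsilon> (\<gamma> n i)) (shrink \<epsilon> (\<gamma> n (Suc i))) \<le> (1 + \<epsilon>) * \<eta> n" .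
    qed
    also have "\<dots> = (1 + \<epsilon>) * (real (?b - ?a) * \<eta> n)" by simp
    also have "\<dots> \<le> (1 + \<epsilon>) * (t - s + \<eta> n)" using elim(1) assms by (intro mult_left_mono) auto
    finally show ?case by (simp add: rpath_def)
  qed
qed

text \<open>The upper estimate lets first \<open>n\<close> and then the contraction parameter tend
  to their limits. The lower one is \<open>kob_dist_usc\<close>: a shortcut in \<open>B\<close>
  would give shortcuts in \<open>A n\<close>.\<close>

lemma limit_geodesic:
  obtains \<sigma> G where "G \<noteq> bot" "G \<le> sequentially" "is_geodesic B \<sigma>" "\<And>t. ((\<lambda>n. rpath n t) \<longlongrightarrow> \<sigma> t) G"
proof -
  have "\<forall>t. \<exists>K. compact K \<and> K \<subseteq> B \<and> eventually (\<lambda>n. rpath n t \<in> K) sequentially"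
  proof
    fix t
    obtain K where K: "compact K" "K \<subseteq> B" "eventually (\<lambda>n. \<forall>q\<in>A n. kob_dist (A n) (u n) q \<le> \<bar>t\<bar> + 1 \<longrightarrow> q \<in> K) sequentially"
      using kob_ball_compact by blast
    have "eventually (\<lambda>n. rpath n t \<in> K) sequentially"
      using K(3) path_dist_u[of t] eta_small[of 1, simplified] by eventually_elim auto
    with K show "\<exists>K. compact K \<and> K \<subseteq> B \<and> eventually (\<lambda>n. rpath n t \<in> K) sequentially" by blast
  qed
  from choice[OF this] obtain K where
    "\<forall>t. compact (K t) \<and> K t \<subseteq> B \<and> eventually (\<lambda>n. rpath n t \<in> K t) sequentially" ..
  then have K: "compact (K t)" "K t \<subseteq> B" "eventually (\<lambda>n. rpath n t \<in> K t) sequentially" for t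
    by simp_all
  obtain \<sigma> G where G: "G \<noteq> bot" "G \<le> sequentially" "\<And>t. \<sigma> t \<in> K t" "\<And>t. ((\<lambda>n. rpath n t) \<longlongrightarrow> \<sigma> t) G"
    by (rule pointwise_cluster[where K = K and f = rpath, OF K(1,3)]) (rule that)
  have \<sigma>B: "\<sigma> t \<in> B" for t using G(3) K(2) by blast
  have eta_G: "(\<eta> \<longlongrightarrow> 0) G" using eta_lim G(2) by (rule tendsto_mono[rotated])
  have upper: "kob_dist B (\<sigma> s) (\<sigma> t) \<le> t - s" if st: "s \<le> t" for s t
  proof -
    have 1: "kob_dist B (shrink \<epsilon> (\<sigma> s)) (shrink \<epsilon> (\<sigma> t)) \<le> (1 + \<epsilon>) * (t - s)" if e: "\<epsilon> > 0" for \<epsilon>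
    proof (rule kob_dist_le_limit[OF cdB G(1)])
      show "((\<lambda>n. shrink \<epsilon> (rpath n s)) \<longlongrightarrow> shrink \<epsilon> (\<sigma> s)) G" "((\<lambda>n. shrink \<epsilon> (rpath n t)) \<longlongrightarrow> shrink \<epsilon> (\<sigma> t)) G"
        unfolding shrink_def by (intro tendsto_intros G(4))+
      show "eventually (\<lambda>n. kob_dist B (shrink \<epsilon> (rpath n s)) (shrink \<epsilon> (rpath n t)) \<le> (1 + \<epsilon>) * (t - s + \<eta> n)) G"
        by (rule filter_leD[OF G(2) shrink_path_dist[OF st e]])
      show "((\<lambda>n. (1 + \<epsilon>) * (t - s + \<eta> n)) \<longlongrightarrow> (1 + \<epsilon>) * (t - s)) G"
        using tendsto_mult[OF tendsto_const[of "1 + \<epsilon>"] tendsto_add[OF tendsto_const[of "t - s"] eta_G]] by simp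
    qed (auto intro: shrink_mem \<sigma>B e)
    have sh: "((\<lambda>\<epsilon>. shrink \<epsilon> x) \<longlongrightarrow> x) (at_right 0)" for x
    proof -
      have "((\<lambda>\<epsilon>. shrink \<epsilon> x) \<longlongrightarrow> u0 + (1 / (1 + 0)) *\<^sub>R (x - u0)) (at_right 0)"
        unfolding shrink_def by (intro tendsto_intros) auto
      then show ?thesis by simp
    qed
    show ?thesis
    proof (rule kob_dist_le_limit[OF cdB _ sh \<sigma>B sh \<sigma>B])
      show "eventually (\<lambda>\<epsilon>. kob_dist B (shrink \<epsilon> (\<sigma> s)) (shrink \<epsilon> (\<sigma> t)) \<le> (1 + \<epsilon>) * (t - s)) (at_right 0)"
        using eventually_at_right_less[of 0] by eventually_elim (rule 1)
      have "((\<lambda>\<epsilon>::real. (1 + \<epsilon>) * (t - s)) \<longlongrightarrow> (1 + 0) * (t - s)) (at_right 0)" by (intro tendsto_intros)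
      then show "((\<lambda>\<epsilon>::real. (1 + \<epsilon>) * (t - s)) \<longlongrightarrow> t - s) (at_right 0)" by simp
    qed (simp add: trivial_limit_at_right_real)
  qed
  have lower: "t - s \<le> kob_dist B (\<sigma> s) (\<sigma> t)" if st: "s \<le> t" for s t
  proof (rule ccontr)
    assume "\<not> ?thesis"
    then obtain T where T: "kob_dist B (\<sigma> s) (\<sigma> t) < T" "T < t - s" using dense by (metis not_le)
    have "eventually (\<lambda>n. kob_dist (A n) (rpath n s) (rpath n t) < T) G"
      by (rule kob_dist_usc[OF haus cdA cdB G(2) G(4) \<sigma>B G(4) \<sigma>B T(1)])
    moreover have "eventually (\<lambda>n. \<eta> n < (t - s - T) / 3) G"
      by (rule filter_leD[OF G(2) eta_small]) (use T in auto)
    moreover note filter_leD[OF G(2) path_dist[OF st]]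
    ultimately have "eventually (\<lambda>n. False) G" by eventually_elim auto
    then show False using G(1) by (simp add: trivial_limit_def)
  qed
  have "kob_dist B (\<sigma> s) (\<sigma> t) = \<bar>s - t\<bar>" for s t
    using upper[of s t] lower[of s t] upper[of t s] lower[of t s] kob_dist_sym[OF cdB \<sigma>B \<sigma>B, of s t]
    by (cases "s \<le> t") auto
  then have "is_geodesic B \<sigma>" using \<sigma>B by (auto simp: is_geodesic_def)
  with G that show ?thesis by blast
qed

text \<open>The walk around the triangle has four pieces: from \<open>rpath n T\<close> to the end
  of the side, along \<open>\<beta>\<close>, along \<open>\<alpha>\<close>, and from the start of
  the side to \<open>rpath n (- T)\<close>. Each is far from the base point and moves by less than
  \<open>\<epsilon>\<close> provided one of its ends is known to be bounded; this bound is handed on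
  from piece to piece, from whichever end it is given.\<close>

lemma no_far_triangle:
  assumes \<alpha>: "\<And>n. almost_geod (A n) (kob_dist (A n)) (\<eta> n) (\<alpha> n) (a n)"
    and \<beta>: "\<And>n. almost_geod (A n) (kob_dist (A n)) (\<eta> n) (\<beta> n) (b n)"
    and ends: "\<And>n. \<alpha> n 0 = \<gamma> n 0" "\<And>n. \<alpha> n (a n) = \<beta> n 0" "\<And>n. \<beta> n (b n) = \<gamma> n (N n)"
    and far: "\<And>D. eventually (\<lambda>n. \<forall>j\<le>a n. D < kob_dist (A n) (u n) (\<alpha> n j)) sequentially"
      "\<And>D. eventually (\<lambda>n. \<forall>j\<le>b n. D < kob_dist (A n) (u n) (\<beta> n j)) sequentially"
    and R: "R > 0" and \<epsilon>: "\<epsilon> > 0"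
  shows "\<exists>T0. \<forall>T\<ge>T0. eventually (\<lambda>n. norm (rpath n T) < R \<or> norm (rpath n (- T)) < R \<longrightarrow>
    dist (rpath n T) (rpath n (- T)) < 4 * \<epsilon>) sequentially"
proof -
  \<comment> \<open>Room for the drift along four pieces.\<close>
  define R' where "R' = R + 4 * \<epsilon>"
  have R': "R' > 0" using R \<epsilon> by (simp add: R'_def)
  obtain D where D: "eventually (\<lambda>n. \<forall>c N. almost_geod (A n) (kob_dist (A n)) (\<eta> n) c N \<longrightarrow>
    (\<forall>i\<le>N. D < kob_dist (A n) (u n) (c i)) \<longrightarrow> norm (c 0) < R' \<or> norm (c N) < R' \<longrightarrow> dist (c 0) (c N) < \<epsilon>) sequentially"
    using almost_geod_far_close[OF eta_pos eta_lim R' \<epsilon>] by blast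
  \<comment> \<open>Once \<open>\<eta> n < 1\<close>, points of the side beyond time
    \<open>T\<close> are farther than \<open>T - 3\<close> from the base point: two steps for the
    slack and one for rounding.\<close>
  have "eventually (\<lambda>n. norm (rpath n T) < R \<or> norm (rpath n (- T)) < R \<longrightarrow>
    dist (rpath n T) (rpath n (- T)) < 4 * \<epsilon>) sequentially" if T: "T \<ge> max 0 (D + 3)" for T
  proof -
    have T0: "- T \<le> 0" "0 \<le> T" using T by auto
    show ?thesis
      using D idx_eventually[OF T0(1)] idx_eventually[OF T0(2)] far(1)[of D] far(2)[of D] eta_small[of 1, simplified]
    proof eventually_elim
      case (elim n)
      interpret pseudometric "A n" "kob_dist (A n)" by (rule pseudometric_kob[OF cdA])
      let ?p = "idx n T" and ?q = "idx n (- T)"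
      have pq: "?q \<le> k0 n" "k0 n \<le> ?p" "?p \<le> N n" using elim(2,3) by (auto simp: idx_0)
      note close = elim(1)[rule_format]
      have farp: "D < kob_dist (A n) (u n) (\<gamma> n i)" if "?p \<le> i" "i \<le> N n" for i
      proof -
        have "T - \<eta> n \<le> real (?p - k0 n) * \<eta> n" using elim(3)[unfolded idx_0 diff_0_right] by blast
        also have "\<dots> \<le> real (i - k0 n) * \<eta> n" using that eta_pos[of n] by (intro mult_right_mono) auto
        also have "\<dots> \<le> kob_dist (A n) (u n) (\<gamma> n i) + 2 * \<eta> n"
          using almost_geod_lower[OF geod, of "k0 n" i] that pq by (simp add: k0)
        finally show ?thesis using T elim(6) by simp
      qed
      have farq: "D < kob_dist (A n) (u n) (\<gamma> n i)" if "i \<le> ?q" for i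
      proof -
        have mem: "\<gamma> n i \<in> A n" using geod[of n] that pq by (auto simp: almost_geod_def)
        have "T - \<eta> n \<le> real (k0 n - ?q) * \<eta> n" using elim(2)[unfolded idx_0 diff_minus_eq_add add_0_left] by blast
        also have "\<dots> \<le> real (k0 n - i) * \<eta> n" using that eta_pos[of n] by (intro mult_right_mono) auto
        also have "\<dots> \<le> kob_dist (A n) (u n) (\<gamma> n i) + 2 * \<eta> n"
          using almost_geod_lower[OF geod, of i "k0 n"] that pq d_sym[OF mem u_in] by (simp add: k0)
        finally show ?thesis using T elim(6) by simp
      qed
      have 1: "norm (rpath n T) < R' \<or> norm (\<gamma> n (N n)) < R' \<Longrightarrow> dist (rpath n T) (\<gamma> n (N n)) < \<epsilon>"
        using close[OF almost_geod_sub[OF geod pq(3) order_refl]] farp pq by (auto simp: rpath_def)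
      have 2: "norm (\<beta> n 0) < R' \<or> norm (\<gamma> n (N n)) < R' \<Longrightarrow> dist (\<beta> n 0) (\<gamma> n (N n)) < \<epsilon>"
        using close[OF \<beta>] elim(5) by (auto simp: ends)
      have 3: "norm (\<gamma> n 0) < R' \<or> norm (\<beta> n 0) < R' \<Longrightarrow> dist (\<gamma> n 0) (\<beta> n 0) < \<epsilon>"
        using close[OF \<alpha>] elim(4) ends(1,2) by metis
      have 4: "norm (\<gamma> n 0) < R' \<or> norm (rpath n (- T)) < R' \<Longrightarrow> dist (\<gamma> n 0) (rpath n (- T)) < \<epsilon>"
        using close[OF almost_geod_sub[OF geod, of 0 ?q]] farq pq by (auto simp: rpath_def)
      have tr: "norm y < r + \<epsilon>" if "norm x < r" "dist x y < \<epsilon>" for x y :: "complex ^ 'n" and r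
        using that norm_triangle_sub[of y x] by (simp add: dist_norm norm_minus_commute)
      have tri: "dist (rpath n T) (rpath n (- T)) \<le> dist (rpath n T) (\<gamma> n (N n)) + dist (\<beta> n 0) (\<gamma> n (N n))
          + dist (\<gamma> n 0) (\<beta> n 0) + dist (\<gamma> n 0) (rpath n (- T))"
        using dist_triangle[of "rpath n T" "rpath n (- T)" "\<gamma> n (N n)"] dist_triangle[of "\<gamma> n (N n)" "rpath n (- T)" "\<beta> n 0"]
          dist_triangle[of "\<beta> n 0" "rpath n (- T)" "\<gamma> n 0"] by (simp add: dist_commute)
      show ?case
      proof
        assume "norm (rpath n T) < R \<or> norm (rpath n (- T)) < R"
        then show "dist (rpath n T) (rpath n (- T)) < 4 * \<epsilon>"
        proof
          assume a: "norm (rpath n T) < R"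
          have s1: "dist (rpath n T) (\<gamma> n (N n)) < \<epsilon>" using 1 a \<epsilon> by (simp add: R'_def)
          note n1 = tr[OF a s1]
          have s2: "dist (\<beta> n 0) (\<gamma> n (N n)) < \<epsilon>" using 2 n1 \<epsilon> by (simp add: R'_def)
          have n2: "norm (\<beta> n 0) < R + \<epsilon> + \<epsilon>" using tr[OF n1, of "\<beta> n 0"] s2 by (simp add: dist_commute)
          have s3: "dist (\<gamma> n 0) (\<beta> n 0) < \<epsilon>" using 3 n2 \<epsilon> by (simp add: R'_def)
          have n3: "norm (\<gamma> n 0) < R + \<epsilon> + \<epsilon> + \<epsilon>" using tr[OF n2, of "\<gamma> n 0"] s3 by (simp add: dist_commute)
          have s4: "dist (\<gamma> n 0) (rpath n (- T)) < \<epsilon>" using 4 n3 \<epsilon> by (simp add: R'_def)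
          show ?thesis using tri s1 s2 s3 s4 by linarith
        next
          assume a: "norm (rpath n (- T)) < R"
          have s4: "dist (\<gamma> n 0) (rpath n (- T)) < \<epsilon>" using 4 a \<epsilon> by (simp add: R'_def)
          have n1: "norm (\<gamma> n 0) < R + \<epsilon>" using tr[OF a, of "\<gamma> n 0"] s4 by (simp add: dist_commute)
          have s3: "dist (\<gamma> n 0) (\<beta> n 0) < \<epsilon>" using 3 n1 \<epsilon> by (simp add: R'_def)
          note n2 = tr[OF n1 s3]
          have s2: "dist (\<beta> n 0) (\<gamma> n (N n)) < \<epsilon>" using 2 n2 \<epsilon> by (simp add: R'_def)
          note n3 = tr[OF n2 s2]
          have s1: "dist (rpath n T) (\<gamma> n (N n)) < \<epsilon>" using 1 n3 \<epsilon> by (simp add: R'_def)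
          show ?thesis using tri s1 s2 s3 s4 by linarith
        qed
      qed
    qed
  qed
  then show ?thesis by blast
qed

end

text \<open>The assumption leaves both functions free while both are large, as suits the point at
  infinity. If one has a finite limit, it is eventually bounded and pulls the other to the same
  limit; so infinity for one excludes a finite limit of the other.\<close>

lemma tends_opc_unique:
  fixes f g :: "real \<Rightarrow> 'a::real_normed_vector"
  assumes close: "\<And>R \<epsilon>. R > 0 \<Longrightarrow> \<epsilon> > 0 \<Longrightarrow> eventually (\<lambda>t. norm (f t) < R \<or> norm (g t) < R \<longrightarrow> dist (f t) (g t) \<le> \<epsilon>) F"
    and F: "F \<noteq> bot" and f: "tends_opc f F e" and g: "tends_opc g F e'"
  shows "e = e'"
proof -
  have main: "e' = Some a"
    if close: "\<And>R \<epsilon>. R > 0 \<Longrightarrow> \<epsilon> > 0 \<Longrightarrow> eventually (\<lambda>t. norm (f t) < R \<longrightarrow> dist (f t) (g t) \<le> \<epsilon>) F"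
      and f: "(f \<longlongrightarrow> a) F" and g: "tends_opc g F e'" for f g :: "real \<Rightarrow> 'a" and a e'
  proof -
    have nf: "eventually (\<lambda>t. norm (f t) < norm a + 1) F"
      using order_tendstoD(2)[OF tendsto_norm[OF f], of "norm a + 1"] by simp
    have "((\<lambda>t. dist (f t) (g t)) \<longlongrightarrow> 0) F"
    proof (rule tendstoI)
      fix \<epsilon> :: real assume \<epsilon>: "\<epsilon> > 0"
      then have "eventually (\<lambda>t. norm (f t) < norm a + 1 \<longrightarrow> dist (f t) (g t) \<le> \<epsilon> / 2) F"
        by (intro close) (auto simp: add_nonneg_pos)
      with nf show "eventually (\<lambda>t. dist (dist (f t) (g t)) 0 < \<epsilon>) F"
        by eventually_elim (use \<epsilon> in auto)
    qed
    then have "((\<lambda>t. f t - g t) \<longlongrightarrow> 0) F"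
      by (simp add: dist_norm tendsto_norm_zero_iff)
    from tendsto_diff[OF f this] have ga: "(g \<longlongrightarrow> a) F" by simp
    show ?thesis
    proof (cases e')
      case None
      then have "filterlim (\<lambda>t. norm (g t)) at_top F" using g by (simp add: tends_opc_def)
      then show ?thesis
        using not_tendsto_and_filterlim_at_infinity[OF F ga] by (simp add: filterlim_at_infinity_conv_norm_at_top)
    next
      case (Some b)
      then show ?thesis using g ga tendsto_unique[OF F] by (simp add: tends_opc_def)
    qed
  qed
  have c1: "eventually (\<lambda>t. norm (f t) < R \<longrightarrow> dist (f t) (g t) \<le> \<epsilon>) F"
    and c2: "eventually (\<lambda>t. norm (g t) < R \<longrightarrow> dist (g t) (f t) \<le> \<epsilon>) F" if "R > 0" "\<epsilon> > 0" for R \<epsilon>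
    using close[OF that] by (auto elim!: eventually_mono simp: dist_commute)
  show ?thesis
  proof (cases e)
    case (Some a) then show ?thesis using main[OF c1 _ g] f by (simp add: tends_opc_def)
  next
    case None
    then show ?thesis using main[OF c2 _ f] g by (cases e') (auto simp: tends_opc_def)
  qed
qed

lemma tends_opc_mirror: "tends_opc \<sigma> at_bot e \<longleftrightarrow> tends_opc (\<lambda>t. \<sigma> (- t)) at_top e"
  by (cases e) (simp_all add: tends_opc_def filterlim_at_bot_mirror)

section \<open>Affine invariance and the contradiction\<close>

lemma holo_disc_aff_map: "holo_disc f \<Longrightarrow> holo_disc (\<lambda>z. aff_map M b (f z))"
  unfolding holo_disc_def aff_map_def matrix_vector_mult_def by (auto intro!: holomorphic_intros)

lemma kob_dist_aff_map:
  assumes M: "invertible M" and \<Omega>: "cdom \<Omega>" "cdom (aff_map M b ` \<Omega>)" and xy: "x \<in> \<Omega>" "y \<in> \<Omega>"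
  shows "kob_dist (aff_map M b ` \<Omega>) (aff_map M b x) (aff_map M b y) = kob_dist \<Omega> x y"
proof (rule antisym)
  show "kob_dist (aff_map M b ` \<Omega>) (aff_map M b x) (aff_map M b y) \<le> kob_dist \<Omega> x y"
    by (rule kob_dist_contract[OF \<Omega> holo_disc_aff_map]) (use xy in auto)
  obtain M' where M': "M' ** M = mat 1" using M by (auto simp: invertible_def)
  define b' where "b' = - (M' *v b)"
  have inv: "aff_map M' b' (aff_map M b z) = z" for z
    by (simp add: aff_map_def b'_def matrix_vector_right_distrib matrix_vector_mul_assoc M')
  have "kob_dist \<Omega> (aff_map M' b' (aff_map M b x)) (aff_map M' b' (aff_map M b y))
      \<le> kob_dist (aff_map M b ` \<Omega>) (aff_map M b x) (aff_map M b y)"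
    by (rule kob_dist_contract[OF \<Omega>(2,1) holo_disc_aff_map]) (use xy inv in auto)
  then show "kob_dist \<Omega> x y \<le> kob_dist (aff_map M b ` \<Omega>) (aff_map M b x) (aff_map M b y)" by (simp add: inv)
qed

lemma almost_geod_map:
  assumes "almost_geod X d \<eta> c N" "\<And>x. x \<in> X \<Longrightarrow> f x \<in> Y" "\<And>x y. x \<in> X \<Longrightarrow> y \<in> X \<Longrightarrow> d' (f x) (f y) = d x y"
  shows "almost_geod Y d' \<eta> (\<lambda>i. f (c i)) N"
  using assms by (simp add: almost_geod_def)

theorem theorem1p12:
  fixes \<Omega> :: "(complex ^ 'n) set"
  assumes "C_proper \<Omega>" and "convex \<Omega>" and "open \<Omega>"
    and "\<forall>u::nat \<Rightarrow> complex ^ 'n. (\<forall>n. u n \<in> \<Omega>) \<longrightarrow>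
      (\<exists>r::nat \<Rightarrow> nat. \<exists>M::nat \<Rightarrow> complex ^ 'n ^ 'n. \<exists>b::nat \<Rightarrow> complex ^ 'n.
       \<exists>m::real. \<exists>\<Omega>h::(complex ^ 'n) set. \<exists>uinf.
         strict_mono r \<and> (\<forall>k. invertible (M k)) \<and> m > 0 \<and>
         C_proper \<Omega>h \<and> convex \<Omega>h \<and> open \<Omega>h \<and>
         local_hausdorff_conv (\<lambda>k. aff_map (M k) (b k) ` \<Omega>) \<Omega>h \<and>
         uinf \<in> \<Omega>h \<and> ((\<lambda>k. aff_map (M k) (b k) (u (r k))) \<longlongrightarrow> uinf) sequentially \<and>
         locally_m_convex_seq m (\<lambda>k. aff_map (M k) (b k) ` \<Omega>) \<and>
         (\<forall>\<sigma>. is_geodesic \<Omega>h \<sigma> \<longrightarrow> well_behaved \<sigma>))"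
  shows "gromov_hyperbolic \<Omega> (kob_dist \<Omega>)"
proof (rule ccontr)
  assume nh: "\<not> gromov_hyperbolic \<Omega> (kob_dist \<Omega>)"
  have \<Omega>: "cdom \<Omega>" using assms by (simp add: cdom_def)
  interpret pseudometric \<Omega> "kob_dist \<Omega>" by (rule pseudometric_kob[OF \<Omega>])
  let ?d = "kob_dist \<Omega>"
  \<comment> \<open>A triangle violating thinness for the step size \<open>1 / (n + 1)\<close> and
    the constant \<open>n\<close> at once. Thinness for one such pair would already give
    hyperbolicity, so there is a bad triangle for every \<open>n\<close>.\<close>
  define bad where "bad n \<gamma> N \<alpha> a \<beta> b i \<longleftrightarrow> almost_geod \<Omega> ?d (1 / (real n + 1)) \<gamma> N \<and>
    almost_geod \<Omega> ?d (1 / (real n + 1)) \<alpha> a \<and> almost_geod \<Omega> ?d (1 / (real n + 1)) \<beta> b \<and>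
    \<gamma> 0 = \<alpha> 0 \<and> \<alpha> a = \<beta> 0 \<and> \<beta> b = \<gamma> N \<and> i \<le> N \<and>
    (\<forall>j\<le>a. real n < ?d (\<gamma> i) (\<alpha> j)) \<and> (\<forall>j\<le>b. real n < ?d (\<gamma> i) (\<beta> j))" for n \<gamma> N \<alpha> a \<beta> b i
  have "\<exists>\<gamma> N \<alpha> a \<beta> b i. bad n \<gamma> N \<alpha> a \<beta> b i" for n
  proof (rule ccontr)
    assume c: "\<not> ?thesis"
    have "gromov_hyperbolic \<Omega> ?d"
    proof (rule thin_imp_gromov_hyperbolic[of "1 / (real n + 1)" "real n"])
      show "\<exists>c N. almost_geod \<Omega> ?d (1 / (real n + 1)) c N \<and> c 0 = x \<and> c N = y" if "x \<in> \<Omega>" "y \<in> \<Omega>" for x y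
        by (rule almost_geod_kob_ex[OF \<Omega> _ that]) simp
    qed (use c in \<open>auto simp: bad_def not_less\<close>)
    with nh show False by simp
  qed
  then obtain \<gamma> N \<alpha> a \<beta> b i where bad: "\<And>n. bad n (\<gamma> n) (N n) (\<alpha> n) (a n) (\<beta> n) (b n) (i n)" by metis
  have geods: "almost_geod \<Omega> ?d (1 / (real n + 1)) (\<gamma> n) (N n)"
      "almost_geod \<Omega> ?d (1 / (real n + 1)) (\<alpha> n) (a n)" "almost_geod \<Omega> ?d (1 / (real n + 1)) (\<beta> n) (b n)"
    and ends: "\<gamma> n 0 = \<alpha> n 0" "\<alpha> n (a n) = \<beta> n 0" "\<beta> n (b n) = \<gamma> n (N n)" and iN: "i n \<le> N n"
    and far0: "\<And>j. j \<le> a n \<Longrightarrow> real n < ?d (\<gamma> n (i n)) (\<alpha> n j)" "\<And>j. j \<le> b n \<Longrightarrow> real n < ?d (\<gamma> n (i n)) (\<beta> n j)" for n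
    using bad[of n] unfolding bad_def by blast+
  have mem: "j \<le> N n \<Longrightarrow> \<gamma> n j \<in> \<Omega>" "j \<le> a n \<Longrightarrow> \<alpha> n j \<in> \<Omega>" "j \<le> b n \<Longrightarrow> \<beta> n j \<in> \<Omega>" for n j
    using geods[of n] unfolding almost_geod_def by blast+
  define u where "u n = \<gamma> n (i n)" for n
  have u: "u n \<in> \<Omega>" for n unfolding u_def by (rule mem(1)[OF iN])
  then have all: "\<forall>n. u n \<in> \<Omega>" by simp
  from assms(4)[THEN spec, THEN mp, OF all]
  obtain r M c m \<Omega>h uinf where r: "strict_mono r" and M: "\<forall>k. invertible (M k)" and m: "m > 0"
    and \<Omega>h': "C_proper \<Omega>h" "convex \<Omega>h" "open \<Omega>h"
    and haus: "local_hausdorff_conv (\<lambda>k. aff_map (M k) (c k) ` \<Omega>) \<Omega>h"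
    and uinf: "uinf \<in> \<Omega>h" "(\<lambda>k. aff_map (M k) (c k) (u (r k))) \<longlonglongrightarrow> uinf"
    and lmc: "locally_m_convex_seq m (\<lambda>k. aff_map (M k) (c k) ` \<Omega>)"
    and wb: "\<forall>\<sigma>. is_geodesic \<Omega>h \<sigma> \<longrightarrow> well_behaved \<sigma>"
    by (elim exE conjE) (rule that)
  have \<Omega>h: "cdom \<Omega>h" using \<Omega>h' by (simp add: cdom_def)
  define F where "F k = aff_map (M k) (c k)" for k
  define A where "A k = F k ` \<Omega>" for k
  define \<eta> where "\<eta> k = 1 / (real (r k) + 1)" for k
  have cdA: "cdom (A k)" for k using lmc by (simp add: locally_m_convex_seq_def cdom_def A_def F_def)
  have iso: "kob_dist (A k) (F k x) (F k y) = ?d x y" if "x \<in> \<Omega>" "y \<in> \<Omega>" for k x y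
    unfolding A_def F_def by (rule kob_dist_aff_map[OF M[THEN spec] \<Omega> _ that]) (use cdA[of k] in \<open>simp add: A_def F_def\<close>)
  have FA: "F k x \<in> A k" if "x \<in> \<Omega>" for k x using that by (simp add: A_def)
  have ag: "almost_geod (A k) (kob_dist (A k)) (\<eta> k) (\<lambda>i. F k (p i)) q"
    if "almost_geod \<Omega> ?d (1 / (real (r k) + 1)) p q" for k p q
    unfolding \<eta>_def by (rule almost_geod_map[OF that FA iso])
  have rk: "real k \<le> real (r k)" for k using seq_suble[OF r] by simp
  have \<eta>: "\<eta> k > 0" for k by (simp add: \<eta>_def)
  have "filterlim (\<lambda>k. real (r k)) at_top sequentially"
    by (rule filterlim_at_top_mono[OF filterlim_real_sequentially]) (use rk in auto)
  then have "\<eta> \<longlonglongrightarrow> 0" unfolding \<eta>_def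
    by (intro real_tendsto_divide_at_top[where c = 1] filterlim_tendsto_add_at_top[OF tendsto_const] tendsto_const
        | simp add: add.commute[of _ 1])+
  have far: "real k < ?d (\<gamma> (r k) (i (r k))) (\<alpha> (r k) j)" if "j \<le> a (r k)" for k j
    using far0(1)[OF that] rk[of k] by linarith
  have far': "real k < ?d (\<gamma> (r k) (i (r k))) (\<beta> (r k) j)" if "j \<le> b (r k)" for k j
    using far0(2)[OF that] rk[of k] by linarith
  have g\<eta>: "almost_geod \<Omega> ?d (\<eta> k) (\<gamma> (r k)) (N (r k))" for k unfolding \<eta>_def by (rule geods)
  \<comment> \<open>The end points of the side also belong to the other two sides, so they are
    farther than \<open>k\<close> from the base point. Hence both halves grow without bound and the
    limit is a geodesic on the whole line.\<close>
  have left: "real k \<le> real (i (r k)) * \<eta> k" for k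
  proof -
    have "real k < ?d (\<gamma> (r k) (i (r k))) (\<gamma> (r k) 0)" using far[of 0 k] ends(1)[of "r k"] by simp
    also have "\<dots> = ?d (\<gamma> (r k) 0) (\<gamma> (r k) (i (r k)))" by (rule d_sym) (auto intro: mem iN)
    also have "\<dots> \<le> real (i (r k)) * \<eta> k" using almost_geod_upper[OF g\<eta>, of 0 "i (r k)" k] iN[of "r k"] by simp
    finally show ?thesis by simp
  qed
  have right: "real k \<le> real (N (r k) - i (r k)) * \<eta> k" for k
    using far'[of "b (r k)" k] ends(3)[of "r k"] almost_geod_upper[OF g\<eta>, of "i (r k)" "N (r k)" k] iN[of "r k"] by simp
  interpret rescaled_geods A \<Omega>h m "\<lambda>k. F k (u (r k))" uinf \<eta> "\<lambda>k j. F k (\<gamma> (r k) j)" "\<lambda>k. N (r k)" "\<lambda>k. i (r k)"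
  proof unfold_locales
    show "local_hausdorff_conv A \<Omega>h" using haus by (simp add: A_def[abs_def] F_def)
    show "locally_m_convex_seq m A" using lmc by (simp add: A_def[abs_def] F_def)
    show "(\<lambda>k. F k (u (r k))) \<longlonglongrightarrow> uinf" using uinf(2) by (simp add: F_def)
    show "almost_geod (A k) (kob_dist (A k)) (\<eta> k) (\<lambda>j. F k (\<gamma> (r k) j)) (N (r k))" for k
      by (rule ag[OF geods(1)])
    show "filterlim (\<lambda>k. real (i (r k)) * \<eta> k) at_top sequentially"
      by (rule filterlim_at_top_mono[OF filterlim_real_sequentially]) (use left in auto)
    show "filterlim (\<lambda>k. real (N (r k) - i (r k)) * \<eta> k) at_top sequentially"
      by (rule filterlim_at_top_mono[OF filterlim_real_sequentially]) (use right in auto)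
  qed (use cdA \<Omega>h m u uinf FA \<eta> \<open>\<eta> \<longlonglongrightarrow> 0\<close> iN in \<open>auto simp: u_def\<close>)
  obtain \<sigma> G where \<sigma>: "G \<noteq> bot" "G \<le> sequentially" "is_geodesic \<Omega>h \<sigma>" "\<And>t. ((\<lambda>n. rpath n t) \<longlongrightarrow> \<sigma> t) G"
    using limit_geodesic by blast
  have large: "eventually (\<lambda>k. D < real k) sequentially" for D
    using filterlim_real_sequentially by (simp add: filterlim_at_top_dense)
  have fa: "kob_dist (A k) (F k (u (r k))) (F k (\<alpha> (r k) j)) = ?d (\<gamma> (r k) (i (r k))) (\<alpha> (r k) j)" if "j \<le> a (r k)" for k j
    unfolding u_def by (rule iso) (auto intro: mem iN that)
  have fb: "kob_dist (A k) (F k (u (r k))) (F k (\<beta> (r k) j)) = ?d (\<gamma> (r k) (i (r k))) (\<beta> (r k) j)" if "j \<le> b (r k)" for k j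
    unfolding u_def by (rule iso) (auto intro: mem iN that)
  have close: "eventually (\<lambda>t. norm (\<sigma> t) < R \<or> norm (\<sigma> (- t)) < R \<longrightarrow> dist (\<sigma> t) (\<sigma> (- t)) \<le> \<epsilon>) at_top"
    if R: "R > 0" "\<epsilon> > 0" for R \<epsilon>
  proof -
    have e4: "\<epsilon> / 4 > 0" using R by simp
    have "\<exists>T0. \<forall>T\<ge>T0. eventually (\<lambda>n. norm (rpath n T) < R \<or> norm (rpath n (- T)) < R \<longrightarrow>
        dist (rpath n T) (rpath n (- T)) < 4 * (\<epsilon> / 4)) sequentially"
    proof (rule no_far_triangle[where \<alpha> = "\<lambda>k j. F k (\<alpha> (r k) j)" and \<beta> = "\<lambda>k j. F k (\<beta> (r k) j)"
          and a = "\<lambda>k. a (r k)" and b = "\<lambda>k. b (r k)", OF _ _ _ _ _ _ _ R(1) e4])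
      show "almost_geod (A k) (kob_dist (A k)) (\<eta> k) (\<lambda>j. F k (\<alpha> (r k) j)) (a (r k))"
        "almost_geod (A k) (kob_dist (A k)) (\<eta> k) (\<lambda>j. F k (\<beta> (r k) j)) (b (r k))" for k
        by (rule ag[OF geods(2)], rule ag[OF geods(3)])
      show "eventually (\<lambda>k. \<forall>j\<le>a (r k). D < kob_dist (A k) (F k (u (r k))) (F k (\<alpha> (r k) j))) sequentially" for D
        using large[of D] by eventually_elim (use far fa in \<open>auto intro: order.strict_trans\<close>)
      show "eventually (\<lambda>k. \<forall>j\<le>b (r k). D < kob_dist (A k) (F k (u (r k))) (F k (\<beta> (r k) j))) sequentially" for D
        using large[of D] by eventually_elim (use far' fb in \<open>auto intro: order.strict_trans\<close>)
    qed (simp_all add: ends)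
    then obtain T0 where T0: "\<And>T. T \<ge> T0 \<Longrightarrow> eventually (\<lambda>n. norm (rpath n T) < R \<or> norm (rpath n (- T)) < R \<longrightarrow>
        dist (rpath n T) (rpath n (- T)) < \<epsilon>) sequentially" by auto
    show ?thesis
      using eventually_ge_at_top[of T0]
    proof eventually_elim
      case (elim T)
      have ev: "eventually (\<lambda>n. norm (rpath n T) < R \<or> norm (rpath n (- T)) < R \<longrightarrow>
        dist (rpath n T) (rpath n (- T)) < \<epsilon>) G" by (rule filter_leD[OF \<sigma>(2) T0[OF elim]])
      show ?case
      proof
        assume "norm (\<sigma> T) < R \<or> norm (\<sigma> (- T)) < R"
        \<comment> \<open>The bound on the norm is strict, so it holds for the approximating paths
          along \<open>G\<close>; their distance estimate then passes to the limit as a weak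
          inequality.\<close>
        then have "eventually (\<lambda>n. norm (rpath n T) < R) G \<or> eventually (\<lambda>n. norm (rpath n (- T)) < R) G"
          using order_tendstoD(2)[OF tendsto_norm[OF \<sigma>(4)]] by blast
        then have "eventually (\<lambda>n. norm (rpath n T) < R \<or> norm (rpath n (- T)) < R) G"
          by (auto elim: eventually_mono)
        with ev have "eventually (\<lambda>n. dist (rpath n T) (rpath n (- T)) \<le> \<epsilon>) G"
          by eventually_elim auto
        then show "dist (\<sigma> T) (\<sigma> (- T)) \<le> \<epsilon>"
          by (rule tendsto_upperbound[OF tendsto_dist[OF \<sigma>(4) \<sigma>(4)] _ \<sigma>(1)])
      qed
    qed
  qed
  obtain e1 e2 where e: "tends_opc \<sigma> at_bot e1" "tends_opc \<sigma> at_top e2" "e1 \<noteq> e2"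
    using wb \<sigma>(3) by (auto simp: well_behaved_def)
  \<comment> \<open>The backward end of \<open>\<sigma>\<close> is the forward end of
    \<open>\<lambda>t. \<sigma> (- t)\<close>.\<close>
  have "e2 = e1"
    by (rule tends_opc_unique[OF close _ e(2)]) (use e(1) tends_opc_mirror in auto)
  with e(3) show False by simp
qed

end
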